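(* Let $d\in\mathbb{N}$ and let $\mathcal{H}$ be a Hilbert space. Let $X$ be the space of all commuting $d$-tuples $\{S_i\}_{i=1}^d$ of contractions on $\mathcal{H}$ endowed with the weak polynomial topology ($\mathrm{PW}$), and let $X^*\subseteq X$ be the set of those $d$-tuples which have strictly non-commuting free dilations. If $d\le 2$, then $X^*=\emptyset$. If $d\ge 3$ and $\mathcal{H}$ is infinite-dimensional, then $X^*\neq\emptyset$. If furthermore $\mathcal{H}$ is separable, then $X^*$ is residual in $(X,\mathrm{PW})$, i.e. almost all (in the Baire-category sense) commuting $d$-tuples of contractions have strictly non-commuting free dilations.
   Context: The topology $\mathrm{PW}$ on $X$ is given by: $\{S^{(\alpha)}_i\}_{i=1}^d\to\{S_i\}_{i=1}^d$ iff $\prod_{i=1}^d(S_i^{(\alpha)})^{n_i}\to\prod_{i=1}^dS_i^{n_i}$ in the weak operator topology for all $(n_i)_{i=1}^d\in\mathbb{N}_0^d$. A (discrete-time) free unitary dilation of $(\mathcal{H},\{S_i\}_{i=1}^d)$ is a triple $(\mathcal{H}',r,\{V_i\}_{i=1}^d)$ of a Hilbert space $\mathcal{H}'$, an isometry $r:\mathcal{H}\to\mathcal{H}'$ and unitaries $V_i$ on $\mathcal{H}'$ such that $\prod_{k=1}^NS_{i_k}^{n_k}=r^*\big(\prod_{k=1}^NV_{i_k}^{n_k}\big)r$ for all $N\in\mathbb{N}$, all $(i_k)_{k=1}^N\subseteq\{1,\ldots,d\}$ and all $(n_k)_{k=1}^N\subseteq\mathbb{N}_0$ (products ordered left to right).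 $\{S_i\}_{i=1}^d\in X$ has strictly non-commuting free dilations if none of its free unitary dilations consists of commuting unitaries. A subset is residual if its complement is meagre. *)

theory Defs
  imports "HOL-Analysis.Analysis"
begin

section \<open>Complex Hilbert spaces\<close>

class complex_inner = real_normed_vector +
  fixes scaleC :: "complex \<Rightarrow> 'a \<Rightarrow> 'a" (infixr \<open>*\<^sub>C\<close> 75)
    and cinner :: "'a \<Rightarrow> 'a \<Rightarrow> complex"
  assumes scaleC_add_right: "a *\<^sub>C (x + y) = a *\<^sub>C x + a *\<^sub>C y"
    and scaleC_add_left: "(a + b) *\<^sub>C x = a *\<^sub>C x + b *\<^sub>C x"
    and scaleC_scaleC: "a *\<^sub>C b *\<^sub>C x = (a * b) *\<^sub>C x"
    and scaleR_scaleC: "r *\<^sub>R x = complex_of_real r *\<^sub>C x"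
    and cinner_commute: "cinner x y = cnj (cinner y x)"
    and cinner_add_left: "cinner (x + y) z = cinner x z + cinner y z"
    and cinner_scaleC_left: "cinner (a *\<^sub>C x) y = a * cinner x y"
    and norm_eq_sqrt_cinner: "norm x = sqrt (Re (cinner x x))"

class chilbert_space = complex_inner + complete_space

interpretation complex_vector: vector_space "scaleC :: complex \<Rightarrow> 'a \<Rightarrow> 'a::complex_inner"
proof
  show "1 *\<^sub>C x = x" for x :: 'a
    using scaleR_scaleC [of 1 x] by simp
qed (simp_all add: scaleC_add_right scaleC_add_left scaleC_scaleC)

definition infinite_dimensional :: "'h::complex_inner itself \<Rightarrow> bool" where
  "infinite_dimensional _ \<longleftrightarrow> \<not> (\<exists>B :: 'h set. finite B \<and> complex_vector.span B = UNIV)"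

definition bounded_clinear :: "('h::complex_inner \<Rightarrow> 'h) \<Rightarrow> bool" where
  "bounded_clinear T \<longleftrightarrow> bounded_linear T \<and> (\<forall>a x. T (a *\<^sub>C x) = a *\<^sub>C T x)"

definition contraction :: "('h::complex_inner \<Rightarrow> 'h) \<Rightarrow> bool" where
  "contraction T \<longleftrightarrow> bounded_clinear T \<and> onorm T \<le> 1"

section \<open>Commuting tuples of contractions and the weak polynomial topology\<close>

text \<open>A \<open>d\<close>-tuple is a function on \<open>{1..d}\<close>, extended by \<^const>\<open>undefined\<close> outside.\<close>

definition commuting_contractions :: "nat \<Rightarrow> (nat \<Rightarrow> 'h::complex_inner \<Rightarrow> 'h) set" where
  "commuting_contractions d =
     {S \<in> {1..d} \<rightarrow>\<^sub>E {T. contraction T}. \<forall>i\<in>{1..d}. \<forall>j\<in>{1..d}. S i \<circ> S j = S j \<circ> S i}"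

text \<open>\<open>word_prod S [(i\<^sub>1, n\<^sub>1), \<dots>, (i\<^sub>N, n\<^sub>N)]\<close> is the product of the powers \<open>S i\<^sub>k ^^ n\<^sub>k\<close>
  from left to right, so the rightmost factor is applied first.\<close>

definition word_prod :: "(nat \<Rightarrow> 'a \<Rightarrow> 'a) \<Rightarrow> (nat \<times> nat) list \<Rightarrow> 'a \<Rightarrow> 'a" where
  "word_prod S ws = foldr (\<lambda>(i, n) T. (S i ^^ n) \<circ> T) ws id"

definition monomial :: "nat \<Rightarrow> (nat \<Rightarrow> 'a \<Rightarrow> 'a) \<Rightarrow> (nat \<Rightarrow> nat) \<Rightarrow> 'a \<Rightarrow> 'a" where
  "monomial d S n = word_prod S (map (\<lambda>i. (i, n i)) [1..<Suc d])"

definition weak_operator_topology :: "('h::complex_inner \<Rightarrow> 'h) topology" where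
  "weak_operator_topology =
     pullback_topology {T. bounded_clinear T} (\<lambda>T x y. cinner (T x) y) euclidean"

definition weak_polynomial_topology :: "nat \<Rightarrow> (nat \<Rightarrow> 'h::complex_inner \<Rightarrow> 'h) topology" where
  "weak_polynomial_topology d =
     pullback_topology (commuting_contractions d) (monomial d)
       (product_topology (\<lambda>_. weak_operator_topology) UNIV)"

lemma limitin_pullback_topology:
  "limitin (pullback_topology A f T) g l F \<longleftrightarrow>
     l \<in> A \<and> (\<forall>\<^sub>F a in F. g a \<in> A) \<and> limitin T (\<lambda>a. f (g a)) (f l) F"
proof (intro iffI conjI)
  assume L: "limitin (pullback_topology A f T) g l F"
  then have l: "l \<in> A" "f l \<in> topspace T"
    by (auto simp: limitin_def topspace_pullback_topology)
  have *: "\<forall>\<^sub>F a in F. g a \<in> f -` U \<inter> A" if "openin T U" "f l \<in> U" for U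
    using L that l unfolding limitin_def openin_pullback_topology by blast
  show "l \<in> A" by (fact l)
  show "\<forall>\<^sub>F a in F. g a \<in> A"
    using * [OF openin_topspace l(2)] by (rule eventually_mono) simp
  show "limitin T (\<lambda>a. f (g a)) (f l) F"
    unfolding limitin_def
  proof (intro conjI allI impI)
    fix U assume "openin T U \<and> f l \<in> U"
    then show "\<forall>\<^sub>F a in F. f (g a) \<in> U"
      using * [of U] by (auto elim: eventually_mono)
  qed (fact l)
next
  assume R: "l \<in> A \<and> (\<forall>\<^sub>F a in F. g a \<in> A) \<and> limitin T (\<lambda>a. f (g a)) (f l) F"
  show "limitin (pullback_topology A f T) g l F"
    unfolding limitin_def
  proof (intro conjI allI impI)
    show "l \<in> topspace (pullback_topology A f T)"
      using R by (auto simp: limitin_def topspace_pullback_topology)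
    fix U assume "openin (pullback_topology A f T) U \<and> l \<in> U"
    then obtain W where W: "openin T W" "f l \<in> W" "U = f -` W \<inter> A"
      by (auto simp: openin_pullback_topology)
    have "\<forall>\<^sub>F a in F. f (g a) \<in> W"
      using R W by (simp add: limitin_def)
    moreover have "\<forall>\<^sub>F a in F. g a \<in> A"
      using R by blast
    ultimately show "\<forall>\<^sub>F a in F. g a \<in> U"
      by eventually_elim (simp add: W)
  qed
qed

text \<open>Convergence in the two topologies just defined, for arbitrary nets.\<close>

lemma limitin_weak_operator_topology:
  "limitin weak_operator_topology T T0 F \<longleftrightarrow>
     bounded_clinear T0 \<and> (\<forall>\<^sub>F a in F. bounded_clinear (T a)) \<and>
     (\<forall>x y. ((\<lambda>a. cinner (T a x) y) \<longlongrightarrow> cinner (T0 x) y) F)"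
  unfolding weak_operator_topology_def limitin_pullback_topology
  by (simp add: limitin_componentwise flip: euclidean_product_topology)

lemma bounded_clinear_id: "bounded_clinear id"
  by (simp add: bounded_clinear_def bounded_linear_ident id_def)

lemma bounded_clinear_comp:
  "bounded_clinear T \<Longrightarrow> bounded_clinear U \<Longrightarrow> bounded_clinear (T \<circ> U)"
  by (auto simp: bounded_clinear_def o_def intro: bounded_linear_compose)

lemma bounded_clinear_pow: "bounded_clinear T \<Longrightarrow> bounded_clinear (T ^^ n)"
  by (induction n) (auto intro: bounded_clinear_comp simp: bounded_clinear_id)

lemma bounded_clinear_word_prod:
  "(\<And>i. i \<in> fst ` set ws \<Longrightarrow> bounded_clinear (S i)) \<Longrightarrow> bounded_clinear (word_prod S ws)"
  unfolding word_prod_def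
  by (induction ws)
    (auto intro!: bounded_clinear_comp bounded_clinear_pow simp: bounded_clinear_id)

lemma bounded_clinear_monomial:
  "S \<in> commuting_contractions d \<Longrightarrow> bounded_clinear (monomial d S n)"
  unfolding monomial_def
  by (rule bounded_clinear_word_prod)
    (auto simp: commuting_contractions_def contraction_def PiE_iff)

lemma topspace_weak_polynomial_topology:
  "topspace (weak_polynomial_topology d) = commuting_contractions d"
  by (auto simp: weak_polynomial_topology_def weak_operator_topology_def
      topspace_pullback_topology bounded_clinear_monomial)

lemma limitin_weak_polynomial_topology:
  "limitin (weak_polynomial_topology d) S S0 F \<longleftrightarrow>
     S0 \<in> commuting_contractions d \<and> (\<forall>\<^sub>F a in F. S a \<in> commuting_contractions d) \<and>
     (\<forall>n. limitin weak_operator_topology (\<lambda>a. monomial d (S a) n) (monomial d S0 n) F)"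
proof -
  have "\<forall>\<^sub>F a in F. monomial d (S a) \<in> UNIV \<rightarrow>\<^sub>E topspace weak_operator_topology"
    if "\<forall>\<^sub>F a in F. S a \<in> commuting_contractions d"
    using that
    by (rule eventually_mono)
      (auto simp: weak_operator_topology_def topspace_pullback_topology bounded_clinear_monomial)
  then show ?thesis
    unfolding weak_polynomial_topology_def limitin_pullback_topology
    by (auto simp: limitin_componentwise)
qed

section \<open>Free unitary dilations\<close>

text \<open>The dilating space is an arbitrary Hilbert space that has to be quantified over inside a
  definition. It is therefore given by explicit operations on a carrier set instead of by a
  type class.\<close>

record 'k hilbert =
  hcarrier :: "'k set"
  hzero :: 'k
  hadd :: "'k \<Rightarrow> 'k \<Rightarrow> 'k"
  hscale :: "complex \<Rightarrow> 'k \<Rightarrow> 'k"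
  hinner :: "'k \<Rightarrow> 'k \<Rightarrow> complex"

definition hnorm :: "'k hilbert \<Rightarrow> 'k \<Rightarrow> real" where
  "hnorm K x = sqrt (Re (hinner K x x))"

definition hdist :: "'k hilbert \<Rightarrow> 'k \<Rightarrow> 'k \<Rightarrow> real" where
  "hdist K x y = hnorm K (hadd K x (hscale K (-1) y))"

locale hilbert =
  fixes K :: "'k hilbert"
  assumes zero_closed: "hzero K \<in> hcarrier K"
    and add_closed: "\<lbrakk>x \<in> hcarrier K; y \<in> hcarrier K\<rbrakk> \<Longrightarrow> hadd K x y \<in> hcarrier K"
    and scale_closed: "x \<in> hcarrier K \<Longrightarrow> hscale K a x \<in> hcarrier K"
    and add_assoc: "\<lbrakk>x \<in> hcarrier K; y \<in> hcarrier K; z \<in> hcarrier K\<rbrakk>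
      \<Longrightarrow> hadd K (hadd K x y) z = hadd K x (hadd K y z)"
    and add_commute: "\<lbrakk>x \<in> hcarrier K; y \<in> hcarrier K\<rbrakk> \<Longrightarrow> hadd K x y = hadd K y x"
    and add_zero: "x \<in> hcarrier K \<Longrightarrow> hadd K x (hzero K) = x"
    and add_inverse: "x \<in> hcarrier K \<Longrightarrow> \<exists>y\<in>hcarrier K. hadd K x y = hzero K"
    and scale_add_right: "\<lbrakk>x \<in> hcarrier K; y \<in> hcarrier K\<rbrakk>
      \<Longrightarrow> hscale K a (hadd K x y) = hadd K (hscale K a x) (hscale K a y)"
    and scale_add_left: "x \<in> hcarrier K
      \<Longrightarrow> hscale K (a + b) x = hadd K (hscale K a x) (hscale K b x)"
    and scale_scale: "x \<in> hcarrier K \<Longrightarrow> hscale K a (hscale K b x) = hscale K (a * b) x"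
    and scale_one: "x \<in> hcarrier K \<Longrightarrow> hscale K 1 x = x"
    and inner_commute: "\<lbrakk>x \<in> hcarrier K; y \<in> hcarrier K\<rbrakk> \<Longrightarrow> hinner K x y = cnj (hinner K y x)"
    and inner_add_left: "\<lbrakk>x \<in> hcarrier K; y \<in> hcarrier K; z \<in> hcarrier K\<rbrakk>
      \<Longrightarrow> hinner K (hadd K x y) z = hinner K x z + hinner K y z"
    and inner_scale_left: "\<lbrakk>x \<in> hcarrier K; y \<in> hcarrier K\<rbrakk>
      \<Longrightarrow> hinner K (hscale K a x) y = a * hinner K x y"
    and inner_pos: "\<lbrakk>x \<in> hcarrier K; x \<noteq> hzero K\<rbrakk> \<Longrightarrow> 0 < Re (hinner K x x)"
    and complete: "\<lbrakk>range \<sigma> \<subseteq> hcarrier K;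
        \<forall>e>0. \<exists>N. \<forall>m\<ge>N. \<forall>n\<ge>N. hdist K (\<sigma> m) (\<sigma> n) < e\<rbrakk>
      \<Longrightarrow> \<exists>x\<in>hcarrier K. (\<lambda>n. hdist K (\<sigma> n) x) \<longlonglongrightarrow> 0"

definition isometry_into :: "'k hilbert \<Rightarrow> ('h::complex_inner \<Rightarrow> 'k) \<Rightarrow> bool" where
  "isometry_into K r \<longleftrightarrow>
     range r \<subseteq> hcarrier K \<and>
     (\<forall>x y. r (x + y) = hadd K (r x) (r y)) \<and>
     (\<forall>a x. r (a *\<^sub>C x) = hscale K a (r x)) \<and>
     (\<forall>x. hnorm K (r x) = norm x)"

definition unitary_on :: "'k hilbert \<Rightarrow> ('k \<Rightarrow> 'k) \<Rightarrow> bool" where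
  "unitary_on K V \<longleftrightarrow>
     bij_betw V (hcarrier K) (hcarrier K) \<and>
     (\<forall>x\<in>hcarrier K. \<forall>y\<in>hcarrier K. V (hadd K x y) = hadd K (V x) (V y)) \<and>
     (\<forall>a. \<forall>x\<in>hcarrier K. V (hscale K a x) = hscale K a (V x)) \<and>
     (\<forall>x\<in>hcarrier K. \<forall>y\<in>hcarrier K. hinner K (V x) (V y) = hinner K x y)"

definition hadjoint :: "'k hilbert \<Rightarrow> ('h::complex_inner \<Rightarrow> 'k) \<Rightarrow> 'k \<Rightarrow> 'h" where
  "hadjoint K r y = (THE z. \<forall>x. cinner x z = hinner K (r x) y)"

definition free_unitary_dilation ::
  "nat \<Rightarrow> (nat \<Rightarrow> 'h::complex_inner \<Rightarrow> 'h) \<Rightarrow> 'k hilbert \<Rightarrow> ('h \<Rightarrow> 'k) \<Rightarrow> (nat \<Rightarrow> 'k \<Rightarrow> 'k) \<Rightarrow> bool"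
  where
  "free_unitary_dilation d S K r V \<longleftrightarrow>
     hilbert K \<and> isometry_into K r \<and> (\<forall>i\<in>{1..d}. unitary_on K (V i)) \<and>
     (\<forall>ws. ws \<noteq> [] \<and> fst ` set ws \<subseteq> {1..d} \<longrightarrow>
        word_prod S ws = hadjoint K r \<circ> word_prod V ws \<circ> r)"

definition commuting_on :: "nat \<Rightarrow> 'k hilbert \<Rightarrow> (nat \<Rightarrow> 'k \<Rightarrow> 'k) \<Rightarrow> bool" where
  "commuting_on d K V \<longleftrightarrow>
     (\<forall>i\<in>{1..d}. \<forall>j\<in>{1..d}. \<forall>x\<in>hcarrier K. V i (V j x) = V j (V i x))"

text \<open>Since types cannot be quantified over, the carriers of the dilating spaces below are subsets
  of the type of sequences in \<open>'h\<close>. This is no restriction: every free unitary dilation, on a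
  Hilbert space over any type whatsoever, restricts to the closed reducing subspace generated by
  the image of \<open>r\<close>, whose cardinality is at most that of \<open>nat \<Rightarrow> 'h\<close>. See
  \<open>strictly_noncommutingD\<close> below.\<close>

definition strictly_noncommuting :: "nat \<Rightarrow> (nat \<Rightarrow> 'h::complex_inner \<Rightarrow> 'h) \<Rightarrow> bool" where
  "strictly_noncommuting d S \<longleftrightarrow>
     \<not> (\<exists>(K :: (nat \<Rightarrow> 'h) hilbert) r V. free_unitary_dilation d S K r V \<and> commuting_on d K V)"

definition strictly_noncommuting_tuples :: "nat \<Rightarrow> (nat \<Rightarrow> 'h::complex_inner \<Rightarrow> 'h) set" where
  "strictly_noncommuting_tuples d = {S \<in> commuting_contractions d. strictly_noncommuting d S}"

section \<open>Baire category\<close>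

definition nowhere_dense_in :: "'a topology \<Rightarrow> 'a set \<Rightarrow> bool" where
  "nowhere_dense_in X A \<longleftrightarrow> A \<subseteq> topspace X \<and> X interior_of (X closure_of A) = {}"

definition meagre_in :: "'a topology \<Rightarrow> 'a set \<Rightarrow> bool" where
  "meagre_in X A \<longleftrightarrow> (\<exists>\<F>. countable \<F> \<and> (\<forall>N\<in>\<F>. nowhere_dense_in X N) \<and> A = \<Union>\<F>)"

definition residual_in :: "'a topology \<Rightarrow> 'a set \<Rightarrow> bool" where
  "residual_in X A \<longleftrightarrow> A \<subseteq> topspace X \<and> meagre_in X (topspace X - A)"

section \<open>Independence of the type carrying the dilating space\<close>

definition transport :: "'k hilbert \<Rightarrow> 'k set \<Rightarrow> ('k \<Rightarrow> 'l) \<Rightarrow> 'l hilbert" where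
  "transport K M e =
     \<lparr>hcarrier = e ` M,
      hzero = e (hzero K),
      hadd = \<lambda>x y. e (hadd K (inv_into M e x) (inv_into M e y)),
      hscale = \<lambda>a x. e (hscale K a (inv_into M e x)),
      hinner = \<lambda>x y. hinner K (inv_into M e x) (inv_into M e y)\<rparr>"

context hilbert
begin

abbreviation "C \<equiv> hcarrier K"
abbreviation add (infixl \<open>\<oplus>\<close> 65) where "x \<oplus> y \<equiv> hadd K x y"
abbreviation scl (infixr \<open>\<odot>\<close> 75) where "a \<odot> x \<equiv> hscale K a x"
abbreviation ip (\<open>\<langle>_, _\<rangle>\<close>) where "\<langle>x, y\<rangle> \<equiv> hinner K x y"

lemmas closed = zero_closed add_closed scale_closed

lemma scale_zero: "x \<in> C \<Longrightarrow> 0 \<odot> x = hzero K"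
proof -
  assume x: "x \<in> C"
  have e: "0 \<odot> x \<oplus> 0 \<odot> x = 0 \<odot> x"
    using scale_add_left [OF x, of 0 0] by simp
  obtain y where y: "y \<in> C" "0 \<odot> x \<oplus> y = hzero K"
    using add_inverse [of "0 \<odot> x"] x closed by blast
  have "0 \<odot> x \<oplus> (0 \<odot> x \<oplus> y) = 0 \<odot> x \<oplus> y"
    using add_assoc [of "0 \<odot> x" "0 \<odot> x" y] e x y closed by simp
  then show ?thesis
    using y x closed add_zero by simp
qed

lemma inner_zero_left: "y \<in> C \<Longrightarrow> \<langle>hzero K, y\<rangle> = 0"
  using inner_scale_left [of "hzero K" y 0] scale_zero zero_closed by simp

lemma inner_add_right:
  "\<lbrakk>x \<in> C; y \<in> C; z \<in> C\<rbrakk> \<Longrightarrow> \<langle>z, x \<oplus> y\<rangle> = \<langle>z, x\<rangle> + \<langle>z, y\<rangle>"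
  using inner_commute [of z] inner_add_left [of x y z] closed by simp

lemma inner_scale_right:
  "\<lbrakk>x \<in> C; z \<in> C\<rbrakk> \<Longrightarrow> \<langle>z, a \<odot> x\<rangle> = cnj a * \<langle>z, x\<rangle>"
  using inner_commute [of z] inner_scale_left [of x z a] closed by simp

lemma eqI:
  assumes "x \<in> C" "y \<in> C" "\<And>z. z \<in> C \<Longrightarrow> \<langle>x, z\<rangle> = \<langle>y, z\<rangle>"
  shows "x = y"
proof -
  let ?w = "x \<oplus> (-1) \<odot> y"
  have w: "?w \<in> C" using assms closed by simp
  have "\<langle>?w, ?w\<rangle> = 0"
    using assms w closed by (simp add: inner_add_left inner_scale_left)
  then have w0: "?w = hzero K"
    using inner_pos [OF w] by force
  have n: "(-1) \<odot> y \<oplus> y = hzero K"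
    using scale_add_left [of y "-1" 1] scale_one scale_zero assms by simp
  have "x = x \<oplus> ((-1) \<odot> y \<oplus> y)"
    using n add_zero assms by simp
  also have "\<dots> = ?w \<oplus> y"
    using add_assoc [of x "(-1) \<odot> y" y] assms closed by simp
  also have "\<dots> = y"
    using w0 add_commute [of "hzero K" y] add_zero assms closed by simp
  finally show ?thesis .
qed

lemma inner_self_nonneg: "x \<in> C \<Longrightarrow> 0 \<le> Re \<langle>x, x\<rangle>"
  using inner_pos [of x] inner_zero_left [of x] by (cases "x = hzero K") auto

lemma Re_commute: "\<lbrakk>x \<in> C; y \<in> C\<rbrakk> \<Longrightarrow> Re \<langle>x, y\<rangle> = Re \<langle>y, x\<rangle>"
  using inner_commute [of x y] by simp

lemma hdist_sq:
  assumes "x \<in> C" "y \<in> C"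
  shows "(hdist K x y)\<^sup>2 = Re \<langle>x, x\<rangle> - 2 * Re \<langle>x, y\<rangle> + Re \<langle>y, y\<rangle>"
proof -
  let ?w = "x \<oplus> (-1) \<odot> y"
  have w: "?w \<in> C" using assms closed by simp
  have "(hdist K x y)\<^sup>2 = Re \<langle>?w, ?w\<rangle>"
    using inner_self_nonneg [OF w] by (simp add: hdist_def hnorm_def)
  also have "\<dots> = Re \<langle>x, x\<rangle> - 2 * Re \<langle>x, y\<rangle> + Re \<langle>y, y\<rangle>"
    using assms w closed Re_commute [OF assms]
    by (simp add: inner_add_left inner_scale_left inner_add_right inner_scale_right)
  finally show ?thesis .
qed

lemma hdist_nonneg: "\<lbrakk>x \<in> C; y \<in> C\<rbrakk> \<Longrightarrow> 0 \<le> hdist K x y"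
  using inner_self_nonneg [of "x \<oplus> (-1) \<odot> y"] closed by (simp add: hdist_def hnorm_def)

lemma Re_inner_le:
  assumes "x \<in> C" "y \<in> C"
  shows "Re \<langle>x, y\<rangle> \<le> hnorm K x * hnorm K y"
proof -
  let ?a = "Re \<langle>x, x\<rangle>" and ?b = "Re \<langle>y, y\<rangle>" and ?c = "Re \<langle>x, y\<rangle>"
  have q: "0 \<le> s\<^sup>2 * ?a + 2 * s * t * ?c + t\<^sup>2 * ?b" for s t :: real
  proof -
    let ?w = "complex_of_real s \<odot> x \<oplus> complex_of_real t \<odot> y"
    have w: "?w \<in> C" using assms closed by simp
    have "Re \<langle>?w, ?w\<rangle> = s\<^sup>2 * ?a + 2 * s * t * ?c + t\<^sup>2 * ?b"
      using assms w closed Re_commute [OF assms]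
      by (simp add: inner_add_left inner_scale_left inner_add_right inner_scale_right
          power2_eq_square algebra_simps)
    then show ?thesis
      using inner_self_nonneg [OF w] by simp
  qed
  have a: "0 \<le> ?a" and b: "0 \<le> ?b"
    using assms inner_self_nonneg by auto
  have "?c\<^sup>2 \<le> ?a * ?b"
  proof (cases "?b = 0")
    case True
    then have "y = hzero K" using inner_pos [OF assms(2)] by force
    then have "?c = 0"
      using inner_zero_left [OF assms(1)] Re_commute [OF assms] by simp
    then show ?thesis using a b by simp
  next
    case False
    have "0 \<le> ?b * (?a * ?b - ?c\<^sup>2)"
      using q [of "?b" "- ?c"] by (simp add: power2_eq_square algebra_simps)
    then show ?thesis
      using False b by (simp add: zero_le_mult_iff)
  qed
  then have "\<bar>?c\<bar> \<le> sqrt (?a * ?b)"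
    using real_le_rsqrt by (metis abs_le_square_iff real_sqrt_abs real_sqrt_le_mono)
  then show ?thesis
    by (simp add: hnorm_def real_sqrt_mult)
qed

lemma hdist_triangle:
  assumes "x \<in> C" "y \<in> C" "z \<in> C"
  shows "hdist K x z \<le> hdist K x y + hdist K y z"
proof (rule power2_le_imp_le)
  let ?a = "x \<oplus> (-1) \<odot> y" and ?b = "y \<oplus> (-1) \<odot> z"
  have ab: "?a \<in> C" "?b \<in> C" using assms closed by auto
  have "(hdist K x z)\<^sup>2 = (hdist K x y)\<^sup>2 + 2 * Re \<langle>?a, ?b\<rangle> + (hdist K y z)\<^sup>2"
    using assms ab closed
    by (simp add: hdist_sq inner_add_left inner_scale_left inner_add_right inner_scale_right)
  also have "\<dots> \<le> (hdist K x y)\<^sup>2 + 2 * (hdist K x y * hdist K y z) + (hdist K y z)\<^sup>2"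
    using Re_inner_le [OF ab] by (simp add: hdist_def)
  finally show "(hdist K x z)\<^sup>2 \<le> (hdist K x y + hdist K y z)\<^sup>2"
    by (simp add: power2_eq_square algebra_simps)
  show "0 \<le> hdist K x y + hdist K y z"
    using hdist_nonneg assms by simp
qed

lemma hdist_commute: "\<lbrakk>x \<in> C; y \<in> C\<rbrakk> \<Longrightarrow> hdist K x y = hdist K y x"
  using hdist_sq [of x y] hdist_sq [of y x] hdist_nonneg Re_commute [of x y]
  by (metis (no_types, opaque_lifting) add.commute add_diff_eq diff_add_eq power2_eq_iff_nonneg)

lemma hdist_zero_iff:
  assumes "x \<in> C" "y \<in> C"
  shows "hdist K x y = 0 \<longleftrightarrow> x = y"
proof
  assume "hdist K x y = 0"
  let ?w = "x \<oplus> (-1) \<odot> y"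
  have w: "?w \<in> C" using assms closed by simp
  have "?w = hzero K"
    using \<open>hdist K x y = 0\<close> inner_pos [OF w] by (force simp: hdist_def hnorm_def)
  then have "\<langle>x, z\<rangle> = \<langle>y, z\<rangle>" if "z \<in> C" for z
    using inner_zero_left [OF that] inner_add_left [of x "(-1) \<odot> y" z]
      inner_scale_left [of y z "-1"] assms that closed by simp
  then show "x = y" using eqI assms by blast
next
  assume "x = y"
  then show "hdist K x y = 0"
    using hdist_sq [OF assms] by simp
qed

lemma transport_hilbert:
  fixes e :: "'k \<Rightarrow> 'l"
  assumes M: "M \<subseteq> C" and e: "inj_on e M"
    and zero: "hzero K \<in> M"
    and add: "\<And>x y. x \<in> M \<Longrightarrow> y \<in> M \<Longrightarrow> x \<oplus> y \<in> M"
    and scl: "\<And>a x. x \<in> M \<Longrightarrow> a \<odot> x \<in> M"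
    and cl: "\<And>\<sigma> x. range \<sigma> \<subseteq> M \<Longrightarrow> x \<in> C \<Longrightarrow> (\<lambda>n. hdist K (\<sigma> n) x) \<longlonglongrightarrow> 0 \<Longrightarrow> x \<in> M"
  shows "hilbert (transport K M e)"
proof -
  let ?T = "transport K M e"
  note d = inv_into_f_f [OF e]
  have sub: "x \<in> C" if "x \<in> M" for x using M that by blast
  have dist: "hdist ?T (e x) (e y) = hdist K x y" if "x \<in> M" "y \<in> M" for x y
    using that by (simp add: transport_def hdist_def hnorm_def d add scl)
  show ?thesis
  proof
    fix \<sigma> :: "nat \<Rightarrow> 'l"
    assume r: "range \<sigma> \<subseteq> hcarrier ?T"
      and c: "\<forall>\<epsilon>>0. \<exists>N. \<forall>m\<ge>N. \<forall>n\<ge>N. hdist ?T (\<sigma> m) (\<sigma> n) < \<epsilon>"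
    have "\<forall>n. \<exists>x\<in>M. \<sigma> n = e x"
      using r by (auto simp: transport_def)
    then obtain \<tau> where \<tau>: "\<And>n. \<tau> n \<in> M" "\<And>n. \<sigma> n = e (\<tau> n)"
      by metis
    have "\<exists>x\<in>C. (\<lambda>n. hdist K (\<tau> n) x) \<longlonglongrightarrow> 0"
      using c \<tau> sub by (intro complete) (auto simp: dist)
    then obtain x where x: "x \<in> C" "(\<lambda>n. hdist K (\<tau> n) x) \<longlonglongrightarrow> 0"
      by blast
    have "x \<in> M" using cl [OF _ x] \<tau> by blast
    then have "(\<lambda>n. hdist ?T (\<sigma> n) (e x)) \<longlonglongrightarrow> 0"
      using x \<tau> by (simp add: dist)
    then show "\<exists>x\<in>hcarrier ?T. (\<lambda>n. hdist ?T (\<sigma> n) x) \<longlonglongrightarrow> 0"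
      using \<open>x \<in> M\<close> by (intro bexI [of _ "e x"]) (auto simp: transport_def)
  next
    fix x assume "x \<in> hcarrier ?T"
    then obtain u where u: "u \<in> M" "x = e u" by (auto simp: transport_def)
    have "(-1) \<odot> u \<in> M" using u scl by blast
    moreover have "u \<oplus> (-1) \<odot> u = hzero K"
      using scale_add_left [of u 1 "-1"] scale_one scale_zero u sub by simp
    ultimately show "\<exists>y\<in>hcarrier ?T. hadd ?T x y = hzero ?T"
      using u by (intro bexI [of _ "e ((-1) \<odot> u)"]) (auto simp: transport_def d)
  next
    fix x y assume "x \<in> hcarrier ?T" "y \<in> hcarrier ?T"
    then show "hadd ?T x y = hadd ?T y x"
      using add_commute [OF sub sub] by (auto simp: transport_def d)
  next
    fix x assume "x \<in> hcarrier ?T" "x \<noteq> hzero ?T"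
    then show "0 < Re (hinner ?T x x)"
      using inner_pos [OF sub] by (fastforce simp: transport_def d)
  qed (auto simp: transport_def d zero add scl sub scale_zero add_assoc add_zero scale_add_right
      scale_add_left scale_scale scale_one inner_add_left inner_scale_left
      intro: inner_commute)
qed

lemma hdist_add_right:
  "\<lbrakk>x \<in> C; y \<in> C; z \<in> C\<rbrakk> \<Longrightarrow> hdist K (x \<oplus> z) (y \<oplus> z) = hdist K x y"
proof -
  assume a: "x \<in> C" "y \<in> C" "z \<in> C"
  have "(hdist K (x \<oplus> z) (y \<oplus> z))\<^sup>2 = (hdist K x y)\<^sup>2"
    using a closed Re_commute [of y z]
    by (simp add: hdist_sq inner_add_left inner_add_right Re_commute [of z x])
  then show ?thesis
    using hdist_nonneg a closed by (simp add: power2_eq_iff_nonneg)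
qed

lemma hdist_add:
  assumes "x \<in> C" "y \<in> C" "x' \<in> C" "y' \<in> C"
  shows "hdist K (x \<oplus> y) (x' \<oplus> y') \<le> hdist K x x' + hdist K y y'"
  using hdist_triangle [of "x \<oplus> y" "x' \<oplus> y" "x' \<oplus> y'"] hdist_add_right [of x x' y]
    hdist_add_right [of y y' x'] add_commute assms closed by simp

lemma hdist_scale:
  assumes "x \<in> C" "y \<in> C"
  shows "hdist K (a \<odot> x) (a \<odot> y) = cmod a * hdist K x y"
proof -
  have m: "a * (cnj a * w) = complex_of_real ((cmod a)\<^sup>2) * w" for w
    by (simp only: complex_norm_square mult.assoc)
  have "(hdist K (a \<odot> x) (a \<odot> y))\<^sup>2 = (cmod a * hdist K x y)\<^sup>2"
    using assms closed
    by (simp add: hdist_sq inner_scale_left inner_scale_right power_mult_distrib m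
        Re_complex_of_real algebra_simps del: of_real_power)
  then show ?thesis
    using hdist_nonneg assms closed by (simp add: power2_eq_iff_nonneg)
qed

lemma unitary_onD:
  assumes "unitary_on K U"
  shows "x \<in> C \<Longrightarrow> U x \<in> C"
    and "x \<in> C \<Longrightarrow> y \<in> C \<Longrightarrow> U (x \<oplus> y) = U x \<oplus> U y"
    and "x \<in> C \<Longrightarrow> U (a \<odot> x) = a \<odot> U x"
    and "x \<in> C \<Longrightarrow> y \<in> C \<Longrightarrow> \<langle>U x, U y\<rangle> = \<langle>x, y\<rangle>"
    and "U (hzero K) = hzero K"
proof -
  show "x \<in> C \<Longrightarrow> U x \<in> C" for x
    using assms bij_betwE unfolding unitary_on_def by blast
  then show "U (hzero K) = hzero K"
    using assms scale_zero zero_closed unfolding unitary_on_def by metis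
qed (use assms in \<open>auto simp: unitary_on_def\<close>)

lemma hdist_unitary:
  assumes "unitary_on K U" "x \<in> C" "y \<in> C"
  shows "hdist K (U x) (U y) = hdist K x y"
proof -
  have "(hdist K (U x) (U y))\<^sup>2 = (hdist K x y)\<^sup>2"
    using assms by (simp add: hdist_sq unitary_onD [OF assms(1)])
  then show ?thesis
    using hdist_nonneg unitary_onD(1) assms by (simp add: power2_eq_iff_nonneg)
qed

lemma unitary_on_id: "unitary_on K id"
  by (simp add: unitary_on_def)

lemma unitary_on_inv:
  assumes U: "unitary_on K U"
  shows "unitary_on K (inv_into C U)"
proof -
  have b: "bij_betw U C C" using U by (simp add: unitary_on_def)
  have c: "inv_into C U x \<in> C" "U (inv_into C U x) = x" if "x \<in> C" for x
    using b that by (auto simp: bij_betw_def inv_into_into f_inv_into_f)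
  have u: "x = y" if "x \<in> C" "y \<in> C" "U x = U y" for x y
    using b that by (auto simp: bij_betw_def inj_on_def)
  show ?thesis
    unfolding unitary_on_def
  proof (intro conjI ballI allI)
    show "bij_betw (inv_into C U) C C" by (rule bij_betw_inv_into [OF b])
    fix x assume x: "x \<in> C"
    show "inv_into C U (a \<odot> x) = a \<odot> inv_into C U x" for a
      using x by - (rule u, simp_all add: c closed unitary_onD [OF U])
    fix y assume y: "y \<in> C"
    show "inv_into C U (x \<oplus> y) = inv_into C U x \<oplus> inv_into C U y"
      using x y by - (rule u, simp_all add: c closed unitary_onD [OF U])
    show "\<langle>inv_into C U x, inv_into C U y\<rangle> = \<langle>x, y\<rangle>"
      using unitary_onD(4) [OF U, of "inv_into C U x" "inv_into C U y"] x y by (simp add: c)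
  qed
qed

end

locale unitaries_with_isometry = hilbert K for K :: "'k hilbert" +
  fixes d :: nat and r :: "'h::complex_inner \<Rightarrow> 'k" and V :: "nat \<Rightarrow> 'k \<Rightarrow> 'k"
  assumes isometry: "isometry_into K r"
    and unitary: "i \<in> {1..d} \<Longrightarrow> unitary_on K (V i)"
begin

lemma r: "r x \<in> C" "r (x + y) = r x \<oplus> r y" "r (a *\<^sub>C x) = a \<odot> r x"
  using isometry by (auto simp: isometry_into_def)

lemma r_zero: "r 0 = hzero K"
  using r(3) [of 0 0] scale_zero r(1) complex_vector.scale_zero_left by simp

definition letter :: "nat \<times> bool \<Rightarrow> 'k \<Rightarrow> 'k" where
  "letter l = (if fst l \<in> {1..d} then if snd l then V (fst l) else inv_into C (V (fst l)) else id)"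

lemma unitary_letter: "unitary_on K (letter l)"
  by (simp add: letter_def unitary unitary_on_inv unitary_on_id)

lemma letter_inverse: "x \<in> C \<Longrightarrow> letter (i, b) (letter (i, \<not> b) x) = x"
proof -
  assume x: "x \<in> C"
  have "bij_betw (V i) C C" if "i \<in> {1..d}"
    using unitary [OF that] by (simp add: unitary_on_def)
  then show ?thesis
    using x by (auto simp: letter_def bij_betw_def f_inv_into_f inv_into_f_f)
qed

fun act :: "(nat \<times> bool) list \<Rightarrow> 'k \<Rightarrow> 'k" where
  "act [] x = x"
| "act (l # w) x = letter l (act w x)"

lemma act:
  "x \<in> C \<Longrightarrow> act w x \<in> C"
  "x \<in> C \<Longrightarrow> y \<in> C \<Longrightarrow> act w (x \<oplus> y) = act w x \<oplus> act w y"
  "x \<in> C \<Longrightarrow> act w (a \<odot> x) = a \<odot> act w x"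
  "act w (hzero K) = hzero K"
proof -
  show c: "act w x \<in> C" if "x \<in> C" for w x
    using that by (induction w) (auto simp: unitary_onD [OF unitary_letter])
  show "x \<in> C \<Longrightarrow> y \<in> C \<Longrightarrow> act w (x \<oplus> y) = act w x \<oplus> act w y"
    by (induction w) (auto simp: unitary_onD [OF unitary_letter] c)
  show "x \<in> C \<Longrightarrow> act w (a \<odot> x) = a \<odot> act w x"
    by (induction w) (auto simp: unitary_onD [OF unitary_letter] c)
  show "act w (hzero K) = hzero K"
    by (induction w) (auto simp: unitary_onD [OF unitary_letter])
qed

fun lin :: "((nat \<times> bool) list \<times> 'h) list \<Rightarrow> 'k" where
  "lin [] = hzero K"
| "lin (p # ts) = act (fst p) (r (snd p)) \<oplus> lin ts"

lemma lin_closed: "lin ts \<in> C"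
  by (induction ts) (auto simp: closed act r)

lemma lin_append: "lin (ts @ us) = lin ts \<oplus> lin us"
proof (induction ts)
  case Nil
  then show ?case
    using add_commute [of "hzero K"] add_zero by (simp add: closed lin_closed)
next
  case (Cons p ts)
  then show ?case
    by (simp add: add_assoc closed lin_closed act r)
qed

lemma lin_letter: "letter l (lin ts) = lin (map (\<lambda>p. (l # fst p, snd p)) ts)"
  by (induction ts) (simp_all add: unitary_onD [OF unitary_letter] lin_closed act r)

lemma lin_scale: "a \<odot> lin ts = lin (map (\<lambda>p. (fst p, a *\<^sub>C snd p)) ts)"
proof (induction ts)
  case Nil
  have "a \<odot> 0 \<odot> hzero K = 0 \<odot> hzero K"
    by (simp add: scale_scale closed)
  then show ?case
    by (simp add: scale_zero closed)
qed (simp add: scale_add_right lin_closed act r)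

definition M :: "'k set" where
  "M = {x \<in> C. \<forall>e>0. \<exists>ts. hdist K (lin ts) x < e}"

lemma M_sub: "x \<in> M \<Longrightarrow> x \<in> C"
  by (simp add: M_def)

lemma lin_in_M: "lin ts \<in> M"
proof -
  have "hdist K (lin ts) (lin ts) = 0"
    by (simp add: hdist_zero_iff lin_closed)
  then show ?thesis
    unfolding M_def using lin_closed by (auto intro!: exI [of _ ts])
qed

lemma r_in_M: "r x \<in> M"
  using lin_in_M [of "[([], x)]"] add_zero r(1) by simp

lemma zero_in_M: "hzero K \<in> M"
  using lin_in_M [of "[]"] by simp

lemma add_in_M:
  assumes "x \<in> M" "y \<in> M"
  shows "x \<oplus> y \<in> M"
proof -
  have "\<exists>ts. hdist K (lin ts) (x \<oplus> y) < e" if "e > 0" for e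
  proof -
    obtain ts us where "hdist K (lin ts) x < e / 2" "hdist K (lin us) y < e / 2"
      using assms half_gt_zero [OF \<open>e > 0\<close>] unfolding M_def by blast
    then have "hdist K (lin (ts @ us)) (x \<oplus> y) < e"
      using hdist_add [of "lin ts" "lin us" x y] M_sub assms lin_closed by (simp add: lin_append)
    then show ?thesis by blast
  qed
  moreover have "x \<oplus> y \<in> C"
    using assms M_sub closed by blast
  ultimately show ?thesis
    unfolding M_def by blast
qed

lemma scale_in_M:
  assumes "x \<in> M"
  shows "a \<odot> x \<in> M"
proof -
  have "\<exists>ts. hdist K (lin ts) (a \<odot> x) < e" if "e > 0" for e
  proof -
    have "0 < e / (cmod a + 1)"
      using that by (simp add: add_nonneg_pos)
    then obtain ts where ts: "hdist K (lin ts) x < e / (cmod a + 1)"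
      using assms unfolding M_def by blast
    have "hdist K (a \<odot> lin ts) (a \<odot> x) = cmod a * hdist K (lin ts) x"
      using hdist_scale lin_closed M_sub assms by simp
    also have "\<dots> \<le> (cmod a + 1) * hdist K (lin ts) x"
      using hdist_nonneg lin_closed M_sub assms by (simp add: mult_right_mono)
    also have "\<dots> < e"
      using ts by (simp add: add_nonneg_pos pos_less_divide_eq mult.commute)
    finally show ?thesis
      by (auto simp: lin_scale)
  qed
  moreover have "a \<odot> x \<in> C"
    using assms M_sub closed by blast
  ultimately show ?thesis
    unfolding M_def by blast
qed

lemma letter_in_M:
  assumes "x \<in> M"
  shows "letter l x \<in> M"
proof -
  have "\<exists>ts. hdist K (lin ts) (letter l x) < e" if "e > 0" for e
  proof -
    obtain ts where ts: "hdist K (lin ts) x < e"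
      using assms \<open>e > 0\<close> unfolding M_def by blast
    have "hdist K (letter l (lin ts)) (letter l x) < e"
      using ts by (simp add: hdist_unitary [OF unitary_letter] M_sub assms lin_closed)
    then show ?thesis
      by (auto simp: lin_letter)
  qed
  moreover have "letter l x \<in> C"
    using assms M_sub unitary_onD(1) [OF unitary_letter] by blast
  ultimately show ?thesis
    unfolding M_def by blast
qed

lemma limit_in_M:
  assumes "range \<sigma> \<subseteq> M" "x \<in> C" "(\<lambda>n. hdist K (\<sigma> n) x) \<longlonglongrightarrow> 0"
  shows "x \<in> M"
proof -
  have "\<exists>ts. hdist K (lin ts) x < e" if "e > 0" for e
  proof -
    have "\<forall>\<^sub>F n in sequentially. hdist K (\<sigma> n) x < e / 2"
      using assms(3) that by (intro order_tendstoD) auto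
    then obtain n where n: "hdist K (\<sigma> n) x < e / 2"
      by (auto simp: eventually_sequentially)
    have s: "\<sigma> n \<in> M" using assms(1) by blast
    then obtain ts where "hdist K (lin ts) (\<sigma> n) < e / 2"
      using half_gt_zero [OF \<open>e > 0\<close>] unfolding M_def by blast
    then have "hdist K (lin ts) x < e"
      using n hdist_triangle [of "lin ts" "\<sigma> n" x] lin_closed s M_sub assms(2) by simp
    then show ?thesis by blast
  qed
  then show ?thesis
    unfolding M_def using assms(2) by blast
qed

lemma bij_M:
  assumes i: "i \<in> {1..d}"
  shows "bij_betw (V i) M M"
proof -
  have V: "V i = letter (i, True)" using i by (simp add: letter_def)
  have "inj_on (V i) M"
    using unitary [OF i] M_sub by (auto simp: unitary_on_def bij_betw_def inj_on_def)
  moreover have "V i ` M = M"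
  proof
    show "V i ` M \<subseteq> M" using letter_in_M V by auto
    show "M \<subseteq> V i ` M"
    proof
      fix x assume x: "x \<in> M"
      have "x = V i (letter (i, False) x)"
        using letter_inverse [of x i True] x M_sub V by simp
      then show "x \<in> V i ` M"
        using letter_in_M [OF x] by blast
    qed
  qed
  ultimately show ?thesis by (simp add: bij_betw_def)
qed

definition collect :: "((nat \<times> bool) list \<times> 'h) list \<Rightarrow> (nat \<times> bool) list \<Rightarrow> 'h" where
  "collect ts w = sum_list (map snd (filter (\<lambda>p. fst p = w) ts))"

lemma inner_lin:
  assumes "finite A" "fst ` set ts \<subseteq> A" "z \<in> C"
  shows "\<langle>lin ts, z\<rangle> = (\<Sum>w\<in>A. \<langle>act w (r (collect ts w)), z\<rangle>)"
  using assms(2)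
proof (induction ts)
  case Nil
  then show ?case
    using assms(3) by (simp add: collect_def r_zero act inner_zero_left)
next
  case (Cons p ts)
  have c: "collect (p # ts) w = (if w = fst p then snd p else 0) + collect ts w" for w
    by (simp add: collect_def)
  have "(\<Sum>w\<in>A. \<langle>act w (r (collect (p # ts) w)), z\<rangle>)
      = (\<Sum>w\<in>A. (if w = fst p then \<langle>act (fst p) (r (snd p)), z\<rangle> else 0)
          + \<langle>act w (r (collect ts w)), z\<rangle>)"
    using assms(3) closed
    by (intro sum.cong) (auto simp: c r r_zero act inner_add_left inner_zero_left)
  also have "\<dots> = \<langle>act (fst p) (r (snd p)), z\<rangle> + \<langle>lin ts, z\<rangle>"
    using Cons assms(1) by (simp add: sum.distrib)
  also have "\<dots> = \<langle>lin (p # ts), z\<rangle>"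
    using assms(3) by (simp add: inner_add_left act r lin_closed)
  finally show ?case by simp
qed

lemma lin_eq:
  assumes "collect ts = collect us"
  shows "lin ts = lin us"
proof (rule eqI)
  fix z assume "z \<in> C"
  then show "\<langle>lin ts, z\<rangle> = \<langle>lin us, z\<rangle>"
    using inner_lin [of "fst ` set ts \<union> fst ` set us"] assms by simp
qed (fact lin_closed)+

definition approx :: "'k \<Rightarrow> nat \<Rightarrow> ((nat \<times> bool) list \<times> 'h) list" where
  "approx x m = (SOME ts. hdist K (lin ts) x < 1 / Suc m)"

lemma approx: "x \<in> M \<Longrightarrow> hdist K (lin (approx x m)) x < 1 / Suc m"
  unfolding approx_def M_def by (rule someI_ex) simp

definition code :: "'k \<Rightarrow> nat \<Rightarrow> 'h" where
  "code x k = (let (m, j) = prod_decode k in collect (approx x m) (from_nat j))"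

lemma inj_code: "inj_on code M"
proof
  fix x y assume xy: "x \<in> M" "y \<in> M" and eq: "code x = code y"
  have "collect (approx x m) w = collect (approx y m) w" for m w
    using fun_cong [OF eq, of "prod_encode (m, to_nat w)"] by (simp add: code_def)
  then have l: "lin (approx x m) = lin (approx y m)" for m
    by (intro lin_eq) blast
  have "hdist K x y \<le> 2 / Suc m" for m
    using approx [OF xy(1), of m] approx [OF xy(2), of m] l [of m]
      hdist_triangle [of x "lin (approx x m)" y] hdist_commute [of x "lin (approx x m)"]
      xy M_sub lin_closed by simp
  moreover have "(\<lambda>m. 2 / real (Suc m)) \<longlonglongrightarrow> 0"
    by (rule LIMSEQ_Suc) (rule lim_const_over_n)
  ultimately have "hdist K x y \<le> 0"
    by (intro LIMSEQ_le_const) auto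
  then show "x = y"
    using hdist_nonneg [of x y] hdist_zero_iff [of x y] xy M_sub by simp
qed

abbreviation "dec \<equiv> inv_into M code"
abbreviation "K' \<equiv> transport K M code"
abbreviation "V' i y \<equiv> code (V i (dec y))"

lemmas dec = inv_into_f_f [OF inj_code]

lemma V_in_M: "i \<in> {1..d} \<Longrightarrow> x \<in> M \<Longrightarrow> V i x \<in> M"
  using bij_M bij_betwE by blast

lemma hilbert': "hilbert K'"
  by (rule transport_hilbert)
    (use M_sub inj_code zero_in_M add_in_M scale_in_M limit_in_M in auto)

lemma isometry': "isometry_into K' (\<lambda>x. code (r x))"
  using isometry r_in_M by (auto simp: isometry_into_def transport_def dec hnorm_def)

lemma unitary':
  assumes i: "i \<in> {1..d}"
  shows "unitary_on K' (V' i)"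
proof -
  have "bij_betw code M (code ` M)"
    using inj_code by (simp add: bij_betw_def)
  then have "bij_betw (V' i) (code ` M) (code ` M)"
    using bij_betw_trans [OF bij_betw_trans [OF bij_betw_inv_into bij_M [OF i]]]
    by (simp add: comp_def)
  then show ?thesis
    using V_in_M [OF i] unitary_onD [OF unitary [OF i]] M_sub
    by (auto simp: unitary_on_def transport_def dec add_in_M scale_in_M)
qed

lemma word':
  assumes "fst ` set ws \<subseteq> {1..d}" "x \<in> M"
  shows "word_prod V ws x \<in> M \<and> word_prod V' ws (code x) = code (word_prod V ws x)"
  using assms(1)
proof (induction ws)
  case Nil
  then show ?case using assms(2) by (simp add: word_prod_def)
next
  case (Cons p ws)
  have pow: "(V i ^^ n) y \<in> M \<and> (V' i ^^ n) (code y) = code ((V i ^^ n) y)"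
    if "i \<in> {1..d}" "y \<in> M" for i n y
    by (induction n) (use that in \<open>auto simp: dec V_in_M\<close>)
  show ?case
    using Cons pow by (auto simp: word_prod_def split: prod.split)
qed

lemma hadjoint': "y \<in> M \<Longrightarrow> hadjoint K' (\<lambda>x. code (r x)) (code y) = hadjoint K r y"
  by (simp add: hadjoint_def transport_def dec r_in_M)

end

lemma strictly_noncommutingD:
  fixes K :: "'k hilbert"
  assumes S: "strictly_noncommuting d S" and D: "free_unitary_dilation d S K r V"
  shows "\<not> commuting_on d K V"
proof
  assume comm: "commuting_on d K V"
  interpret unitaries_with_isometry K d r V
    using D by (simp add: free_unitary_dilation_def unitaries_with_isometry_def
        unitaries_with_isometry_axioms_def)
  have "word_prod S ws = hadjoint K' (\<lambda>x. code (r x)) \<circ> word_prod V' ws \<circ> (\<lambda>x. code (r x))"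
    if "ws \<noteq> [] \<and> fst ` set ws \<subseteq> {1..d}" for ws
  proof -
    have w: "word_prod S ws = hadjoint K r \<circ> word_prod V ws \<circ> r"
      using D that by (simp add: free_unitary_dilation_def)
    show ?thesis
    proof
      fix x
      show "word_prod S ws x =
          (hadjoint K' (\<lambda>x. code (r x)) \<circ> word_prod V' ws \<circ> (\<lambda>x. code (r x))) x"
        using word' [of ws "r x"] that r_in_M by (simp add: w hadjoint')
    qed
  qed
  then have "free_unitary_dilation d S K' (\<lambda>x. code (r x)) V'"
    using hilbert' isometry' unitary' by (simp add: free_unitary_dilation_def)
  moreover have "commuting_on d K' V'"
    using comm V_in_M M_sub by (auto simp: commuting_on_def transport_def dec)
  ultimately show False
    using S unfolding strictly_noncommuting_def by blast
qed

end

theory Submission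
  imports Defs
begin

text \<open>
  The two regimes \<open>d \<le> 2\<close> and \<open>d \<ge> 3\<close> have unrelated proofs.

  For \<open>d \<le> 2\<close> the claim is Ando's theorem that two commuting contractions have commuting unitary
  dilations; a single contraction is the case of two equal ones. Let \<open>D\<^sub>1, D\<^sub>2\<close> be defect operators,
  \<open>\<parallel>D\<^sub>i h\<parallel>\<^sup>2 = \<parallel>h\<parallel>\<^sup>2 - \<parallel>S\<^sub>i h\<parallel>\<^sup>2\<close>. The shifts \<open>(h, k\<^sub>0, k\<^sub>1, \<dots>) \<mapsto> (S\<^sub>i h, D\<^sub>i h, k\<^sub>0, k\<^sub>1, \<dots>)\<close> are isometric
  dilations, and they fail to commute only because the pair \<open>(D\<^sub>1 S\<^sub>2 h, D\<^sub>2 h)\<close> is produced in one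
  order and \<open>(D\<^sub>2 S\<^sub>1 h, D\<^sub>1 h)\<close> in the other. Both pairs have the square norm
  \<open>\<parallel>h\<parallel>\<^sup>2 - \<parallel>S\<^sub>1 S\<^sub>2 h\<parallel>\<^sup>2\<close>, so on a large enough space some unitary \<open>G\<close> exchanges them, and twisting one
  shift by \<open>G\<close> and the other by \<open>G\<^sup>-\<^sup>1\<close> makes them commute
  (\<open>commuting_isometric_dilation_exists\<close>). Unitaries come from a second application of the same
  result, to the adjoints \<open>V\<^sub>i\<^sup>*\<close> of the isometries just found: since \<open>V\<^sub>i\<^sup>*\<close> is a coisometry, the new
  isometries \<open>W\<^sub>i\<close> satisfy \<open>W\<^sub>i V\<^sub>i k = k\<close>, hence they are invertible on a closed subspace that
  contains the original one, and their inverses there extend the \<open>V\<^sub>i\<close>.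

  For \<open>d \<ge> 3\<close> the starting point is Parrott's triple of operators on a four-dimensional space. For
  a unitary dilation \<open>V\<^sub>i\<close> the distance between \<open>V\<^sub>i r x\<close> and \<open>r y\<close> depends on \<open>\<langle>S\<^sub>i x, y\<rangle>\<close> only
  (\<open>hdist_dilation\<close>). If the unitaries commute, then going around two chains of approximate
  equalities from \<open>V\<^sub>2 V\<^sub>3 r x\<^sub>0\<close>, once as it stands and once as \<open>V\<^sub>3 V\<^sub>2 r x\<^sub>0\<close>, bounds the distance
  between \<open>x\<^sub>1\<close> and \<open>- x\<^sub>1\<close> by a sum of eight such distances
  (\<open>commuting_dilation_inequality\<close>). Parrott's triple makes all eight vanish although
  \<open>x\<^sub>1 \<noteq> 0\<close>. The inequality is a closed condition in the weak polynomial topology, so it remains to see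
  that the tuples that violate it are dense. In an infinite-dimensional space there is room for this:
  given finitely many vectors, an isometry \<open>W\<close> that fixes them moves any tuple \<open>S\<close> aside to
  \<open>W S\<^sub>i W\<^sup>*\<close>, leaving four dimensions orthogonal to the range of \<open>W\<close>, where Parrott's triple is
  added. The matrix coefficients of all monomials at the given vectors do not change
  (\<open>noncommuting_perturbation_exists\<close>).
\<close>

section \<open>Elementary geometry of complex Hilbert spaces\<close>

lemma cinner_add_right: "cinner x (y + z) = cinner x y + cinner x (z :: 'a::complex_inner)"
  by (metis cinner_add_left cinner_commute complex_cnj_add)

lemma cinner_scaleC_right: "cinner x (a *\<^sub>C y) = cnj a * cinner x (y :: 'a::complex_inner)"
  by (metis cinner_scaleC_left cinner_commute complex_cnj_mult)

lemma cinner_zero_left [simp]: "cinner 0 (x :: 'a::complex_inner) = 0"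
  using cinner_add_left [of 0 0 x] by simp

lemma cinner_zero_right [simp]: "cinner (x :: 'a::complex_inner) 0 = 0"
  using cinner_add_right [of x 0 0] by simp

lemma cinner_minus_left: "cinner (- x) (y :: 'a::complex_inner) = - cinner x y"
  using cinner_add_left [of x "- x" y] by (simp add: add_eq_0_iff)

lemma cinner_minus_right: "cinner x (- y :: 'a::complex_inner) = - cinner x y"
  using cinner_add_right [of x y "- y"] by (simp add: add_eq_0_iff)

lemma cinner_diff_left: "cinner (x - y) (z :: 'a::complex_inner) = cinner x z - cinner y z"
  using cinner_add_left [of x "- y" z] by (simp add: cinner_minus_left)

lemma cinner_diff_right: "cinner x (y - z :: 'a::complex_inner) = cinner x y - cinner x z"
  using cinner_add_right [of x y "- z"] by (simp add: cinner_minus_right)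

lemma cinner_scaleR_left: "cinner (r *\<^sub>R x) (y :: 'a::complex_inner) = of_real r * cinner x y"
  by (simp add: scaleR_scaleC cinner_scaleC_left)

lemmas cinner_algebra =
  cinner_add_left cinner_add_right cinner_diff_left cinner_diff_right
  cinner_minus_left cinner_minus_right cinner_scaleC_left cinner_scaleC_right

lemma cinner_sum_left: "cinner (\<Sum>i\<in>A. f i) (y :: 'a::complex_inner) = (\<Sum>i\<in>A. cinner (f i) y)"
  by (induction A rule: infinite_finite_induct) (simp_all add: cinner_add_left)

lemma scaleC_uminus_one: "(- 1) *\<^sub>C (x :: 'a::complex_inner) = - x"
  by simp

lemma scaleC_diff_right: "a *\<^sub>C (x - y :: 'a::complex_inner) = a *\<^sub>C x - a *\<^sub>C y"
  by (rule complex_vector.scale_right_diff_distrib)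

lemma cinner_self: "cinner x x = complex_of_real ((norm (x :: 'a::complex_inner))\<^sup>2)"
proof -
  have "0 \<le> Re (cinner x x)"
    using norm_ge_zero [of x] by (simp only: norm_eq_sqrt_cinner real_sqrt_ge_0_iff)
  then have "Re (cinner x x) = (norm x)\<^sup>2"
    by (simp add: norm_eq_sqrt_cinner)
  moreover have "Im (cinner x x) = 0"
    using arg_cong [OF cinner_commute [of x x], of Im] by simp
  ultimately show ?thesis
    by (simp add: complex_eq_iff)
qed

lemma Re_cinner_self: "Re (cinner x x) = (norm (x :: 'a::complex_inner))\<^sup>2"
  by (simp only: cinner_self Re_complex_of_real)

lemma Re_cinner_commute: "Re (cinner x y) = Re (cinner y (x :: 'a::complex_inner))"
  using cinner_commute [of x y] by simp

lemma norm_add_square: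
  "(norm (x + y :: 'a::complex_inner))\<^sup>2 = (norm x)\<^sup>2 + (norm y)\<^sup>2 + 2 * Re (cinner x y)"
  using Re_cinner_commute [of x y]
  by (simp flip: Re_cinner_self add: cinner_add_left cinner_add_right)

lemma norm_diff_square:
  "(norm (x - y :: 'a::complex_inner))\<^sup>2 = (norm x)\<^sup>2 + (norm y)\<^sup>2 - 2 * Re (cinner x y)"
  using norm_add_square [of x "- y"] by (simp add: cinner_minus_right)

lemma norm_add_square_orthogonal:
  "cinner x y = 0 \<Longrightarrow> (norm (x + y :: 'a::complex_inner))\<^sup>2 = (norm x)\<^sup>2 + (norm y)\<^sup>2"
  by (simp add: norm_add_square)

lemma norm_scaleC: "norm (a *\<^sub>C x) = cmod a * norm (x :: 'a::complex_inner)"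
proof -
  have "complex_of_real ((norm (a *\<^sub>C x))\<^sup>2) = complex_of_real ((cmod a * norm x)\<^sup>2)"
    by (simp only: cinner_self [symmetric] cinner_scaleC_left cinner_scaleC_right)
      (simp add: cinner_self power_mult_distrib mult.commute [of "cnj _"]
        flip: mult.assoc of_real_power add: complex_norm_square del: of_real_power)
  then have "(norm (a *\<^sub>C x))\<^sup>2 = (cmod a * norm x)\<^sup>2"
    by (simp only: of_real_eq_iff)
  then show ?thesis
    by (simp add: power2_eq_iff_nonneg)
qed

lemma bounded_linear_scaleC: "bounded_linear (\<lambda>x :: 'a::complex_inner. a *\<^sub>C x)"
proof (rule bounded_linear_intro)
  show "a *\<^sub>C r *\<^sub>R x = r *\<^sub>R a *\<^sub>C x" for r and x :: 'a
    by (simp add: scaleR_scaleC mult.commute)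
  show "norm (a *\<^sub>C x) \<le> norm x * cmod a" for x :: 'a
    by (simp add: norm_scaleC)
qed (rule scaleC_add_right)

lemma norm_diff_projection:
  fixes x e :: "'a::complex_inner"
  assumes "norm e = 1"
  shows "(norm (x - cinner x e *\<^sub>C e))\<^sup>2 = (norm x)\<^sup>2 - (cmod (cinner x e))\<^sup>2"
proof -
  have "Re (cinner x (cinner x e *\<^sub>C e)) = (cmod (cinner x e))\<^sup>2"
    by (simp only: cinner_scaleC_right mult.commute [of "cnj _"] complex_norm_square [symmetric]
      Re_complex_of_real)
  then show ?thesis
    using assms by (simp add: norm_diff_square norm_scaleC)
qed

lemma Cauchy_Schwarz_cinner: "cmod (cinner x y) \<le> norm x * norm (y :: 'a::complex_inner)"
proof (cases "y = 0")
  case False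
  let ?e = "(1 / norm y) *\<^sub>R y"
  have e: "norm ?e = 1" using False by simp
  have "(cmod (cinner x ?e))\<^sup>2 \<le> (norm x)\<^sup>2"
    using norm_diff_projection [OF e, of x] zero_le_power2 [of "norm (x - cinner x ?e *\<^sub>C ?e)"]
    by linarith
  then have "cmod (cinner x ?e) \<le> norm x"
    by (rule power2_le_imp_le) simp
  then show ?thesis
    using False by (simp add: scaleR_scaleC cinner_scaleC_right norm_mult norm_divide field_simps)
qed simp

lemma bounded_bilinear_cinner:
  "bounded_bilinear (cinner :: 'a::complex_inner \<Rightarrow> 'a \<Rightarrow> complex)"
proof
  show "\<exists>K. \<forall>a b :: 'a. cmod (cinner a b) \<le> norm a * norm b * K"
    using Cauchy_Schwarz_cinner by (intro exI [of _ 1]) auto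
qed (simp_all add: cinner_add_left cinner_add_right scaleR_scaleC cinner_scaleC_left
    cinner_scaleC_right scaleR_conv_of_real)

lemmas tendsto_cinner = bounded_bilinear.tendsto [OF bounded_bilinear_cinner]

lemma cinner_eqI: "(\<And>z. cinner z x = cinner z y) \<Longrightarrow> x = (y :: 'a::complex_inner)"
  using cinner_self [of "x - y"] by (simp add: cinner_diff_right)

text \<open>Bounded \<open>\<complex>\<close>-linear maps between different spaces; \<^const>\<open>bounded_clinear\<close> is the case of
  operators on a single space.\<close>

definition bclinear :: "('a::complex_inner \<Rightarrow> 'b::complex_inner) \<Rightarrow> bool" where
  "bclinear T \<longleftrightarrow> bounded_linear T \<and> (\<forall>a x. T (a *\<^sub>C x) = a *\<^sub>C T x)"

lemma bounded_clinear_iff_bclinear: "bounded_clinear T \<longleftrightarrow> bclinear T"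
  by (simp add: bounded_clinear_def bclinear_def)

lemma bclinearI:
  assumes "\<And>x y. T (x + y) = T x + T y" "\<And>a x. T (a *\<^sub>C x) = a *\<^sub>C T x"
    and "\<And>x. norm (T x) \<le> K * norm x"
  shows "bclinear T"
  unfolding bclinear_def
  by (intro conjI bounded_linear_intro [of _ K])
    (simp_all add: assms scaleR_scaleC mult.commute)

lemma bclinearD:
  assumes "bclinear T"
  shows "T (x + y) = T x + T y" "T (x - y) = T x - T y" "T (- x) = - T x" "T 0 = 0"
    "T (a *\<^sub>C x) = a *\<^sub>C T x" "bounded_linear T"
proof -
  have *: "bounded_linear T" "\<And>a x. T (a *\<^sub>C x) = a *\<^sub>C T x"
    using assms by (auto simp: bclinear_def)
  interpret bounded_linear T by (fact *)
  show "T (x + y) = T x + T y" "T (x - y) = T x - T y" "T (- x) = - T x" "T 0 = 0"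
    "T (a *\<^sub>C x) = a *\<^sub>C T x" "bounded_linear T"
    by (rule add diff neg zero *)+
qed

lemma bclinear_compose: "bclinear T \<Longrightarrow> bclinear U \<Longrightarrow> bclinear (\<lambda>x. T (U x))"
  by (auto simp: bclinear_def intro: bounded_linear_compose)

lemma contraction_iff:
  "contraction T \<longleftrightarrow> bclinear T \<and> (\<forall>x. norm (T x) \<le> norm x)"
proof
  assume "contraction T"
  then have T: "bclinear T" "onorm T \<le> 1"
    by (auto simp: contraction_def bounded_clinear_iff_bclinear)
  have "norm (T x) \<le> norm x" for x
  proof -
    have "norm (T x) \<le> onorm T * norm x"
      by (rule onorm [OF bclinearD(6) [OF T(1)]])
    also have "\<dots> \<le> 1 * norm x"
      using T(2) by (intro mult_right_mono) auto
    finally show ?thesis by simp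
  qed
  then show "bclinear T \<and> (\<forall>x. norm (T x) \<le> norm x)"
    using T by blast
next
  assume "bclinear T \<and> (\<forall>x. norm (T x) \<le> norm x)"
  then show "contraction T"
    by (auto simp: contraction_def bounded_clinear_iff_bclinear intro!: onorm_bound)
qed

section \<open>The Riesz representation theorem, projections and adjoints\<close>

definition closed_csubspace :: "'a::complex_inner set \<Rightarrow> bool" where
  "closed_csubspace M \<longleftrightarrow> closed M \<and> 0 \<in> M \<and> (\<forall>x\<in>M. \<forall>y\<in>M. x + y \<in> M) \<and> (\<forall>a. \<forall>x\<in>M. a *\<^sub>C x \<in> M)"

lemma closed_csubspaceD:
  assumes "closed_csubspace M"
  shows "closed M" "0 \<in> M" "x \<in> M \<Longrightarrow> y \<in> M \<Longrightarrow> x + y \<in> M" "x \<in> M \<Longrightarrow> a *\<^sub>C x \<in> M"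
    "x \<in> M \<Longrightarrow> r *\<^sub>R x \<in> M" "x \<in> M \<Longrightarrow> y \<in> M \<Longrightarrow> x - y \<in> M"
proof -
  show "x \<in> M \<Longrightarrow> y \<in> M \<Longrightarrow> x - y \<in> M"
    using assms [unfolded closed_csubspace_def] diff_conv_add_uminus [of x y] scaleC_uminus_one [of y]
    by metis
qed (use assms in \<open>auto simp: closed_csubspace_def scaleR_scaleC\<close>)

lemma closed_csubspace_UNIV: "closed_csubspace UNIV"
  by (simp add: closed_csubspace_def)

text \<open>The representing vector minimises \<open>\<parallel>x\<parallel>\<^sup>2 - 2 Re (f x)\<close> over \<open>M\<close>: by the parallelogram law
  the functional is uniformly convex, so minimising sequences are Cauchy, and the vanishing of the
  derivative at the minimum is the claim. Over the whole space this gives adjoints; for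
  \<open>f x = \<langle>x, y\<rangle>\<close> the vector obtained is the orthogonal projection of \<open>y\<close> onto \<open>M\<close>.\<close>

lemma riesz_on_closed_csubspace:
  fixes M :: "'a::chilbert_space set"
  assumes M: "closed_csubspace M"
    and add: "\<And>x y. x \<in> M \<Longrightarrow> y \<in> M \<Longrightarrow> f (x + y) = f x + f y"
    and scale: "\<And>a x. x \<in> M \<Longrightarrow> f (a *\<^sub>C x) = a * f x"
    and bound: "\<And>x. x \<in> M \<Longrightarrow> cmod (f x) \<le> B * norm x"
  shows "\<exists>z\<in>M. \<forall>x\<in>M. f x = cinner x z"
proof -
  define \<phi> where "\<phi> x = (norm x)\<^sup>2 - 2 * Re (f x)" for x
  note MD = closed_csubspaceD [OF M]
  have fR: "f (r *\<^sub>R x) = of_real r * f x" if "x \<in> M" for r x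
    using scale [OF that] by (simp add: scaleR_scaleC)
  have lower: "- B\<^sup>2 \<le> \<phi> x" if "x \<in> M" for x
  proof -
    have "Re (f x) \<le> B * norm x"
      using bound [OF that] complex_Re_le_cmod [of "f x"] by linarith
    moreover have "0 \<le> (norm x - B)\<^sup>2" by simp
    ultimately show ?thesis
      by (simp add: \<phi>_def power2_diff mult.commute [of B])
  qed
  define m where "m = Inf (\<phi> ` M)"
  have bdd: "bdd_below (\<phi> ` M)"
    using lower by (intro bdd_belowI2)
  have m_le: "m \<le> \<phi> x" if "x \<in> M" for x
    unfolding m_def using bdd that by (intro cInf_lower) auto
  have "\<exists>x\<in>M. \<phi> x < m + 1 / Suc n" for n
    using cInf_lessD [of "\<phi> ` M" "m + 1 / Suc n"] MD(2) by (auto simp: m_def)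
  then obtain s where s: "\<And>n. s n \<in> M" "\<And>n. \<phi> (s n) < m + 1 / Suc n"
    by metis
  have par: "(norm (x - y))\<^sup>2 = 2 * \<phi> x + 2 * \<phi> y - 4 * \<phi> ((1/2) *\<^sub>R (x + y))"
    if "x \<in> M" "y \<in> M" for x y
    using that MD(3)
    by (simp add: \<phi>_def fR add norm_diff_square norm_add_square power_mult_distrib power_divide
        add_divide_distrib)
  have close: "(norm (s i - s j))\<^sup>2 \<le> 4 / Suc N" if "i \<ge> N" "j \<ge> N" for i j N
  proof -
    have "\<phi> (s i) \<le> m + 1 / Suc N" "\<phi> (s j) \<le> m + 1 / Suc N"
      using that s(2) [of i] s(2) [of j] frac_le [of 1 1 "real (Suc N)" "real (Suc i)"]
        frac_le [of 1 1 "real (Suc N)" "real (Suc j)"] by simp_all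
    moreover have "m \<le> \<phi> ((1/2) *\<^sub>R (s i + s j))"
      using MD s by (intro m_le) auto
    ultimately show ?thesis
      using par [of "s i" "s j"] s by simp
  qed
  have "Cauchy s"
  proof (rule metric_CauchyI)
    fix e :: real assume e: "e > 0"
    then have "e\<^sup>2 / 4 > 0" by simp
    then obtain N where N: "1 / Suc N < e\<^sup>2 / 4"
      using reals_Archimedean [of "e\<^sup>2 / 4"] by (auto simp: inverse_eq_divide)
    have "dist (s i) (s j) < e" if "i \<ge> N" "j \<ge> N" for i j
    proof (rule power2_less_imp_less)
      show "(dist (s i) (s j))\<^sup>2 < e\<^sup>2"
        using close [OF that] N by (simp add: dist_norm)
    qed (use e in simp)
    then show "\<exists>N. \<forall>i\<ge>N. \<forall>j\<ge>N. dist (s i) (s j) < e" by blast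
  qed
  then obtain z where z: "s \<longlonglongrightarrow> z"
    using Cauchy_convergent convergent_def by blast
  have zM: "z \<in> M"
    using closed_sequentially [OF MD(1)] s z by blast
  have f_tendsto: "(\<lambda>n. f (s n)) \<longlonglongrightarrow> f z"
  proof -
    have "(\<lambda>n. B * norm (s n - z)) \<longlonglongrightarrow> B * norm (z - z)"
      by (intro tendsto_intros z)
    then have "(\<lambda>n. f (s n - z)) \<longlonglongrightarrow> 0"
      using bound [OF MD(6) [OF s(1) zM]]
      by (simp add: Lim_null_comparison [where g = "\<lambda>n. B * norm (s n - z)"])
    moreover have "f (s n - z) = f (s n) - f z" for n
      using add [of "s n - z" z] MD(6) s zM by simp
    ultimately show ?thesis
      by (simp add: LIM_zero_iff)
  qed
  have "(\<lambda>n. \<phi> (s n)) \<longlonglongrightarrow> \<phi> z"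
    unfolding \<phi>_def by (intro tendsto_intros z f_tendsto)
  moreover have "(\<lambda>n. m + 1 / Suc n) \<longlonglongrightarrow> m + 0"
    by (intro tendsto_intros LIMSEQ_Suc [OF lim_const_over_n])
  ultimately have "\<phi> z \<le> m + 0"
    by (rule LIMSEQ_le) (use s in \<open>auto intro: less_imp_le\<close>)
  then have min: "\<phi> z \<le> \<phi> x" if "x \<in> M" for x
    using m_le that by fastforce
  have Re_eq: "Re (f x) = Re (cinner x z)" if x: "x \<in> M" for x
  proof (rule ccontr)
    define c where "c = Re (cinner x z) - Re (f x)"
    assume "Re (f x) \<noteq> Re (cinner x z)"
    then have c: "c \<noteq> 0" by (simp add: c_def)
    then have xz: "x \<noteq> 0"
      using x fR [of 0 0] MD(2) by (auto simp: c_def)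
    \<comment> \<open>A parabola through the origin with slope \<open>2 c \<noteq> 0\<close> takes negative values.\<close>
    have t: "0 \<le> t\<^sup>2 * (norm x)\<^sup>2 + 2 * t * c" for t
      using min [of "z + t *\<^sub>R x"] MD zM x
      by (simp add: \<phi>_def add fR norm_add_square power_mult_distrib c_def Re_cinner_commute [of z]
          cinner_scaleR_left algebra_simps)
    have "0 \<le> - (c\<^sup>2 / (norm x)\<^sup>2)"
      using t [of "- c / (norm x)\<^sup>2"] xz by (simp add: field_simps power2_eq_square)
    then show False
      using c xz by (simp add: field_simps)
  qed
  have "f x = cinner x z" if x: "x \<in> M" for x
  proof -
    have "Re (f (\<i> *\<^sub>C x)) = Re (cinner (\<i> *\<^sub>C x) z)"
      using Re_eq MD(4) x by blast
    then have "Im (f x) = Im (cinner x z)"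
      using scale x by (simp add: cinner_scaleC_left)
    then show ?thesis
      using Re_eq [OF x] by (simp add: complex_eq_iff)
  qed
  then show ?thesis using zM by blast
qed

lemma riesz:
  fixes f :: "'a::chilbert_space \<Rightarrow> complex"
  assumes "\<And>x y. f (x + y) = f x + f y" "\<And>a x. f (a *\<^sub>C x) = a * f x"
    "\<And>x. cmod (f x) \<le> B * norm x"
  shows "\<exists>z. \<forall>x. f x = cinner x z"
  using riesz_on_closed_csubspace [OF closed_csubspace_UNIV, of f B] assms by simp

definition adjoint_op :: "('a::complex_inner \<Rightarrow> 'b::complex_inner) \<Rightarrow> 'b \<Rightarrow> 'a" where
  "adjoint_op T y = (THE z. \<forall>x. cinner (T x) y = cinner x z)"

lemma cinner_adjoint_right:
  fixes T :: "'a::chilbert_space \<Rightarrow> 'b::complex_inner"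
  assumes T: "bclinear T"
  shows "cinner x (adjoint_op T y) = cinner (T x) y"
proof -
  obtain K where K: "\<And>x. norm (T x) \<le> norm x * K"
    using bounded_linear.bounded [OF bclinearD(6) [OF T]] by blast
  have "cmod (cinner (T x) y) \<le> (K * norm y) * norm x" for x
    using Cauchy_Schwarz_cinner [of "T x" y] mult_right_mono [OF K [of x] norm_ge_zero [of y]]
    by (simp add: mult_ac)
  then have "\<exists>z. \<forall>x. cinner (T x) y = cinner x z"
    by (intro riesz [where B = "K * norm y"])
      (simp_all add: bclinearD [OF T] cinner_add_left cinner_scaleC_left)
  then have "\<exists>!z. \<forall>x. cinner (T x) y = cinner x z"
    by (metis cinner_eqI)
  from theI' [OF this] have "\<forall>x. cinner (T x) y = cinner x (adjoint_op T y)"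
    unfolding adjoint_op_def .
  then show ?thesis by simp
qed

lemma cinner_adjoint_left:
  fixes T :: "'a::chilbert_space \<Rightarrow> 'b::complex_inner"
  assumes "bclinear T"
  shows "cinner (adjoint_op T y) x = cinner y (T x)"
  using cinner_adjoint_right [OF assms, of x y] cinner_commute [of _ x]
    cinner_commute [of y] by simp

lemma norm_adjoint_le:
  fixes T :: "'a::chilbert_space \<Rightarrow> 'b::complex_inner"
  assumes T: "bclinear T" and K: "\<And>x. norm (T x) \<le> K * norm x" "0 \<le> K"
  shows "norm (adjoint_op T y) \<le> K * norm y"
proof (cases "adjoint_op T y = 0")
  case True
  then show ?thesis
    using K(2) by simp
next
  case False
  let ?z = "adjoint_op T y"
  have "norm ?z * norm ?z = cmod (cinner ?z ?z)"
    by (simp add: cinner_self power2_eq_square norm_mult)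
  also have "\<dots> = cmod (cinner (T ?z) y)"
    by (simp add: cinner_adjoint_right [OF T])
  also have "\<dots> \<le> norm (T ?z) * norm y"
    by (rule Cauchy_Schwarz_cinner)
  also have "\<dots> \<le> (K * norm ?z) * norm y"
    by (intro mult_right_mono K(1)) simp
  finally show ?thesis
    using False by (simp add: mult_ac)
qed

lemma bclinear_adjoint:
  fixes T :: "'a::chilbert_space \<Rightarrow> 'b::complex_inner"
  assumes T: "bclinear T"
  shows "bclinear (adjoint_op T)"
proof -
  obtain K where K: "0 \<le> K" "\<And>x. norm (T x) \<le> K * norm x"
    using bounded_linear.nonneg_bounded [OF bclinearD(6) [OF T]] by (auto simp: mult.commute)
  show ?thesis
    by (rule bclinearI [OF _ _ norm_adjoint_le [OF T K(2,1)]])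
      (rule cinner_eqI, simp add: cinner_adjoint_right [OF T] cinner_algebra)+
qed

lemma contraction_adjoint:
  fixes T :: "'a::chilbert_space \<Rightarrow> 'a"
  assumes "contraction T"
  shows "contraction (adjoint_op T)"
  using assms norm_adjoint_le [of T 1] bclinear_adjoint [of T] by (simp add: contraction_iff)

lemma adjoint_isometry:
  fixes T :: "'a::chilbert_space \<Rightarrow> 'b::complex_inner"
  assumes T: "bclinear T" and iso: "\<And>x y. cinner (T x) (T y) = cinner x y"
  shows "adjoint_op T (T x) = x"
  by (rule cinner_eqI) (simp add: cinner_adjoint_right [OF T] iso)

lemma cinner_isometry:
  fixes T :: "'a::complex_inner \<Rightarrow> 'b::complex_inner"
  assumes T: "bclinear T" and iso: "\<And>x. norm (T x) = norm x"
  shows "cinner (T x) (T y) = cinner x y"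
proof -
  have Re: "Re (cinner (T x) (T y)) = Re (cinner x y)" for x y
    using norm_add_square [of "T x" "T y"] norm_add_square [of x y]
    by (simp add: iso flip: bclinearD(1) [OF T])
  have "Im (cinner (T x) (T y)) = Im (cinner x y)"
    using Re [of "\<i> *\<^sub>C x" y] by (simp add: bclinearD [OF T] cinner_scaleC_left)
  then show ?thesis
    using Re by (simp add: complex_eq_iff)
qed

section \<open>Products and square-summable sequences\<close>

instantiation prod :: (complex_inner, complex_inner) complex_inner
begin

definition scaleC_prod_def: "a *\<^sub>C p = (a *\<^sub>C fst p, a *\<^sub>C snd p)"

definition cinner_prod_def: "cinner p q = cinner (fst p) (fst q) + cinner (snd p) (snd q)"

instance
proof
  fix x y z :: "'a \<times> 'b" and a b :: complex
  show "cinner x y = cnj (cinner y x)"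
    using cinner_commute [of "fst x"] cinner_commute [of "snd x"] by (simp add: cinner_prod_def)
  show "norm x = sqrt (Re (cinner x x))"
    by (simp add: norm_prod_def cinner_prod_def Re_cinner_self)
qed (simp_all add: scaleC_prod_def cinner_prod_def scaleC_add_right scaleC_add_left scaleC_scaleC
    scaleR_scaleC cinner_add_left cinner_scaleC_left prod_eq_iff distrib_left)

end

instance prod :: (chilbert_space, chilbert_space) chilbert_space ..

lemma scaleC_Pair: "a *\<^sub>C (x, y) = (a *\<^sub>C x, a *\<^sub>C y)"
  by (simp add: scaleC_prod_def)

lemma fst_scaleC [simp]: "fst (a *\<^sub>C p) = a *\<^sub>C fst p"
  by (simp add: scaleC_prod_def)

lemma snd_scaleC [simp]: "snd (a *\<^sub>C p) = a *\<^sub>C snd p"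
  by (simp add: scaleC_prod_def)

lemma norm_prod_square: "(norm p)\<^sup>2 = (norm (fst p))\<^sup>2 + (norm (snd p))\<^sup>2"
  by (simp add: norm_prod_def)

typedef (overloaded) 'a l2 =
  "{f :: nat \<Rightarrow> 'a::complex_inner. summable (\<lambda>n. (norm (f n))\<^sup>2)}"
  morphisms coord Abs_l2
  by (intro exI [of _ "\<lambda>_. 0"]) simp

setup_lifting type_definition_l2

lemma summable_coord: "summable (\<lambda>n. (norm (coord x n))\<^sup>2)"
  using coord [of x] by simp

lemma l2_eqI: "(\<And>n. coord x n = coord y n) \<Longrightarrow> x = y"
  by (simp add: coord_inject [symmetric] fun_eq_iff)

lemma norm_add_square_le:
  "(norm (x + y :: 'a::real_normed_vector))\<^sup>2 \<le> 2 * (norm x)\<^sup>2 + 2 * (norm y)\<^sup>2"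
proof -
  have "(norm (x + y))\<^sup>2 \<le> (norm x + norm y)\<^sup>2"
    by (intro power_mono norm_triangle_ineq) simp
  also have "\<dots> \<le> 2 * (norm x)\<^sup>2 + 2 * (norm y)\<^sup>2"
    using zero_le_power2 [of "norm x - norm y"] by (simp add: power2_diff power2_sum)
  finally show ?thesis .
qed

lemma summable_norm_add_square:
  fixes f g :: "nat \<Rightarrow> 'a::real_normed_vector"
  assumes "summable (\<lambda>n. (norm (f n))\<^sup>2)" "summable (\<lambda>n. (norm (g n))\<^sup>2)"
  shows "summable (\<lambda>n. (norm (f n + g n))\<^sup>2)"
proof (rule summable_comparison_test')
  show "summable (\<lambda>n. 2 * (norm (f n))\<^sup>2 + 2 * (norm (g n))\<^sup>2)"
    by (intro summable_add summable_mult assms)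
qed (use norm_add_square_le in auto)

lemma summable_cinner:
  fixes f g :: "nat \<Rightarrow> 'a::complex_inner"
  assumes "summable (\<lambda>n. (norm (f n))\<^sup>2)" "summable (\<lambda>n. (norm (g n))\<^sup>2)"
  shows "summable (\<lambda>n. cinner (f n) (g n))"
proof (rule summable_comparison_test')
  show "summable (\<lambda>n. (norm (f n))\<^sup>2 + (norm (g n))\<^sup>2)"
    by (intro summable_add assms)
  show "norm (cinner (f n) (g n)) \<le> (norm (f n))\<^sup>2 + (norm (g n))\<^sup>2" for n
  proof -
    have "norm (f n) * norm (g n) \<le> (norm (f n))\<^sup>2 + (norm (g n))\<^sup>2"
      using zero_le_power2 [of "norm (f n) - norm (g n)"]
        mult_nonneg_nonneg [OF norm_ge_zero norm_ge_zero, of "f n" "g n"]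
      unfolding power2_diff by linarith
    then show ?thesis
      using Cauchy_Schwarz_cinner order_trans by blast
  qed
qed

instantiation l2 :: (complex_inner) complex_inner
begin

lift_definition zero_l2 :: "'a l2" is "\<lambda>_. 0" by simp

lift_definition plus_l2 :: "'a l2 \<Rightarrow> 'a l2 \<Rightarrow> 'a l2" is "\<lambda>f g n. f n + g n"
  by (rule summable_norm_add_square)

lift_definition uminus_l2 :: "'a l2 \<Rightarrow> 'a l2" is "\<lambda>f n. - f n" by simp

definition minus_l2_def: "x - y = x + (- y)" for x y :: "'a l2"

lift_definition scaleC_l2 :: "complex \<Rightarrow> 'a l2 \<Rightarrow> 'a l2" is "\<lambda>a f n. a *\<^sub>C f n"
  by (simp add: norm_scaleC power_mult_distrib summable_mult)

lift_definition scaleR_l2 :: "real \<Rightarrow> 'a l2 \<Rightarrow> 'a l2" is "\<lambda>a f n. a *\<^sub>R f n"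
  by (simp add: power_mult_distrib summable_mult)

definition cinner_l2_def: "cinner x y = (\<Sum>n. cinner (coord x n) (coord y n))"
  for x y :: "'a l2"

definition norm_l2_def: "norm x = sqrt (\<Sum>n. (norm (coord x n))\<^sup>2)" for x :: "'a l2"

definition sgn_l2_def: "sgn x = inverse (norm x) *\<^sub>R x" for x :: "'a l2"

definition dist_l2_def: "dist x y = norm (x - y)" for x y :: "'a l2"

definition uniformity_l2_def:
  "uniformity = (INF e\<in>{0<..}. principal {(x, y). dist x (y :: 'a l2) < e})"

definition open_l2_def:
  "open U \<longleftrightarrow> (\<forall>x\<in>U. eventually (\<lambda>(x', y). x' = x \<longrightarrow> y \<in> U) uniformity)" for U :: "'a l2 set"

lemma coord_simps [simp]:
  "coord 0 n = (0 :: 'a)" "coord (x + y) n = coord x n + coord y n"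
  "coord (- x) n = - coord x n" "coord (x - y) n = coord x n - coord y n"
  "coord (a *\<^sub>C x) n = a *\<^sub>C coord x n" "coord (r *\<^sub>R x) n = r *\<^sub>R coord x n"
  for x y :: "'a l2"
  by (simp_all add: zero_l2.rep_eq plus_l2.rep_eq uminus_l2.rep_eq minus_l2_def scaleC_l2.rep_eq
      scaleR_l2.rep_eq)

instance
proof
  fix x y z :: "'a l2" and a b :: complex and r s :: real
  note summable_coord [simp]
  have sc: "summable (\<lambda>n. cinner (coord x n) (coord y n))" for x y :: "'a l2"
    by (intro summable_cinner) simp_all
  have nonneg: "0 \<le> (\<Sum>n. (norm (coord x n))\<^sup>2)" for x :: "'a l2"
    by (intro suminf_nonneg) simp_all
  have norm_sq: "(norm x)\<^sup>2 = (\<Sum>n. (norm (coord x n))\<^sup>2)" for x :: "'a l2"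
    using nonneg by (simp add: norm_l2_def)
  show "x + y + z = x + (y + z)" "x + y = y + x" "0 + x = x" "- x + x = 0" "x - y = x + - y"
    "r *\<^sub>R (x + y) = r *\<^sub>R x + r *\<^sub>R y" "(r + s) *\<^sub>R x = r *\<^sub>R x + s *\<^sub>R x"
    "r *\<^sub>R s *\<^sub>R x = (r * s) *\<^sub>R x" "1 *\<^sub>R x = x"
    "a *\<^sub>C (x + y) = a *\<^sub>C x + a *\<^sub>C y" "(a + b) *\<^sub>C x = a *\<^sub>C x + b *\<^sub>C x"
    "a *\<^sub>C b *\<^sub>C x = (a * b) *\<^sub>C x" "r *\<^sub>R x = complex_of_real r *\<^sub>C x"
    by (auto intro!: l2_eqI simp: algebra_simps scaleC_add_right scaleC_add_left scaleC_scaleC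
        scaleR_scaleC)
  show "dist x y = norm (x - y)" "sgn x = inverse (norm x) *\<^sub>R x"
    by (simp_all add: dist_l2_def sgn_l2_def)
  show "uniformity = (INF e\<in>{0<..}. principal {(x, y). dist x (y :: 'a l2) < e})"
    by (fact uniformity_l2_def)
  show "open U = (\<forall>x\<in>U. eventually (\<lambda>(x', y). x' = x \<longrightarrow> y \<in> U) uniformity)" for U :: "'a l2 set"
    by (fact open_l2_def)
  show "norm x = 0 \<longleftrightarrow> x = 0"
    by (auto simp: norm_l2_def suminf_eq_zero_iff intro!: l2_eqI)
  have "L2_set (\<lambda>n. norm (coord x n)) {..<k} \<le> norm x" for x :: "'a l2" and k
    unfolding L2_set_def norm_l2_def by (intro real_sqrt_le_mono sum_le_suminf) simp_all
  then have "L2_set (\<lambda>n. norm (coord x n) + norm (coord y n)) {..<k} \<le> norm x + norm y" for k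
    by (intro order_trans [OF L2_set_triangle_ineq] add_mono)
  moreover have "L2_set (\<lambda>n. norm (coord (x + y) n)) {..<k}
      \<le> L2_set (\<lambda>n. norm (coord x n) + norm (coord y n)) {..<k}" for k
    by (intro L2_set_mono) (simp_all add: norm_triangle_ineq)
  ultimately have L: "L2_set (\<lambda>n. norm (coord (x + y) n)) {..<k} \<le> norm x + norm y" for k
    using order_trans by blast
  have pos: "0 \<le> norm x + norm y"
    using nonneg by (simp add: norm_l2_def)
  have "(\<Sum>n<k. (norm (coord (x + y) n))\<^sup>2) \<le> (norm x + norm y)\<^sup>2" for k
    using power_mono [OF L [of k], of 2] by (simp add: L2_set_def sum_nonneg)
  then have "(norm (x + y))\<^sup>2 \<le> (norm x + norm y)\<^sup>2"
    unfolding norm_sq by (intro suminf_le_const summable_coord)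
  then show "norm (x + y) \<le> norm x + norm y"
    by (rule power2_le_imp_le) (rule pos)
  show "norm (r *\<^sub>R x) = \<bar>r\<bar> * norm x"
    by (simp add: norm_l2_def power_mult_distrib suminf_mult real_sqrt_mult)
  show "cinner x y = cnj (cinner y x)"
    unfolding cinner_l2_def
    using bounded_linear.suminf [OF bounded_linear_cnj sc [of y x]] by (simp flip: cinner_commute)
  show "cinner (x + y) z = cinner x z + cinner y z"
    by (simp add: cinner_l2_def cinner_add_left suminf_add [OF sc sc])
  show "cinner (a *\<^sub>C x) y = a * cinner x y"
    by (simp add: cinner_l2_def cinner_scaleC_left suminf_mult [OF sc])
  have "Re (cinner x x) = (\<Sum>n. Re (cinner (coord x n) (coord x n)))"
    unfolding cinner_l2_def using bounded_linear.suminf [OF bounded_linear_Re sc [of x x]] by simp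
  then show "norm x = sqrt (Re (cinner x x))"
    by (simp add: norm_l2_def Re_cinner_self)
qed

end

lemma norm_l2_square: "(norm x)\<^sup>2 = (\<Sum>n. (norm (coord x n))\<^sup>2)"
  by (simp add: norm_l2_def suminf_nonneg summable_coord)

lemma norm_l2_sums: "(\<lambda>n. (norm (coord x n))\<^sup>2) sums (norm x)\<^sup>2"
  by (simp add: norm_l2_square summable_coord summable_sums)

lemma sum_coord_le: "(\<Sum>n<k. (norm (coord x n))\<^sup>2) \<le> (norm x)\<^sup>2"
  unfolding norm_l2_square by (intro sum_le_suminf) (simp_all add: summable_coord)

lemma norm_coord_le: "norm (coord x n) \<le> norm x"
proof (rule power2_le_imp_le)
  have "(norm (coord x n))\<^sup>2 \<le> (\<Sum>i<Suc n. (norm (coord x i))\<^sup>2)"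
    by (intro member_le_sum) simp_all
  then show "(norm (coord x n))\<^sup>2 \<le> (norm x)\<^sup>2"
    using sum_coord_le order_trans by blast
qed simp

instance l2 :: (chilbert_space) chilbert_space
proof
  fix X :: "nat \<Rightarrow> 'a l2"
  assume X: "Cauchy X"
  have coord_dist: "dist (coord (X m) i) (coord (X n) i) \<le> dist (X m) (X n)" for m n i
    using norm_coord_le [of "X m - X n" i] by (simp add: dist_norm)
  have "Cauchy (\<lambda>m. coord (X m) i)" for i
  proof (rule metric_CauchyI)
    fix e :: real assume "e > 0"
    then obtain N where "\<forall>m\<ge>N. \<forall>n\<ge>N. dist (X m) (X n) < e"
      using X metric_CauchyD by blast
    then show "\<exists>N. \<forall>m\<ge>N. \<forall>n\<ge>N. dist (coord (X m) i) (coord (X n) i) < e"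
      using le_less_trans [OF coord_dist] by blast
  qed
  then have "\<exists>l. (\<lambda>m. coord (X m) i) \<longlonglongrightarrow> l" for i
    using Cauchy_convergent convergent_def by blast
  then obtain f where f: "\<And>i. (\<lambda>m. coord (X m) i) \<longlonglongrightarrow> f i"
    by metis
  have tail: "(\<Sum>i<k. (norm (coord (X m) i - f i))\<^sup>2) \<le> e\<^sup>2"
    if "\<forall>m\<ge>N. \<forall>n\<ge>N. dist (X m) (X n) < e" "m \<ge> N" for e N m k
  proof (rule LIMSEQ_le_const2)
    show "(\<lambda>n. \<Sum>i<k. (norm (coord (X m) i - coord (X n) i))\<^sup>2)
        \<longlonglongrightarrow> (\<Sum>i<k. (norm (coord (X m) i - f i))\<^sup>2)"
      by (intro tendsto_intros f)
    have "(\<Sum>i<k. (norm (coord (X m) i - coord (X n) i))\<^sup>2) \<le> e\<^sup>2" if "n \<ge> N" for n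
    proof -
      have "(\<Sum>i<k. (norm (coord (X m) i - coord (X n) i))\<^sup>2) \<le> (norm (X m - X n))\<^sup>2"
        using sum_coord_le [of "X m - X n" k] by simp
      also have "\<dots> \<le> e\<^sup>2"
        using \<open>\<forall>m\<ge>N. \<forall>n\<ge>N. dist (X m) (X n) < e\<close> \<open>m \<ge> N\<close> that
        by (intro power_mono) (auto simp: dist_norm intro: less_imp_le)
      finally show ?thesis .
    qed
    then show "\<exists>N. \<forall>n\<ge>N. (\<Sum>i<k. (norm (coord (X m) i - coord (X n) i))\<^sup>2) \<le> e\<^sup>2"
      by blast
  qed
  have summ: "summable (\<lambda>i. (norm (coord (X m) i - f i))\<^sup>2)"
    if "\<forall>m\<ge>N. \<forall>n\<ge>N. dist (X m) (X n) < e" "m \<ge> N" for e N m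
    using tail [OF that] by (intro bounded_imp_summable [where B = "e\<^sup>2"])
      (auto simp: lessThan_Suc_atMost [symmetric] simp del: sum.lessThan_Suc)
  obtain N1 where N1: "\<forall>m\<ge>N1. \<forall>n\<ge>N1. dist (X m) (X n) < 1"
    using X metric_CauchyD zero_less_one by blast
  have "summable (\<lambda>i. (norm (f i))\<^sup>2)"
    using summable_norm_add_square [OF summable_coord [of "X N1"], of "\<lambda>i. f i - coord (X N1) i"]
      summ [OF N1, of N1] by (simp add: norm_minus_commute)
  then have cf: "coord (Abs_l2 f) = f"
    by (simp add: Abs_l2_inverse)
  have "X \<longlonglongrightarrow> Abs_l2 f"
  proof (rule metric_LIMSEQ_I)
    fix e :: real assume e: "e > 0"
    then obtain N where N: "\<forall>m\<ge>N. \<forall>n\<ge>N. dist (X m) (X n) < e / 2"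
      using X metric_CauchyD half_gt_zero by blast
    have "dist (X m) (Abs_l2 f) < e" if "m \<ge> N" for m
    proof -
      have "(norm (X m - Abs_l2 f))\<^sup>2 \<le> (e / 2)\<^sup>2"
        unfolding norm_l2_square using tail [OF N that] summ [OF N that]
        by (intro suminf_le_const) (simp_all add: cf)
      then have "norm (X m - Abs_l2 f) \<le> e / 2"
        by (rule power2_le_imp_le) (use e in simp)
      then show ?thesis
        using e by (simp add: dist_norm)
    qed
    then show "\<exists>N. \<forall>m\<ge>N. dist (X m) (Abs_l2 f) < e" by blast
  qed
  then show "convergent X"
    by (auto simp: convergent_def)
qed

text \<open>A sequence of component maps whose square norms are summable defines an operator into the
  sequence space. Defect operators, shifts and blockwise operators are all obtained in this way.\<close>

lemma l2_operator_exists: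
  fixes t :: "nat \<Rightarrow> 'a::complex_inner \<Rightarrow> 'b::complex_inner"
  assumes add: "\<And>n x y. t n (x + y) = t n x + t n y"
    and scale: "\<And>n a x. t n (a *\<^sub>C x) = a *\<^sub>C t n x"
    and sums: "\<And>x. (\<lambda>n. (norm (t n x))\<^sup>2) sums s x"
    and bound: "\<And>x. s x \<le> (norm x)\<^sup>2"
  shows "\<exists>T. bclinear T \<and> (\<forall>x n. coord (T x) n = t n x) \<and> (\<forall>x. (norm (T x))\<^sup>2 = s x)"
proof -
  define T where "T x = Abs_l2 (\<lambda>n. t n x)" for x
  have coord_T: "coord (T x) n = t n x" for x n
    using sums [of x] by (simp add: T_def Abs_l2_inverse sums_iff)
  have norm_T: "(norm (T x))\<^sup>2 = s x" for x
    using sums [of x] by (simp add: norm_l2_square coord_T sums_iff)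
  have "norm (T x) \<le> 1 * norm x" for x
    using norm_T bound by (simp add: power2_le_imp_le)
  then have "bclinear T"
    by (intro bclinearI [where K = 1]) (auto intro!: l2_eqI simp: coord_T add scale)
  then show ?thesis
    using coord_T norm_T by blast
qed

section \<open>Defect operators\<close>

text \<open>A factorisation \<open>I - S\<^sup>* S = D\<^sup>* D\<close> without square roots of operators. Put \<open>Q\<^sub>0 = I - S\<^sup>* S\<close> and
  \<open>Q\<^sub>n\<^sub>+\<^sub>1 = Q\<^sub>n - Q\<^sub>n\<^sup>2\<close>. The squares telescope to \<open>\<Sum>Q\<^sub>n\<^sup>2 = Q\<^sub>0\<close>, so \<open>D\<close> can be taken to be the column of all \<open>Q\<^sub>n\<close>,
  with values in the space of square-summable sequences.\<close>

primrec defect_seq :: "('a::complex_inner \<Rightarrow> 'a) \<Rightarrow> nat \<Rightarrow> 'a \<Rightarrow> 'a" where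
  "defect_seq S 0 = (\<lambda>x. x - adjoint_op S (S x))"
| "defect_seq S (Suc n) = (\<lambda>x. defect_seq S n x - defect_seq S n (defect_seq S n x))"

text \<open>Positivity at \<open>x - Q x\<close> and the bound \<open>Q \<le> I\<close> at \<open>Q x\<close> combine to \<open>Q\<^sup>2 \<le> Q\<close>.\<close>

lemma positive_contraction_square_le:
  fixes Q :: "'a::complex_inner \<Rightarrow> 'a"
  assumes diff: "\<And>x y. Q (x - y) = Q x - Q y"
    and sym: "\<And>x y. cinner (Q x) y = cinner x (Q y)"
    and pos: "\<And>x. 0 \<le> Re (cinner (Q x) x)"
    and le: "\<And>x. Re (cinner (Q x) x) \<le> (norm x)\<^sup>2"
  shows "(norm (Q x))\<^sup>2 \<le> Re (cinner (Q x) x)"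
proof -
  have "0 \<le> Re (cinner (Q x - Q (Q x)) (x - Q x))"
    using pos [of "x - Q x"] by (simp add: diff)
  also have "\<dots> = Re (cinner (Q x) x) - 2 * (norm (Q x))\<^sup>2 + Re (cinner (Q (Q x)) (Q x))"
    by (simp add: cinner_diff_left cinner_diff_right sym [of "Q x" x] Re_cinner_self)
  finally show ?thesis
    using le [of "Q x"] by simp
qed

text \<open>The inequality \<open>Q\<^sup>2 \<le> Q\<close> keeps the recursion \<open>Q - Q\<^sup>2\<close> among the positive contractions.\<close>

lemma defect_seq:
  fixes S :: "'a::chilbert_space \<Rightarrow> 'a"
  assumes S: "contraction S"
  shows "defect_seq S n (x + y) = defect_seq S n x + defect_seq S n y"
    and "defect_seq S n (x - y) = defect_seq S n x - defect_seq S n y"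
    and "defect_seq S n (a *\<^sub>C x) = a *\<^sub>C defect_seq S n x"
    and "cinner (defect_seq S n x) y = cinner x (defect_seq S n y)"
    and "0 \<le> Re (cinner (defect_seq S n x) x)"
    and "Re (cinner (defect_seq S n x) x) \<le> (norm x)\<^sup>2"
proof -
  have bS: "bclinear S" "\<And>x. norm (S x) \<le> norm x"
    using S by (auto simp: contraction_iff)
  note lin = bclinearD [OF bS(1)] bclinearD [OF bclinear_adjoint [OF bS(1)]]
  have "(\<forall>x y. defect_seq S n (x + y) = defect_seq S n x + defect_seq S n y) \<and>
    (\<forall>x y. defect_seq S n (x - y) = defect_seq S n x - defect_seq S n y) \<and>
    (\<forall>a x. defect_seq S n (a *\<^sub>C x) = a *\<^sub>C defect_seq S n x) \<and>
    (\<forall>x y. cinner (defect_seq S n x) y = cinner x (defect_seq S n y)) \<and>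
    (\<forall>x. 0 \<le> Re (cinner (defect_seq S n x) x) \<and> Re (cinner (defect_seq S n x) x) \<le> (norm x)\<^sup>2)"
  proof (induction n)
    case 0
    have "Re (cinner (x - adjoint_op S (S x)) x) = (norm x)\<^sup>2 - (norm (S x))\<^sup>2" for x
      by (simp add: cinner_diff_left cinner_adjoint_left [OF bS(1)] Re_cinner_self)
    then show ?case
      using bS(2) by (auto simp: lin cinner_diff_left cinner_diff_right
        cinner_adjoint_left [OF bS(1)] cinner_adjoint_right [OF bS(1)] power_mono
        scaleC_diff_right)
  next
    case (Suc n)
    have "(norm (defect_seq S n x))\<^sup>2 \<le> Re (cinner (defect_seq S n x) x)" for x
      using Suc by (intro positive_contraction_square_le) auto
    moreover have "Re (cinner (defect_seq S (Suc n) x) x)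
        = Re (cinner (defect_seq S n x) x) - (norm (defect_seq S n x))\<^sup>2" for x
    proof -
      have "cinner (defect_seq S n (defect_seq S n x)) x
          = cinner (defect_seq S n x) (defect_seq S n x)"
        using Suc by blast
      then show ?thesis
        by (simp add: cinner_diff_left Re_cinner_self)
    qed
    moreover have "cinner (defect_seq S (Suc n) x) y = cinner x (defect_seq S (Suc n) y)" for x y
      using Suc by (simp add: cinner_diff_left cinner_diff_right)
    ultimately show ?case
      using Suc by (auto simp: scaleC_diff_right intro: order_trans [rotated])
  qed
  then show "defect_seq S n (x + y) = defect_seq S n x + defect_seq S n y"
    "defect_seq S n (x - y) = defect_seq S n x - defect_seq S n y"
    "defect_seq S n (a *\<^sub>C x) = a *\<^sub>C defect_seq S n x"
    "cinner (defect_seq S n x) y = cinner x (defect_seq S n y)"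
    "0 \<le> Re (cinner (defect_seq S n x) x)"
    "Re (cinner (defect_seq S n x) x) \<le> (norm x)\<^sup>2"
    by blast+
qed

text \<open>Partial sums are \<open>\<langle>Q\<^sub>0 x, x\<rangle> - \<langle>Q\<^sub>n x, x\<rangle>\<close>. They are bounded, which forces \<open>Q\<^sub>n x\<close> to tend to \<open>0\<close>,
  and this in turn removes the second term in the limit.\<close>

lemma defect_seq_sums:
  fixes S :: "'a::chilbert_space \<Rightarrow> 'a"
  assumes S: "contraction S"
  shows "(\<lambda>n. (norm (defect_seq S n x))\<^sup>2) sums ((norm x)\<^sup>2 - (norm (S x))\<^sup>2)"
proof -
  let ?Q = "defect_seq S"
  have "bclinear S" using S by (simp add: contraction_iff)
  then have Q0: "Re (cinner (?Q 0 x) x) = (norm x)\<^sup>2 - (norm (S x))\<^sup>2"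
    by (simp add: cinner_diff_left cinner_adjoint_left Re_cinner_self)
  have step: "Re (cinner (?Q (Suc n) x) x) = Re (cinner (?Q n x) x) - (norm (?Q n x))\<^sup>2" for n
    by (simp add: cinner_diff_left Re_cinner_self defect_seq(4) [OF S, of n "?Q n x" x])
  have part: "(\<Sum>k<n. (norm (?Q k x))\<^sup>2) = Re (cinner (?Q 0 x) x) - Re (cinner (?Q n x) x)" for n
  proof (induction n)
    case (Suc n)
    then show ?case
      using step [of n] by (simp del: defect_seq.simps)
  qed simp
  have "summable (\<lambda>n. (norm (?Q n x))\<^sup>2)"
  proof (rule bounded_imp_summable)
    show "(\<Sum>k\<le>n. (norm (?Q k x))\<^sup>2) \<le> Re (cinner (?Q 0 x) x)" for n
      using part [of "Suc n"] defect_seq(5) [OF S, of "Suc n" x]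
      by (simp add: lessThan_Suc_atMost del: defect_seq.simps sum.lessThan_Suc)
  qed simp
  then have "(\<lambda>n. sqrt ((norm (?Q n x))\<^sup>2)) \<longlonglongrightarrow> sqrt 0"
    by (intro tendsto_real_sqrt summable_LIMSEQ_zero)
  then have "(\<lambda>n. ?Q n x) \<longlonglongrightarrow> 0"
    by (simp add: tendsto_norm_zero_iff)
  then have "(\<lambda>n. Re (cinner (?Q 0 x) x) - Re (cinner (?Q n x) x))
      \<longlonglongrightarrow> Re (cinner (?Q 0 x) x) - Re (cinner 0 x)"
    by (intro tendsto_intros tendsto_cinner)
  then show ?thesis
    unfolding sums_def part using Q0 by simp
qed

lemma defect_operator_exists:
  fixes S :: "'a::chilbert_space \<Rightarrow> 'a"
  assumes "contraction S"
  shows "\<exists>D :: 'a \<Rightarrow> 'a l2. bclinear D \<and> (\<forall>x. (norm (D x))\<^sup>2 = (norm x)\<^sup>2 - (norm (S x))\<^sup>2)"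
  using l2_operator_exists [OF defect_seq(1,3) [OF assms] defect_seq_sums [OF assms]] by auto

section \<open>Extending a partial isometry to a unitary operator\<close>

lemma closure_range_sequential:
  fixes T :: "'a \<Rightarrow> 'b::first_countable_topology"
  assumes "x \<in> closure (range T)"
  obtains f where "(\<lambda>n. T (f n)) \<longlonglongrightarrow> x"
proof -
  obtain s where s: "\<forall>n. s n \<in> range T" "s \<longlonglongrightarrow> x"
    using assms unfolding closure_sequential by blast
  have "\<forall>n. \<exists>h. s n = T h" using s(1) by (simp add: image_iff)
  then obtain f where "\<And>n. s n = T (f n)" by (auto dest: choice)
  then have "s = (\<lambda>n. T (f n))" by (rule ext)
  then show ?thesis using s(2) that [of f] by blast
qed

lemma closed_csubspace_closure_range:
  assumes T: "bclinear T"
  shows "closed_csubspace (closure (range T))"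
  unfolding closed_csubspace_def
proof (intro conjI ballI allI)
  show "0 \<in> closure (range T)"
    using bclinearD(4) [OF T] closure_subset [of "range T"] by (metis rangeI subsetD)
  fix x assume "x \<in> closure (range T)"
  then obtain f where f: "(\<lambda>n. T (f n)) \<longlonglongrightarrow> x"
    by (rule closure_range_sequential)
  show "a *\<^sub>C x \<in> closure (range T)" for a
  proof -
    from bounded_linear.tendsto [OF bounded_linear_scaleC f] have "(\<lambda>n. T (a *\<^sub>C f n)) \<longlonglongrightarrow> a *\<^sub>C x"
      by (simp add: bclinearD [OF T])
    then show ?thesis
      unfolding closure_sequential by (intro exI [of _ "\<lambda>n. T (a *\<^sub>C f n)"]) simp
  qed
  fix y assume "y \<in> closure (range T)"
  then obtain g where g: "(\<lambda>n. T (g n)) \<longlonglongrightarrow> y"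
    by (rule closure_range_sequential)
  have "(\<lambda>n. T (f n + g n)) \<longlonglongrightarrow> x + y"
    using tendsto_add [OF f g] by (simp add: bclinearD [OF T])
  then show "x + y \<in> closure (range T)"
    unfolding closure_sequential by (intro exI [of _ "\<lambda>n. T (f n + g n)"]) simp
qed simp

text \<open>The map \<open>a h \<mapsto> b h\<close> is a partial isometry \<open>u\<close> with initial space \<open>cl (ran a)\<close> and final space
  \<open>cl (ran b)\<close>. With the projections \<open>P\<close> and \<open>Q\<close> onto these, Halmos' block matrix
  with rows \<open>(u, I - Q)\<close> and \<open>(I - P, - u\<^sup>*)\<close> is unitary on the doubled space; doubling is what makes
  the defect spaces of \<open>u\<close> match.

  The partial isometry is handled through its graph \<open>\<Gamma>\<close>, the closure of all pairs \<open>(a h, b h)\<close>. For each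
  \<open>x\<close> there is a unique point \<open>A x = (P x, u P x)\<close> of \<open>\<Gamma>\<close>, and for each \<open>y\<close> a unique point
  \<open>B y = (u\<^sup>* Q y, Q y)\<close>; every entry of the block matrix is a component of one of them.\<close>

lemma unitary_extension_exists:
  fixes a b :: "'h::complex_inner \<Rightarrow> 'f::chilbert_space"
  assumes a: "bclinear a" and b: "bclinear b" and ab: "\<And>h. norm (a h) = norm (b h)"
  shows "\<exists>G G' :: 'f \<times> 'f \<Rightarrow> 'f \<times> 'f. bclinear G \<and> bclinear G' \<and>
    (\<forall>p. norm (G p) = norm p) \<and> (\<forall>p. norm (G' p) = norm p) \<and>
    (\<forall>p. G (G' p) = p) \<and> (\<forall>p. G' (G p) = p) \<and> (\<forall>h. G (a h, 0) = (b h, 0))"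
proof -
  obtain Ka Kb where "0 \<le> Ka" "\<And>h. norm (a h) \<le> norm h * Ka" "0 \<le> Kb" "\<And>h. norm (b h) \<le> norm h * Kb"
    using bounded_linear.nonneg_bounded [OF bclinearD(6) [OF a]]
      bounded_linear.nonneg_bounded [OF bclinearD(6) [OF b]] by blast
  then have "norm (a h, b h) \<le> (Ka + Kb) * norm h" for h
    using norm_Pair_le [of "a h" "b h"] by (simp add: algebra_simps) (smt (verit))
  then have "bclinear (\<lambda>h. (a h, b h))"
    by (intro bclinearI [where K = "Ka + Kb"])
      (simp_all add: bclinearD [OF a] bclinearD [OF b] scaleC_Pair)
  then have \<Gamma>': "closed_csubspace (closure (range (\<lambda>h. (a h, b h))))"
    by (rule closed_csubspace_closure_range)
  define \<Gamma> where "\<Gamma> = closure (range (\<lambda>h. (a h, b h)))"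
  note \<Gamma> = closed_csubspaceD [OF \<Gamma>', folded \<Gamma>_def]
  have ab_\<Gamma>: "(a h, b h) \<in> \<Gamma>" for h
    unfolding \<Gamma>_def by (rule subsetD [OF closure_subset]) simp
  have "closed {p :: 'f \<times> 'f. norm (fst p) = norm (snd p)}"
    by (intro closed_Collect_eq continuous_intros)
  then have "\<Gamma> \<subseteq> {p. norm (fst p) = norm (snd p)}"
    unfolding \<Gamma>_def by (intro closure_minimal) (auto simp: ab)
  then have norm_\<Gamma>: "norm (fst p) = norm (snd p)" if "p \<in> \<Gamma>" for p
    using that by blast
  have Re_\<Gamma>: "Re (cinner (fst p) (fst q)) = Re (cinner (snd p) (snd q))"
    if "p \<in> \<Gamma>" "q \<in> \<Gamma>" for p q
    using norm_\<Gamma> [OF \<Gamma>(3) [OF that]] norm_add_square [of "fst p" "fst q"]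
      norm_add_square [of "snd p" "snd q"] norm_\<Gamma> that by simp
  have cinner_\<Gamma>: "cinner (fst p) (fst q) = cinner (snd p) (snd q)" if "p \<in> \<Gamma>" "q \<in> \<Gamma>" for p q
    using Re_\<Gamma> [OF that] Re_\<Gamma> [OF \<Gamma>(4) [OF that(1)] that(2), of \<i>]
    by (simp add: cinner_scaleC_left complex_eq_iff)
  have bound: "cmod (cinner (fst p) x) \<le> norm x * norm p" "cmod (cinner (snd p) x) \<le> norm x * norm p"
    for x and p :: "'f \<times> 'f"
    using Cauchy_Schwarz_cinner [of "fst p" x] Cauchy_Schwarz_cinner [of "snd p" x]
      mult_right_mono [OF norm_fst_le [of "fst p" "snd p"] norm_ge_zero [of x]]
      mult_right_mono [OF norm_snd_le [of "snd p" "fst p"] norm_ge_zero [of x]]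
    by (simp_all add: mult.commute [of "norm x"])
  \<comment> \<open>On \<open>\<Gamma>\<close> the inner product of the product space is twice that of the first components, so
      the Riesz vector of \<open>p \<mapsto> \<langle>fst p, x\<rangle>\<close> is half the point sought.\<close>
  have "\<exists>q\<in>\<Gamma>. \<forall>p\<in>\<Gamma>. cinner (fst p) (x - fst q) = 0" for x
  proof -
    obtain z where z: "z \<in> \<Gamma>" "\<And>p. p \<in> \<Gamma> \<Longrightarrow> cinner (fst p) x = cinner p z"
      using riesz_on_closed_csubspace [OF \<Gamma>', folded \<Gamma>_def, of "\<lambda>p. cinner (fst p) x", OF _ _ bound(1)]
      by (auto simp: cinner_add_left cinner_scaleC_left)
    then show ?thesis
      using \<Gamma>(4) [of z 2] cinner_\<Gamma> [OF _ z(1)]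
      by (intro bexI [of _ "2 *\<^sub>C z"]) (auto simp: cinner_prod_def cinner_algebra)
  qed
  then obtain A where A: "\<And>x. A x \<in> \<Gamma>" "\<And>x p. p \<in> \<Gamma> \<Longrightarrow> cinner (fst p) (x - fst (A x)) = 0"
    by metis
  have "\<exists>q\<in>\<Gamma>. \<forall>p\<in>\<Gamma>. cinner (snd p) (x - snd q) = 0" for x
  proof -
    obtain z where z: "z \<in> \<Gamma>" "\<And>p. p \<in> \<Gamma> \<Longrightarrow> cinner (snd p) x = cinner p z"
      using riesz_on_closed_csubspace [OF \<Gamma>', folded \<Gamma>_def, of "\<lambda>p. cinner (snd p) x", OF _ _ bound(2)]
      by (auto simp: cinner_add_left cinner_scaleC_left)
    then show ?thesis
      using \<Gamma>(4) [of z 2] cinner_\<Gamma> [OF _ z(1)]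
      by (intro bexI [of _ "2 *\<^sub>C z"]) (auto simp: cinner_prod_def cinner_algebra)
  qed
  then obtain B where B: "\<And>x. B x \<in> \<Gamma>" "\<And>x p. p \<in> \<Gamma> \<Longrightarrow> cinner (snd p) (x - snd (B x)) = 0"
    by metis
  have zero: "d = 0" if "d \<in> \<Gamma>" "fst d = 0 \<or> snd d = 0" for d
    using norm_\<Gamma> [OF that(1)] that(2) by (auto simp: prod_eq_iff)
  have A_eq: "A x = q" if q: "q \<in> \<Gamma>" "\<And>p. p \<in> \<Gamma> \<Longrightarrow> cinner (fst p) (x - fst q) = 0" for x q
  proof -
    let ?d = "A x - q"
    have d: "?d \<in> \<Gamma>" by (intro \<Gamma>(6) A(1) q(1))
    have "cinner (fst ?d) (fst ?d) = cinner (fst ?d) (x - fst q) - cinner (fst ?d) (x - fst (A x))"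
      by (simp only: fst_diff snd_diff cinner_diff_right) simp
    then have "cinner (fst ?d) (fst ?d) = 0"
      by (simp only: q(2) [OF d] A(2) [OF d] diff_self)
    then have "fst ?d = 0"
      by (simp only: cinner_self of_real_eq_0_iff power_eq_0_iff norm_eq_zero)
    then show ?thesis using zero [OF d] by simp
  qed
  have B_eq: "B x = q" if q: "q \<in> \<Gamma>" "\<And>p. p \<in> \<Gamma> \<Longrightarrow> cinner (snd p) (x - snd q) = 0" for x q
  proof -
    let ?d = "B x - q"
    have d: "?d \<in> \<Gamma>" by (intro \<Gamma>(6) B(1) q(1))
    have "cinner (snd ?d) (snd ?d) = cinner (snd ?d) (x - snd q) - cinner (snd ?d) (x - snd (B x))"
      by (simp only: fst_diff snd_diff cinner_diff_right) simp
    then have "cinner (snd ?d) (snd ?d) = 0"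
      by (simp only: q(2) [OF d] B(2) [OF d] diff_self)
    then have "snd ?d = 0"
      by (simp only: cinner_self of_real_eq_0_iff power_eq_0_iff norm_eq_zero)
    then show ?thesis using zero [OF d] by simp
  qed
  have A_add: "A (x + y) = A x + A y" for x y
  proof (rule A_eq)
    show "cinner (fst p) (x + y - fst (A x + A y)) = 0" if "p \<in> \<Gamma>" for p
      using A(2) [OF that, of x] A(2) [OF that, of y] by (simp add: cinner_algebra)
  qed (intro \<Gamma>(3) A(1))
  have B_add: "B (x + y) = B x + B y" for x y
  proof (rule B_eq)
    show "cinner (snd p) (x + y - snd (B x + B y)) = 0" if "p \<in> \<Gamma>" for p
      using B(2) [OF that, of x] B(2) [OF that, of y] by (simp add: cinner_algebra)
  qed (intro \<Gamma>(3) B(1))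
  have A_scale: "A (c *\<^sub>C x) = c *\<^sub>C A x" for c x
  proof (rule A_eq)
    show "cinner (fst p) (c *\<^sub>C x - fst (c *\<^sub>C A x)) = 0" if "p \<in> \<Gamma>" for p
      using A(2) [OF that, of x] by (simp add: cinner_algebra)
  qed (intro \<Gamma>(4) A(1))
  have B_scale: "B (c *\<^sub>C x) = c *\<^sub>C B x" for c x
  proof (rule B_eq)
    show "cinner (snd p) (c *\<^sub>C x - snd (c *\<^sub>C B x)) = 0" if "p \<in> \<Gamma>" for p
      using B(2) [OF that, of x] by (simp add: cinner_algebra)
  qed (intro \<Gamma>(4) B(1))
  have A_minus: "A (- x) = - A x" and B_minus: "B (- x) = - B x" for x
    using A_scale [of "-1" x] B_scale [of "-1" x] by simp_all
  have A_diff: "A (x - y) = A x - A y" and B_diff: "B (x - y) = B x - B y" for x y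
    using A_add [of x "- y"] B_add [of x "- y"] by (simp_all add: A_minus B_minus)
  have A_fst: "A (fst p) = p" and B_snd: "B (snd p) = p" if "p \<in> \<Gamma>" for p
    using that by (auto intro!: A_eq B_eq)
  have A0: "A (x - fst (A x)) = 0" and B0: "B (x - snd (B x)) = 0" for x
    using A_fst [OF A(1)] B_snd [OF B(1)] by (simp_all add: A_diff B_diff)
  define G where "G p = (snd (A (fst p)) + (snd p - snd (B (snd p))),
    (fst p - fst (A (fst p))) - fst (B (snd p)))" for p
  define G' where "G' p = (fst (B (fst p)) + (snd p - fst (A (snd p))),
    (fst p - snd (B (fst p))) - snd (A (snd p)))" for p
  have BG: "B (fst (G p)) = A (fst p)" and AG: "A (snd (G p)) = - B (snd p)" for p
    unfolding G_def fst_conv snd_conv B_add A_diff [of "_ - _" "fst (B (snd p))"] B0 A0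
    by (simp_all add: A_fst B_snd A B)
  have AG': "A (fst (G' p)) = B (fst p)" and BG': "B (snd (G' p)) = - A (snd p)" for p
    unfolding G'_def fst_conv snd_conv A_add B_diff [of "_ - _" "snd (A (snd p))"] B0 A0
    by (simp_all add: A_fst B_snd A B)
  have G'G: "G' (G p) = p" for p
    unfolding G'_def [of "G p"] BG AG by (simp add: G_def)
  have GG': "G (G' p) = p" for p
    unfolding G_def [of "G' p"] BG' AG' by (simp add: G'_def)
  have norm_G: "norm (G p) = norm p" for p
  proof -
    obtain x y where p: "p = (x, y)" by fastforce
    have 1: "(norm x)\<^sup>2 = (norm (fst (A x)))\<^sup>2 + (norm (x - fst (A x)))\<^sup>2"
      using norm_add_square_orthogonal [OF A(2) [OF A(1) [of x], of x]] by simp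
    have 2: "(norm y)\<^sup>2 = (norm (snd (B y)))\<^sup>2 + (norm (y - snd (B y)))\<^sup>2"
      using norm_add_square_orthogonal [OF B(2) [OF B(1) [of y], of y]] by simp
    have 3: "(norm (snd (A x) + (y - snd (B y))))\<^sup>2
        = (norm (fst (A x)))\<^sup>2 + (norm (y - snd (B y)))\<^sup>2"
      using norm_add_square_orthogonal [OF B(2) [OF A(1) [of x], of y]] norm_\<Gamma> [OF A(1)] by simp
    have "Re (cinner (x - fst (A x)) (fst (B y))) = 0"
      using A(2) [OF B(1) [of y], of x] Re_cinner_commute by (metis zero_complex.sel(1))
    then have 4: "(norm ((x - fst (A x)) - fst (B y)))\<^sup>2
        = (norm (x - fst (A x)))\<^sup>2 + (norm (snd (B y)))\<^sup>2"
      using norm_\<Gamma> [OF B(1) [of y]] by (simp only: norm_diff_square [of "x - fst (A x)"])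
    have "(norm (G p))\<^sup>2 = (norm p)\<^sup>2"
      using 1 2 3 4 by (simp add: p norm_prod_square G_def)
    then show ?thesis by (simp add: power2_eq_iff_nonneg)
  qed
  have norm_G': "norm (G' p) = norm p" for p
    using norm_G [of "G' p"] GG' by simp
  have "bclinear G"
    by (rule bclinearI [where K = 1])
      (simp_all add: norm_G, simp_all add: G_def A_add B_add A_scale B_scale scaleC_prod_def
        scaleC_add_right scaleC_diff_right)
  moreover have "bclinear G'"
    by (rule bclinearI [where K = 1])
      (simp_all add: norm_G', simp_all add: G'_def A_add B_add A_scale B_scale scaleC_prod_def
        scaleC_add_right scaleC_diff_right)
  moreover have "G (a h, 0) = (b h, 0)" for h
    using A_fst [OF ab_\<Gamma> [of h]] B_snd [OF \<Gamma>(2)] by (simp add: G_def)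
  ultimately show ?thesis
    using norm_G norm_G' GG' G'G by blast
qed

section \<open>Commuting isometric dilations of a pair of contractions\<close>

text \<open>The Sz.-Nagy--Schaeffer isometric dilation \<open>(h, k\<^sub>0, k\<^sub>1, \<dots>) \<mapsto> (S h, D h, k\<^sub>0, k\<^sub>1, \<dots>)\<close>, with the entries
  grouped into blocks of two. A product of two such shifts then moves by exactly one block, and an
  operator on blocks can act on the two entries that the product creates.\<close>

lemma shift_isometry_exists:
  fixes S :: "'a::complex_inner \<Rightarrow> 'a" and D :: "'a \<Rightarrow> 'm::complex_inner"
  assumes S: "bclinear S" and D: "bclinear D"
    and defect: "\<And>h. (norm (D h))\<^sup>2 = (norm h)\<^sup>2 - (norm (S h))\<^sup>2"
  shows "\<exists>W :: 'a \<times> ('m \<times> 'm) l2 \<Rightarrow> 'a \<times> ('m \<times> 'm) l2. bclinear W \<and>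
    (\<forall>p. norm (W p) = norm p) \<and> (\<forall>p. fst (W p) = S (fst p)) \<and>
    (\<forall>p. coord (snd (W p)) 0 = (D (fst p), fst (coord (snd p) 0))) \<and>
    (\<forall>p n. coord (snd (W p)) (Suc n) = (snd (coord (snd p) n), fst (coord (snd p) (Suc n))))"
proof -
  define c where "c n p = (case n of 0 \<Rightarrow> D (fst p) | Suc m \<Rightarrow> snd (coord (snd p) m))"
    for n and p :: "'a \<times> ('m \<times> 'm) l2"
  have sums: "(\<lambda>n. (norm (c n p, fst (coord (snd p) n)))\<^sup>2) sums ((norm (D (fst p)))\<^sup>2 + (norm (snd p))\<^sup>2)"
    for p
  proof -
    let ?k = "coord (snd p)"
    have s: "summable (\<lambda>n. (norm (fst (?k n)))\<^sup>2)" "summable (\<lambda>n. (norm (snd (?k n)))\<^sup>2)"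
      by (rule summable_comparison_test' [OF summable_coord [of "snd p"]]; simp add: norm_prod_square)+
    define f g where "f = (\<Sum>n. (norm (fst (?k n)))\<^sup>2)" and "g = (\<Sum>n. (norm (snd (?k n)))\<^sup>2)"
    have fg: "(\<lambda>n. (norm (fst (?k n)))\<^sup>2) sums f" "(\<lambda>n. (norm (snd (?k n)))\<^sup>2) sums g"
      using s by (simp_all add: f_def g_def summable_sums)
    have "(\<lambda>n. (norm (?k n))\<^sup>2) sums (f + g)"
      using sums_add [OF fg] by (simp add: norm_prod_square)
    then have total: "f + g = (norm (snd p))\<^sup>2"
      using norm_l2_sums [of "snd p"] sums_unique2 by blast
    have "(\<lambda>n. (norm (c n p))\<^sup>2) sums (g + (norm (D (fst p)))\<^sup>2)"
      using fg(2) sums_Suc [of "\<lambda>n. (norm (c n p))\<^sup>2" g] by (simp add: c_def)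
    from sums_add [OF this fg(1)]
    have "(\<lambda>n. (norm (c n p, fst (?k n)))\<^sup>2) sums (g + (norm (D (fst p)))\<^sup>2 + f)"
      by (simp add: norm_prod_square)
    also have "g + (norm (D (fst p)))\<^sup>2 + f = (norm (D (fst p)))\<^sup>2 + (norm (snd p))\<^sup>2"
      using total by simp
    finally show ?thesis .
  qed
  have "\<exists>T. bclinear T \<and> (\<forall>p n. coord (T p) n = (c n p, fst (coord (snd p) n))) \<and>
    (\<forall>p. (norm (T p))\<^sup>2 = (norm (D (fst p)))\<^sup>2 + (norm (snd p))\<^sup>2)"
  proof (rule l2_operator_exists [OF _ _ sums])
    show "(norm (D (fst p)))\<^sup>2 + (norm (snd p))\<^sup>2 \<le> (norm p)\<^sup>2" for p
      using defect by (simp add: norm_prod_square)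
  qed (auto simp: c_def bclinearD [OF D] scaleC_prod_def split: nat.split)
  then obtain T where T: "bclinear T" "\<And>p n. coord (T p) n = (c n p, fst (coord (snd p) n))"
    "\<And>p. (norm (T p))\<^sup>2 = (norm (D (fst p)))\<^sup>2 + (norm (snd p))\<^sup>2"
    by blast
  define W where "W p = (S (fst p), T p)" for p
  have "(norm (W p))\<^sup>2 = (norm p)\<^sup>2" for p
    by (simp add: W_def norm_prod_square T(3) defect)
  then have norm_W: "norm (W p) = norm p" for p
    by (simp add: power2_eq_iff_nonneg)
  have "bclinear W"
    by (rule bclinearI [where K = 1])
      (simp_all add: norm_W, simp_all add: W_def bclinearD [OF S] bclinearD [OF T(1)] scaleC_Pair)
  then show ?thesis
    using norm_W by (intro exI [of _ W]) (simp add: W_def T(2) c_def)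
qed

lemma blockwise_isometry_exists:
  fixes G :: "'m::complex_inner \<Rightarrow> 'm"
  assumes G: "bclinear G" and norm_G: "\<And>x. norm (G x) = norm x"
  shows "\<exists>T :: 'a::complex_inner \<times> 'm l2 \<Rightarrow> 'a \<times> 'm l2. bclinear T \<and> (\<forall>p. norm (T p) = norm p) \<and>
    (\<forall>p. fst (T p) = fst p) \<and> (\<forall>p n. coord (snd (T p)) n = G (coord (snd p) n))"
proof -
  have "\<exists>R. bclinear R \<and> (\<forall>x n. coord (R x) n = G (coord x n)) \<and> (\<forall>x. (norm (R x))\<^sup>2 = (norm x)\<^sup>2)"
    using norm_l2_sums by (intro l2_operator_exists) (simp_all add: bclinearD [OF G] norm_G)
  then obtain R where R: "bclinear R" "\<And>x n. coord (R x) n = G (coord x n)"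
    "\<And>x. norm (R x) = norm x"
    by (auto simp: power2_eq_iff_nonneg)
  have norm: "norm (fst p, R (snd p)) = norm p" for p :: "'a \<times> 'm l2"
    by (simp add: norm_prod_def R(3))
  have "bclinear (\<lambda>p :: 'a \<times> 'm l2. (fst p, R (snd p)))"
    by (rule bclinearI [where K = 1]) (simp_all add: norm bclinearD [OF R(1)] scaleC_Pair)
  then show ?thesis
    using norm R(2) by (intro exI [of _ "\<lambda>p. (fst p, R (snd p))"]) simp
qed

text \<open>Let \<open>T\<close> apply \<open>G\<close> to every block and let \<open>W\<^sub>1, W\<^sub>2\<close> be the two shifts. Then \<open>T W\<^sub>1 W\<^sub>2 = W\<^sub>2 W\<^sub>1 T\<close>: the
  block created by the shifts is corrected by \<open>G\<close>, and all others merely move. This is the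
  statement that \<open>V\<^sub>1 = T W\<^sub>1\<close> and \<open>V\<^sub>2 = W\<^sub>2 T\<^sup>-\<^sup>1\<close> commute.\<close>

lemma isometric_dilation_of_exchange:
  fixes S1 S2 :: "'a::complex_inner \<Rightarrow> 'a" and D1 D2 :: "'a \<Rightarrow> 'm::complex_inner"
  assumes S: "bclinear S1" "bclinear S2" "\<And>h. S1 (S2 h) = S2 (S1 h)"
    and D: "bclinear D1" "bclinear D2"
      "\<And>h. (norm (D1 h))\<^sup>2 = (norm h)\<^sup>2 - (norm (S1 h))\<^sup>2"
      "\<And>h. (norm (D2 h))\<^sup>2 = (norm h)\<^sup>2 - (norm (S2 h))\<^sup>2"
    and G: "bclinear G" "bclinear G'" "\<And>x. norm (G x) = norm x" "\<And>x. norm (G' x) = norm x"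
      "\<And>x. G (G' x) = x" "\<And>x. G' (G x) = x"
    and exchange: "\<And>h. G (D1 (S2 h), D2 h) = (D2 (S1 h), D1 h)"
  shows "\<exists>V1 V2 :: 'a \<times> ('m \<times> 'm) l2 \<Rightarrow> 'a \<times> ('m \<times> 'm) l2.
    bclinear V1 \<and> bclinear V2 \<and> (\<forall>p. norm (V1 p) = norm p) \<and> (\<forall>p. norm (V2 p) = norm p) \<and>
    (\<forall>p. V1 (V2 p) = V2 (V1 p)) \<and> (\<forall>p. fst (V1 p) = S1 (fst p)) \<and> (\<forall>p. fst (V2 p) = S2 (fst p))"
proof -
  obtain W1 :: "'a \<times> ('m \<times> 'm) l2 \<Rightarrow> 'a \<times> ('m \<times> 'm) l2" where W1:
    "bclinear W1" "\<And>p. norm (W1 p) = norm p" "\<And>p. fst (W1 p) = S1 (fst p)"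
    "\<And>p. coord (snd (W1 p)) 0 = (D1 (fst p), fst (coord (snd p) 0))"
    "\<And>p n. coord (snd (W1 p)) (Suc n) = (snd (coord (snd p) n), fst (coord (snd p) (Suc n)))"
    using shift_isometry_exists [OF S(1) D(1,3)] by blast
  obtain W2 :: "'a \<times> ('m \<times> 'm) l2 \<Rightarrow> 'a \<times> ('m \<times> 'm) l2" where W2:
    "bclinear W2" "\<And>p. norm (W2 p) = norm p" "\<And>p. fst (W2 p) = S2 (fst p)"
    "\<And>p. coord (snd (W2 p)) 0 = (D2 (fst p), fst (coord (snd p) 0))"
    "\<And>p n. coord (snd (W2 p)) (Suc n) = (snd (coord (snd p) n), fst (coord (snd p) (Suc n)))"
    using shift_isometry_exists [OF S(2) D(2,4)] by blast
  obtain T :: "'a \<times> ('m \<times> 'm) l2 \<Rightarrow> 'a \<times> ('m \<times> 'm) l2" where T: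
    "bclinear T" "\<And>p. norm (T p) = norm p" "\<And>p. fst (T p) = fst p"
    "\<And>p n. coord (snd (T p)) n = G (coord (snd p) n)"
    using blockwise_isometry_exists [OF G(1,3), where 'a = 'a] by blast
  obtain T' :: "'a \<times> ('m \<times> 'm) l2 \<Rightarrow> 'a \<times> ('m \<times> 'm) l2" where T':
    "bclinear T'" "\<And>p. norm (T' p) = norm p" "\<And>p. fst (T' p) = fst p"
    "\<And>p n. coord (snd (T' p)) n = G' (coord (snd p) n)"
    using blockwise_isometry_exists [OF G(2,4), where 'a = 'a] by blast
  have T'T: "T' (T p) = p" and TT': "T (T' p) = p" for p
    by (auto intro!: prod_eqI l2_eqI simp: T T' G)
  have eq: "T (W1 (W2 p)) = W2 (W1 (T p))" for p
  proof (rule prod_eqI)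
    show "fst (T (W1 (W2 p))) = fst (W2 (W1 (T p)))"
      by (simp add: T W1 W2 S)
    show "snd (T (W1 (W2 p))) = snd (W2 (W1 (T p)))"
    proof (rule l2_eqI)
      show "coord (snd (T (W1 (W2 p)))) n = coord (snd (W2 (W1 (T p)))) n" for n
      proof (cases n)
        case 0
        then show ?thesis by (simp add: T W1 W2 exchange)
      next
        case (Suc m)
        then show ?thesis by (cases m) (simp_all add: T W1 W2)
      qed
    qed
  qed
  have "T (W1 (W2 (T' p))) = W2 (T' (T (W1 p)))" for p
    by (simp add: T'T TT' eq)
  then show ?thesis
    by (intro exI [of _ "\<lambda>p. T (W1 p)"] exI [of _ "\<lambda>p. W2 (T' p)"])
      (simp add: bclinear_compose T T' W1 W2)
qed

type_synonym 'a isometric_dilation_space =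
  "'a \<times> (('a l2 \<times> 'a l2) \<times> ('a l2 \<times> 'a l2)) l2"

text \<open>The conclusion \<open>fst (V\<^sub>i p) = S\<^sub>i (fst p)\<close> says that the original space is coinvariant, which
  is stronger than the dilation property for words and is what the second application of this lemma
  relies on. Each defect vector is padded with a zero, to provide the doubled space on which the
  exchange operator exists.\<close>

lemma commuting_isometric_dilation_exists:
  fixes S1 S2 :: "'a::chilbert_space \<Rightarrow> 'a"
  assumes S1: "contraction S1" and S2: "contraction S2" and comm: "\<And>h. S1 (S2 h) = S2 (S1 h)"
  shows "\<exists>V1 V2 :: 'a isometric_dilation_space \<Rightarrow> 'a isometric_dilation_space.
    bclinear V1 \<and> bclinear V2 \<and> (\<forall>p. norm (V1 p) = norm p) \<and> (\<forall>p. norm (V2 p) = norm p) \<and>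
    (\<forall>p. V1 (V2 p) = V2 (V1 p)) \<and> (\<forall>p. fst (V1 p) = S1 (fst p)) \<and> (\<forall>p. fst (V2 p) = S2 (fst p))"
proof -
  have S: "bclinear S1" "bclinear S2"
    using S1 S2 by (auto simp: contraction_iff)
  obtain D1 :: "'a \<Rightarrow> 'a l2" where D1:
    "bclinear D1" "\<And>x. (norm (D1 x))\<^sup>2 = (norm x)\<^sup>2 - (norm (S1 x))\<^sup>2"
    using defect_operator_exists [OF S1] by blast
  obtain D2 :: "'a \<Rightarrow> 'a l2" where D2:
    "bclinear D2" "\<And>x. (norm (D2 x))\<^sup>2 = (norm x)\<^sup>2 - (norm (S2 x))\<^sup>2"
    using defect_operator_exists [OF S2] by blast
  have pair: "bclinear (\<lambda>h. (E (T h), F h))" and pair': "bclinear (\<lambda>h. (F h, 0 :: 'c))"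
    if "bclinear E" "bclinear T" "bclinear F"
    for E :: "'a \<Rightarrow> 'b::complex_inner" and T :: "'a \<Rightarrow> 'a" and F :: "'a \<Rightarrow> 'c::complex_inner"
  proof -
    note ET = bclinear_compose [OF that(1,2)]
    show "bclinear (\<lambda>h. (E (T h), F h))" "bclinear (\<lambda>h. (F h, 0 :: 'c))"
      using bounded_linear_Pair [OF bclinearD(6) [OF ET] bclinearD(6) [OF that(3)]]
        bounded_linear_Pair [OF bclinearD(6) [OF that(3)] bounded_linear_zero]
      by (simp_all add: bclinear_def [of "\<lambda>h. (_ h, _ h)"] bclinear_def [of "\<lambda>h. (_ h, 0)"]
          scaleC_Pair bclinearD(5) [OF ET] bclinearD(5) [OF that(3)])
  qed
  have "(norm (D1 (S2 h), D2 h))\<^sup>2 = (norm (D2 (S1 h), D1 h))\<^sup>2" for h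
    by (simp add: norm_prod_square D1 D2 comm)
  then have "norm (D1 (S2 h), D2 h) = norm (D2 (S1 h), D1 h)" for h
    by (simp add: power2_eq_iff_nonneg)
  from unitary_extension_exists [OF pair [OF D1(1) S(2) D2(1)] pair [OF D2(1) S(1) D1(1)] this]
  obtain G G' :: "('a l2 \<times> 'a l2) \<times> ('a l2 \<times> 'a l2) \<Rightarrow> ('a l2 \<times> 'a l2) \<times> ('a l2 \<times> 'a l2)"
    where G: "bclinear G" "bclinear G'" "\<And>p. norm (G p) = norm p" "\<And>p. norm (G' p) = norm p"
      "\<And>p. G (G' p) = p" "\<And>p. G' (G p) = p"
      "\<And>h. G ((D1 (S2 h), D2 h), 0) = ((D2 (S1 h), D1 h), 0)"
    by blast
  \<comment> \<open>The exchange operator acts on (pair of defects, padding); \<open>\<sigma>\<close> regroups this as (defect,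
      padding) twice, the order in which the shifts produce the entries.\<close>
  define \<sigma> :: "('a l2 \<times> 'a l2) \<times> ('a l2 \<times> 'a l2) \<Rightarrow> ('a l2 \<times> 'a l2) \<times> ('a l2 \<times> 'a l2)"
    where "\<sigma> p = ((fst (fst p), fst (snd p)), (snd (fst p), snd (snd p)))" for p
  have norm_\<sigma>: "norm (\<sigma> p) = norm p" for p
    by (simp add: \<sigma>_def norm_prod_def algebra_simps)
  have \<sigma>: "bclinear \<sigma>"
    by (rule bclinearI [where K = 1]) (simp_all add: norm_\<sigma>, simp_all add: \<sigma>_def scaleC_prod_def)
  have \<sigma>\<sigma>: "\<sigma> (\<sigma> p) = p" for p
    by (simp add: \<sigma>_def)
  show ?thesis
  proof (rule isometric_dilation_of_exchange [where ?D1.0 = "\<lambda>h. (D1 h, 0)" and ?D2.0 = "\<lambda>h. (D2 h, 0)"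
        and G = "\<lambda>p. \<sigma> (G (\<sigma> p))" and G' = "\<lambda>p. \<sigma> (G' (\<sigma> p))", OF S comm])
    show "bclinear (\<lambda>h. (D1 h, 0 :: 'a l2))" "bclinear (\<lambda>h. (D2 h, 0 :: 'a l2))"
      using pair' [OF D1(1) S(1) D1(1)] pair' [OF D2(1) S(1) D2(1)] by simp_all
    show "bclinear (\<lambda>p. \<sigma> (G (\<sigma> p)))" "bclinear (\<lambda>p. \<sigma> (G' (\<sigma> p)))"
      by (rule bclinear_compose [OF \<sigma> bclinear_compose [OF _ \<sigma>]], fact G)+
    show "\<sigma> (G (\<sigma> ((D1 (S2 h), 0), (D2 h, 0)))) = ((D2 (S1 h), 0), (D1 h, 0))" for h
      using G(7) [of h] by (simp add: \<sigma>_def zero_prod_def)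
    show "(norm (D1 h, 0 :: 'a l2))\<^sup>2 = (norm h)\<^sup>2 - (norm (S1 h))\<^sup>2"
      "(norm (D2 h, 0 :: 'a l2))\<^sup>2 = (norm h)\<^sup>2 - (norm (S2 h))\<^sup>2" for h
      by (simp_all add: D1 D2)
    show "norm (\<sigma> (G (\<sigma> p))) = norm p" "norm (\<sigma> (G' (\<sigma> p))) = norm p"
      "\<sigma> (G (\<sigma> (\<sigma> (G' (\<sigma> p))))) = p" "\<sigma> (G' (\<sigma> (\<sigma> (G (\<sigma> p))))) = p" for p
      by (simp_all only: norm_\<sigma> \<sigma>\<sigma> G)
  qed
qed

section \<open>Unitary dilations of a pair of contractions\<close>

text \<open>The range is the set of fixed points of \<open>T T\<^sup>*\<close>.\<close>

lemma closed_csubspace_range_isometry: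
  fixes T :: "'k::chilbert_space \<Rightarrow> 'b::complex_inner"
  assumes T: "bclinear T" and iso: "\<And>x. norm (T x) = norm x"
  shows "closed_csubspace (range T)"
  unfolding closed_csubspace_def
proof (intro conjI ballI allI)
  have adj: "adjoint_op T (T x) = x" for x
    by (rule adjoint_isometry [OF T cinner_isometry [OF T iso]])
  have "range T = {y. T (adjoint_op T y) = y}"
  proof (intro equalityI subsetI)
    show "y \<in> {y. T (adjoint_op T y) = y}" if "y \<in> range T" for y
      using that by (auto simp: adj)
    show "y \<in> range T" if "y \<in> {y. T (adjoint_op T y) = y}" for y
    proof (rule range_eqI)
      show "y = T (adjoint_op T y)" using that by simp
    qed
  qed
  moreover have "bounded_linear (\<lambda>y. T (adjoint_op T y))"
    by (rule bclinearD(6) [OF bclinear_compose [OF T bclinear_adjoint [OF T]]])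
  then have "closed {y. T (adjoint_op T y) = y}"
    by (intro closed_Collect_eq linear_continuous_on continuous_on_id)
  ultimately show "closed (range T)"
    by simp
  note lin = bclinearD [OF T]
  show "0 \<in> range T" using lin(4) by (metis rangeI)
  show "x + y \<in> range T" if "x \<in> range T" "y \<in> range T" for x y
    using that by (auto simp flip: lin(1))
  show "a *\<^sub>C x \<in> range T" if "x \<in> range T" for a x
    using that by (auto simp flip: lin(5))
qed

lemma closed_csubspace_INT:
  "(\<And>i. i \<in> I \<Longrightarrow> closed_csubspace (M i)) \<Longrightarrow> closed_csubspace (\<Inter>i\<in>I. M i)"
  unfolding closed_csubspace_def by (simp add: closed_INT)

text \<open>The subspace is \<open>L = \<Inter>\<^sub>n ran (W\<^sub>1 W\<^sub>2)\<^sup>n\<close>, the unitary part in the Wold decomposition of the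
  product. The product is onto on \<open>L\<close>, and therefore so are its commuting factors. A set contained
  in its images under both factors lies in the range of every power.\<close>

lemma unitary_part_of_commuting_isometries:
  fixes W1 W2 :: "'k::chilbert_space \<Rightarrow> 'k"
  assumes W: "bclinear W1" "bclinear W2" "\<And>x. norm (W1 x) = norm x" "\<And>x. norm (W2 x) = norm x"
    and comm: "\<And>x. W1 (W2 x) = W2 (W1 x)"
    and A: "A \<subseteq> W1 ` A" "A \<subseteq> W2 ` A"
  shows "\<exists>L. closed_csubspace L \<and> bij_betw W1 L L \<and> bij_betw W2 L L \<and> A \<subseteq> L"
proof -
  define W where "W n = ((\<lambda>x. W1 (W2 x)) ^^ n)" for n
  have W_Suc: "W (Suc n) x = W1 (W2 (W n x))" and W_0: "W 0 x = x" for n x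
    by (simp_all add: W_def)
  have bW: "bclinear (W n) \<and> (\<forall>x. norm (W n x) = norm x)" for n
  proof (induction n)
    case 0
    then show ?case by (auto simp: W_0 intro!: bclinearI [where K = 1])
  next
    case (Suc n)
    then show ?case
      using bclinear_compose [OF W(1) bclinear_compose [OF W(2), of "W n"]]
      by (auto simp: W_Suc [abs_def] W)
  qed
  have commW: "W1 (W n x) = W n (W1 x)" "W2 (W n x) = W n (W2 x)" for n x
    by (induction n arbitrary: x) (simp_all add: W_Suc W_0 comm [symmetric])
  define L where "L = (\<Inter>n. range (W n))"
  have "closed_csubspace L"
    unfolding L_def using bW by (intro closed_csubspace_INT closed_csubspace_range_isometry) auto
  have inj: "x = y" if "W1 x = W1 y \<or> W2 x = W2 y" for x y
    using that W(3,4) [of "x - y"] bclinearD(2) [OF W(1), of x y] bclinearD(2) [OF W(2), of x y]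
    by auto
  have maps: "W1 x \<in> L" "W2 x \<in> L" if "x \<in> L" for x
    using that commW unfolding L_def by (auto simp: image_iff) metis+
  have onto: "\<exists>y\<in>L. x = W1 (W2 y)" if x: "x \<in> L" for x
  proof -
    obtain y where y: "x = W1 (W2 y)"
    proof -
      have "x \<in> range (W (Suc 0))" using x by (simp add: L_def)
      then show ?thesis using that by (auto simp: W_Suc W_0)
    qed
    have "y \<in> range (W n)" for n
    proof -
      obtain z where "x = W1 (W2 (W n z))"
      proof -
        have "x \<in> range (W (Suc n))" using x by (simp add: L_def)
        then show ?thesis using that by (auto simp: W_Suc)
      qed
      then have "y = W n z" using y inj by blast
      then show ?thesis by simp
    qed
    then show ?thesis using y by (auto simp: L_def)
  qed
  have "inj_on W1 L" "inj_on W2 L"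
    by (intro inj_onI inj, blast)+
  moreover have "W1 ` L = L" "W2 ` L = L"
  proof -
    have "x \<in> W1 ` L \<and> x \<in> W2 ` L" if x: "x \<in> L" for x
    proof -
      obtain y where y: "y \<in> L" "x = W1 (W2 y)" using onto [OF x] by blast
      have "x \<in> W1 ` L"
        using y(2) maps(2) [OF y(1)] by simp
      moreover have "x \<in> W2 ` L"
        using y(2) comm [of y] maps(1) [OF y(1)] by simp
      ultimately show ?thesis by blast
    qed
    then show "W1 ` L = L" "W2 ` L = L"
      using maps by blast+
  qed
  ultimately have "bij_betw W1 L L" "bij_betw W2 L L"
    by (simp_all add: bij_betw_def)
  moreover have "A \<subseteq> W n ` A" for n
  proof (induction n)
    case (Suc n)
    have "A \<subseteq> W1 ` W2 ` W n ` A"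
      using A Suc by blast
    then show ?case by (simp add: image_image W_Suc)
  qed (simp add: W_0)
  then have "A \<subseteq> L"
    unfolding L_def by blast
  ultimately show ?thesis
    using \<open>closed_csubspace L\<close> by blast
qed

definition hilbert_of :: "'a::complex_inner set \<Rightarrow> 'a hilbert" where
  "hilbert_of M =
    \<lparr>hcarrier = M, hzero = 0, hadd = (+), hscale = (*\<^sub>C), hinner = cinner\<rparr>"

lemma hilbert_of_simps [simp]:
  "hcarrier (hilbert_of M) = M" "hzero (hilbert_of M) = 0" "hadd (hilbert_of M) x y = x + y"
  "hscale (hilbert_of M) a x = a *\<^sub>C x" "hinner (hilbert_of M) x y = cinner x y"
  by (simp_all add: hilbert_of_def)

lemma hnorm_hilbert_of [simp]: "hnorm (hilbert_of M) x = norm x"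
  by (simp add: hnorm_def norm_eq_sqrt_cinner)

lemma hdist_hilbert_of [simp]: "hdist (hilbert_of M) x y = dist x y"
  by (simp add: hdist_def dist_norm)

lemma hilbert_hilbert_of:
  fixes M :: "'a::chilbert_space set"
  assumes M: "closed_csubspace M"
  shows "hilbert (hilbert_of M)"
proof
  note MD = closed_csubspaceD [OF M]
  show "\<exists>y\<in>hcarrier (hilbert_of M). hadd (hilbert_of M) x y = hzero (hilbert_of M)"
    if "x \<in> hcarrier (hilbert_of M)" for x
    using that MD(6) [OF MD(2), of x] by (intro bexI [of _ "- x"]) simp_all
  show "0 < Re (hinner (hilbert_of M) x x)" if "x \<noteq> hzero (hilbert_of M)" for x
    using that by (simp add: Re_cinner_self)
  show "\<exists>x\<in>hcarrier (hilbert_of M). (\<lambda>n. hdist (hilbert_of M) (\<sigma> n) x) \<longlonglongrightarrow> 0"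
    if "range \<sigma> \<subseteq> hcarrier (hilbert_of M)"
      "\<forall>e>0. \<exists>N. \<forall>m\<ge>N. \<forall>n\<ge>N. hdist (hilbert_of M) (\<sigma> m) (\<sigma> n) < e" for \<sigma>
  proof -
    have "Cauchy \<sigma>"
      using that(2) by (auto simp: Cauchy_def)
    then obtain x where x: "\<sigma> \<longlonglongrightarrow> x"
      using Cauchy_convergent convergent_def by blast
    moreover have "x \<in> M"
      using closed_sequentially [OF MD(1) _ x] that(1) by auto
    ultimately show ?thesis
      using tendsto_dist_iff [of \<sigma> x sequentially] by auto
  qed
  show "hinner (hilbert_of M) x y = cnj (hinner (hilbert_of M) y x)" for x y
    using cinner_commute by simp
qed (simp_all add: closed_csubspaceD [OF M] add_ac scaleC_add_right scaleC_add_left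
    scaleC_scaleC cinner_add_left cinner_scaleC_left)

lemma unitary_on_hilbert_of:
  assumes "bclinear W" "\<And>x. norm (W x) = norm x" "bij_betw W M M"
  shows "unitary_on (hilbert_of M) W"
  using assms(3) cinner_isometry [OF assms(1,2)] by (simp add: unitary_on_def bclinearD [OF assms(1)])

lemma word_prod_intertwine:
  assumes "\<And>i x. i \<in> fst ` set ws \<Longrightarrow> f (A i x) = B i (f x)"
  shows "f (word_prod A ws x) = word_prod B ws (f x)"
  using assms
proof (induction ws)
  case Nil
  then show ?case by (simp add: word_prod_def)
next
  case (Cons p ws)
  have "f ((A (fst p) ^^ n) y) = (B (fst p) ^^ n) (f y)" for n y
    by (induction n) (use Cons.prems in auto)
  then show ?case
    using Cons by (simp add: word_prod_def split_beta)
qed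

text \<open>For \<open>d = 1\<close> the pair consists of two copies of the same contraction.\<close>

theorem commuting_unitary_dilation_of_pair:
  fixes S :: "nat \<Rightarrow> 'h::chilbert_space \<Rightarrow> 'h"
  assumes d: "1 \<le> d" "d \<le> 2" and S: "S \<in> commuting_contractions d"
  shows "\<exists>(K :: ('h isometric_dilation_space) isometric_dilation_space hilbert) r U.
    free_unitary_dilation d S K r U \<and> commuting_on d K U"
proof -
  have SD: "contraction (S i)" "S i \<circ> S j = S j \<circ> S i" if "i \<in> {1..d}" "j \<in> {1..d}" for i j
    using S that by (auto simp: commuting_contractions_def PiE_iff)
  have S1: "contraction (S 1)" and S2: "contraction (S d)" and S12: "S 1 (S d h) = S d (S 1 h)" for h
    using d SD [of 1 d] SD [of d d] by (auto simp: o_def fun_eq_iff)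
  obtain V1 V2 :: "'h isometric_dilation_space \<Rightarrow> 'h isometric_dilation_space" where V:
    "bclinear V1" "bclinear V2" "\<And>p. norm (V1 p) = norm p" "\<And>p. norm (V2 p) = norm p"
    "\<And>p. V1 (V2 p) = V2 (V1 p)" "\<And>p. fst (V1 p) = S 1 (fst p)" "\<And>p. fst (V2 p) = S d (fst p)"
    using commuting_isometric_dilation_exists [OF S1 S2 S12] by blast
  have "contraction V1" "contraction V2"
    using V by (simp_all add: contraction_iff)
  then have "contraction (adjoint_op V1)" "contraction (adjoint_op V2)"
    by (auto intro: contraction_adjoint)
  moreover have "adjoint_op V1 (adjoint_op V2 p) = adjoint_op V2 (adjoint_op V1 p)" for p
    by (rule cinner_eqI) (simp add: cinner_adjoint_right V)
  ultimately obtain W1 W2 ::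
      "'h isometric_dilation_space isometric_dilation_space \<Rightarrow> 'h isometric_dilation_space isometric_dilation_space"
    where W: "bclinear W1" "bclinear W2" "\<And>p. norm (W1 p) = norm p" "\<And>p. norm (W2 p) = norm p"
      "\<And>p. W1 (W2 p) = W2 (W1 p)"
      "\<And>p. fst (W1 p) = adjoint_op V1 (fst p)" "\<And>p. fst (W2 p) = adjoint_op V2 (fst p)"
    using commuting_isometric_dilation_exists [of "adjoint_op V1" "adjoint_op V2"] by blast
  have norm0: "snd p = 0" if "norm p = norm (fst p)"
    for p :: "'h isometric_dilation_space isometric_dilation_space"
    using that norm_prod_square [of p] by simp
  \<comment> \<open>The first component is \<open>V\<^sub>1\<^sup>* V\<^sub>1 k = k\<close>. It already has the norm of the whole vector, so
      nothing is left for the second one.\<close>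
  have WV1: "W1 (V1 k, 0) = (k, 0)" for k
  proof -
    have fst: "fst (W1 (V1 k, 0)) = k"
      by (simp add: W adjoint_isometry V cinner_isometry)
    have "norm (W1 (V1 k, 0)) = norm k"
      by (simp add: W(3) V(3))
    then have "snd (W1 (V1 k, 0)) = 0"
      by (intro norm0) (simp only: fst)
    with fst show ?thesis by (simp add: prod_eq_iff)
  qed
  have WV2: "W2 (V2 k, 0) = (k, 0)" for k
  proof -
    have fst: "fst (W2 (V2 k, 0)) = k"
      by (simp add: W adjoint_isometry V cinner_isometry)
    have "norm (W2 (V2 k, 0)) = norm k"
      by (simp add: W(4) V(4))
    then have "snd (W2 (V2 k, 0)) = 0"
      by (intro norm0) (simp only: fst)
    with fst show ?thesis by (simp add: prod_eq_iff)
  qed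
  define A :: "'h isometric_dilation_space isometric_dilation_space set"
    where "A = range (\<lambda>k. (k, 0))"
  have mem_A: "(k, 0) \<in> A" for k
    by (simp add: A_def)
  have "(k, 0) \<in> W1 ` A" "(k, 0) \<in> W2 ` A" for k
    using imageI [OF mem_A, of W1 "V1 k"] imageI [OF mem_A, of W2 "V2 k"] by (simp_all add: WV1 WV2)
  then have "A \<subseteq> W1 ` A" "A \<subseteq> W2 ` A"
    using A_def by blast+
  then obtain L where L: "closed_csubspace L" "bij_betw W1 L L" "bij_betw W2 L L" "A \<subseteq> L"
    using unitary_part_of_commuting_isometries [OF W(1-5)] by blast
  interpret K: hilbert "hilbert_of L"
    by (rule hilbert_hilbert_of [OF L(1)])
  define U where "U i = (if i = (1::nat) then inv_into L W1 else inv_into L W2)" for i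
  have A_L: "(k, 0) \<in> L" for k
    using L(4) mem_A by blast
  have uW: "unitary_on (hilbert_of L) W1" "unitary_on (hilbert_of L) W2"
    using W L by (auto intro: unitary_on_hilbert_of)
  then have U: "unitary_on (hilbert_of L) (U i)" for i
    using K.unitary_on_inv by (simp add: U_def)
  have inj: "inj_on W1 L" "inj_on W2 L"
    using L by (auto simp: bij_betw_def)
  have UV: "U i (k, 0) = (if i = 1 then V1 k else V2 k, 0)" for i k
    using inv_into_f_f [OF inj(1) A_L [of "V1 k"]] inv_into_f_f [OF inj(2) A_L [of "V2 k"]]
    by (simp add: U_def WV1 WV2)
  have inv: "inv_into L W1 x \<in> L" "W1 (inv_into L W1 x) = x"
    "inv_into L W2 x \<in> L" "W2 (inv_into L W2 x) = x" if "x \<in> L" for x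
    using that L by (auto simp: bij_betw_def inv_into_into f_inv_into_f)
  have comm: "inv_into L W1 (inv_into L W2 x) = inv_into L W2 (inv_into L W1 x)" if "x \<in> L" for x
  proof -
    let ?y = "inv_into L W1 (inv_into L W2 x)" and ?z = "inv_into L W2 (inv_into L W1 x)"
    have yz: "?y \<in> L" "?z \<in> L"
      by (intro inv that)+
    have "W1 (W2 ?y) = x"
      unfolding W(5) using that by (simp add: inv)
    moreover have "W1 (W2 ?z) = x"
      using that by (simp add: inv)
    ultimately have "W2 ?y = W2 ?z"
      using inj_onD [OF inj(1), of "W2 ?y" "W2 ?z"] bij_betwE [OF L(3)] yz by simp
    then show ?thesis
      using inj_onD [OF inj(2), of ?y ?z] yz by simp
  qed
  define r :: "'h \<Rightarrow> 'h isometric_dilation_space isometric_dilation_space"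
    where "r h = ((h, 0), 0)" for h
  have adj: "hadjoint (hilbert_of L) r y = fst (fst y)" for y
  proof -
    have r: "cinner (r x) y = cinner x (fst (fst y))" for x
      by (simp add: r_def cinner_prod_def)
    show ?thesis
      unfolding hadjoint_def hilbert_of_simps
    proof (rule the_equality)
      show "z = fst (fst y)" if "\<forall>x. cinner x z = cinner (r x) y" for z
        using that by (intro cinner_eqI) (simp only: r)
    qed (simp add: r)
  qed
  have "word_prod S ws = hadjoint (hilbert_of L) r \<circ> word_prod U ws \<circ> r"
    if ws: "fst ` set ws \<subseteq> {1..d}" for ws
  proof
    fix h
    define X where "X i = (if i = (1::nat) then V1 else V2)" for i
    have "word_prod U ws (word_prod X [] (h, 0), 0) = (word_prod X ws (h, 0), 0)"
      using word_prod_intertwine [of ws "\<lambda>k. (k, 0)" X U "(h, 0)"] UV by (simp add: X_def word_prod_def)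
    moreover have "fst (word_prod X ws (h, 0)) = word_prod S ws h"
    proof -
      have "fst (X i p) = S i (fst p)" if "i \<in> fst ` set ws" for i p
      proof -
        have "i = 1 \<or> i = d" using that ws d by force
        then show ?thesis
          using V d by (auto simp: X_def)
      qed
      then show ?thesis
        using word_prod_intertwine [of ws fst X S "(h, 0)"] by simp
    qed
    ultimately show "word_prod S ws h = (hadjoint (hilbert_of L) r \<circ> word_prod U ws \<circ> r) h"
      by (simp add: adj r_def word_prod_def)
  qed
  moreover have "isometry_into (hilbert_of L) r"
    using A_L by (auto simp: isometry_into_def r_def norm_prod_def scaleC_prod_def)
  ultimately have "free_unitary_dilation d S (hilbert_of L) r U"
    using U K.hilbert_axioms by (simp add: free_unitary_dilation_def)
  moreover have "commuting_on d (hilbert_of L) U"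
    using comm by (simp add: commuting_on_def U_def)
  ultimately show ?thesis by blast
qed

section \<open>Orthonormal sequences in infinite-dimensional spaces\<close>

text \<open>This makes the Cauchy criterion for series available.\<close>

instance chilbert_space \<subseteq> banach ..

text \<open>One step of the Gram--Schmidt process per element of \<open>B\<close>: the new direction is \<open>u = b - q\<close>, the
  part of \<open>b\<close> orthogonal to the span so far. For \<open>u = 0\<close> the coefficient \<open>k\<close> is \<open>0 / 0 = 0\<close>.\<close>

lemma finite_span_projection_exists:
  fixes B :: "'a::complex_inner set"
  assumes "finite B"
  shows "\<exists>y\<in>complex_vector.span B. \<forall>m\<in>complex_vector.span B. cinner m (x - y) = 0"
  using assms
proof (induction B arbitrary: x)
  case empty
  then show ?case by simp
next
  case (insert b B)
  obtain q where q: "q \<in> complex_vector.span B"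
    "\<And>m. m \<in> complex_vector.span B \<Longrightarrow> cinner m (b - q) = 0"
    using insert.IH [of b] by blast
  obtain y where y: "y \<in> complex_vector.span B"
    "\<And>m. m \<in> complex_vector.span B \<Longrightarrow> cinner m (x - y) = 0"
    using insert.IH [of x] by blast
  define u where "u = b - q"
  define k where "k = cinner (x - y) u / cinner u u"
  have sub: "complex_vector.span B \<subseteq> complex_vector.span (insert b B)"
    by (intro complex_vector.span_mono) blast
  have "u \<in> complex_vector.span (insert b B)"
    unfolding u_def using sub q(1) complex_vector.span_base [of b "insert b B"]
    by (intro complex_vector.span_diff) auto
  then have "y + k *\<^sub>C u \<in> complex_vector.span (insert b B)"
    using sub y(1) by (intro complex_vector.span_add complex_vector.span_scale) auto
  moreover have "cinner m (x - (y + k *\<^sub>C u)) = 0" if mem: "m \<in> complex_vector.span (insert b B)" for m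
  proof -
    obtain c where c: "m - c *\<^sub>C b \<in> complex_vector.span B"
      using mem complex_vector.span_breakdown_eq by blast
    let ?m = "m - c *\<^sub>C b + c *\<^sub>C q"
    have m: "?m \<in> complex_vector.span B"
      by (intro complex_vector.span_add complex_vector.span_scale c q(1))
    have m_eq: "m = ?m + c *\<^sub>C u"
      by (simp add: u_def scaleC_diff_right)
    have "cinner u (x - y) = cnj k * cinner u u"
    proof (cases "u = 0")
      case False
      then have "cinner u u \<noteq> 0" by (simp add: cinner_self)
      then have "k * cinner u u = cinner (x - y) u"
        by (simp add: k_def)
      then have "cnj (k * cinner u u) = cinner u (x - y)"
        by (simp flip: cinner_commute)
      then show ?thesis
        by (simp add: cinner_self)
    qed simp
    moreover have "cinner ?m (x - y) = 0" "cinner ?m u = 0"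
      using y(2) [OF m] q(2) [OF m] by (simp_all add: u_def)
    moreover have "cinner (m' + c *\<^sub>C u) (w - k *\<^sub>C u) = 0"
      if "cinner u w = cnj k * cinner u u" "cinner m' w = 0" "cinner m' u = 0" for m' w
      using that by (simp add: cinner_algebra)
    ultimately have "cinner (?m + c *\<^sub>C u) (x - y - k *\<^sub>C u) = 0"
      by blast
    then show ?thesis using m_eq by (simp add: diff_diff_eq)
  qed
  ultimately show ?case by blast
qed

definition orthonormal :: "(nat \<Rightarrow> 'a::complex_inner) \<Rightarrow> bool" where
  "orthonormal e \<longleftrightarrow> (\<forall>i j. cinner (e i) (e j) = (if i = j then 1 else 0))"

lemma orthonormal_sequence_exists:
  fixes F :: "'a::complex_inner set"
  assumes inf: "infinite_dimensional TYPE('a)" and F: "finite F"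
  shows "\<exists>e. orthonormal e \<and> (\<forall>x\<in>F. \<forall>i. cinner x (e i) = 0)"
proof -
  have unit: "\<exists>u :: 'a. norm u = 1 \<and> (\<forall>b\<in>B. cinner b u = 0)" if B: "finite B" for B
  proof -
    obtain x where x: "x \<notin> complex_vector.span B"
    proof -
      have "complex_vector.span B \<noteq> UNIV"
        using inf B unfolding infinite_dimensional_def by blast
      then show ?thesis using that by blast
    qed
    obtain y where y: "y \<in> complex_vector.span B" "\<And>m. m \<in> complex_vector.span B \<Longrightarrow> cinner m (x - y) = 0"
      using finite_span_projection_exists [OF B] by blast
    have "x - y \<noteq> 0" using x y(1) by auto
    then show ?thesis
      using y(2) complex_vector.span_base
      by (intro exI [of _ "(1 / norm (x - y)) *\<^sub>R (x - y)"])
        (auto simp: scaleR_scaleC cinner_scaleC_right norm_scaleC norm_divide)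
  qed
  have "\<exists>e :: nat \<Rightarrow> 'a. \<forall>n. norm (e n) = 1 \<and> (\<forall>b\<in>F \<union> e ` {..<n}. cinner b (e n) = 0)"
  proof (rule dependent_wellorder_choice
      [where P = "\<lambda>e n u. norm u = 1 \<and> (\<forall>b\<in>F \<union> e ` {..<n}. cinner b u = 0)"])
    show "(norm u = 1 \<and> (\<forall>b\<in>F \<union> e ` {..<n}. cinner b u = 0)) =
        (norm u = 1 \<and> (\<forall>b\<in>F \<union> e' ` {..<n}. cinner b u = 0))"
      if "\<And>k. k < n \<Longrightarrow> e k = e' k" for u :: 'a and e e' and n :: nat
      using that by auto
    show "\<exists>u. norm u = 1 \<and> (\<forall>b\<in>F \<union> e ` {..<n}. cinner b u = 0)" for e and n :: nat
      using F by (intro unit) simp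
  qed
  then obtain e :: "nat \<Rightarrow> 'a" where e: "\<And>n. norm (e n) = 1" "\<And>n b. b \<in> F \<union> e ` {..<n} \<Longrightarrow> cinner b (e n) = 0"
    by blast
  have "cinner (e i) (e j) = (if i = j then 1 else 0)" for i j
  proof (cases i j rule: linorder_cases)
    case less
    then show ?thesis using e(2) [of "e i" j] by simp
  next
    case equal
    then show ?thesis by (simp add: cinner_self e)
  next
    case greater
    then show ?thesis using e(2) [of "e j" i] cinner_commute [of "e i" "e j"] by simp
  qed
  then show ?thesis using e(2) unfolding orthonormal_def by blast
qed

lemma norm_sum_orthonormal:
  assumes e: "orthonormal e" and "finite I"
  shows "(norm (\<Sum>i\<in>I. c i *\<^sub>C e i))\<^sup>2 = (\<Sum>i\<in>I. (cmod (c i))\<^sup>2)"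
  using \<open>finite I\<close>
proof (induction I rule: finite_induct)
  case (insert j I)
  have "cinner (\<Sum>i\<in>I. c i *\<^sub>C e i) (e j) = 0"
    using e insert.hyps by (auto simp: cinner_sum_left cinner_scaleC_left orthonormal_def intro!: sum.neutral)
  then have "cinner (c j *\<^sub>C e j) (\<Sum>i\<in>I. c i *\<^sub>C e i) = 0"
    using cinner_commute [of "e j"] by (simp add: cinner_scaleC_left)
  moreover have "norm (e j) = 1"
    using e by (simp add: norm_eq_sqrt_cinner orthonormal_def)
  ultimately show ?case
    using insert by (simp add: norm_add_square_orthogonal norm_scaleC)
qed simp

lemma bessel:
  assumes e: "orthonormal e"
  shows "(\<Sum>i<n. (cmod (cinner x (e i)))\<^sup>2) \<le> (norm x)\<^sup>2"
proof -
  have "(norm (x - (\<Sum>i<n. cinner x (e i) *\<^sub>C e i)))\<^sup>2 = (norm x)\<^sup>2 - (\<Sum>i<n. (cmod (cinner x (e i)))\<^sup>2)"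
  proof (induction n)
    case (Suc n)
    let ?y = "x - (\<Sum>i<n. cinner x (e i) *\<^sub>C e i)"
    have "norm (e n) = 1"
      using e by (simp add: norm_eq_sqrt_cinner orthonormal_def)
    moreover have "cinner ?y (e n) = cinner x (e n)"
      using e by (simp add: cinner_diff_left cinner_sum_left cinner_scaleC_left orthonormal_def)
    ultimately show ?case
      using norm_diff_projection [of "e n" ?y] Suc by (simp add: diff_diff_eq)
  qed simp
  then show ?thesis
    using zero_le_power2 [of "norm (x - (\<Sum>i<n. cinner x (e i) *\<^sub>C e i))"] by simp
qed

lemma summable_bessel:
  assumes "orthonormal e"
  shows "summable (\<lambda>i. (cmod (cinner x (e i)))\<^sup>2)"
  using bessel [OF assms, of x "Suc _"]
  by (intro bounded_imp_summable [where B = "(norm x)\<^sup>2"])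
    (auto simp: lessThan_Suc_atMost simp del: sum.lessThan_Suc)

lemma summable_orthonormal:
  fixes e :: "nat \<Rightarrow> 'a::chilbert_space"
  assumes e: "orthonormal e" and c: "summable (\<lambda>i. (cmod (c i))\<^sup>2)"
  shows "summable (\<lambda>i. c i *\<^sub>C e i)"
  unfolding summable_Cauchy
proof (intro allI impI)
  fix \<epsilon> :: real assume \<epsilon>: "\<epsilon> > 0"
  then have "\<epsilon>\<^sup>2 > 0" by simp
  then obtain N where N: "\<forall>m\<ge>N. \<forall>n. norm (\<Sum>i=m..<n. (cmod (c i))\<^sup>2) < \<epsilon>\<^sup>2"
    using c unfolding summable_Cauchy by blast
  have "norm (\<Sum>i=m..<n. c i *\<^sub>C e i) < \<epsilon>" if "m \<ge> N" for m n
  proof (rule power2_less_imp_less)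
    show "(norm (\<Sum>i=m..<n. c i *\<^sub>C e i))\<^sup>2 < \<epsilon>\<^sup>2"
      using N that by (simp add: norm_sum_orthonormal [OF e] sum_nonneg)
  qed (use \<epsilon> in simp)
  then show "\<exists>N. \<forall>m\<ge>N. \<forall>n. norm (\<Sum>i=m..<n. c i *\<^sub>C e i) < \<epsilon>" by blast
qed

lemma suminf_orthonormal:
  fixes e :: "nat \<Rightarrow> 'a::chilbert_space"
  assumes e: "orthonormal e" and c: "summable (\<lambda>i. (cmod (c i))\<^sup>2)"
  shows "(norm (\<Sum>i. c i *\<^sub>C e i))\<^sup>2 = (\<Sum>i. (cmod (c i))\<^sup>2)"
    and "cinner (\<Sum>i. c i *\<^sub>C e i) y = (\<Sum>i. c i * cinner (e i) y)"
    and "cinner (\<Sum>i. c i *\<^sub>C e i) (e j) = c j"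
proof -
  have lim: "(\<lambda>n. \<Sum>i<n. c i *\<^sub>C e i) \<longlonglongrightarrow> (\<Sum>i. c i *\<^sub>C e i)"
    using summable_orthonormal [OF assms] by (rule summable_LIMSEQ)
  have "(\<lambda>n. (norm (\<Sum>i<n. c i *\<^sub>C e i))\<^sup>2) \<longlonglongrightarrow> (norm (\<Sum>i. c i *\<^sub>C e i))\<^sup>2"
    by (intro tendsto_intros lim)
  then show "(norm (\<Sum>i. c i *\<^sub>C e i))\<^sup>2 = (\<Sum>i. (cmod (c i))\<^sup>2)"
    using summable_LIMSEQ [OF c] by (simp add: norm_sum_orthonormal [OF e] LIMSEQ_unique)
  have "(\<lambda>n. cinner (\<Sum>i<n. c i *\<^sub>C e i) y) \<longlonglongrightarrow> cinner (\<Sum>i. c i *\<^sub>C e i) y" for y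
    by (intro tendsto_cinner lim tendsto_const)
  then have "(\<lambda>i. c i * cinner (e i) y) sums cinner (\<Sum>i. c i *\<^sub>C e i) y" for y
    by (simp add: sums_def cinner_sum_left cinner_scaleC_left)
  then show *: "cinner (\<Sum>i. c i *\<^sub>C e i) y = (\<Sum>i. c i * cinner (e i) y)" for y
    by (rule sums_unique)
  have "(\<Sum>i. c i * cinner (e i) (e j)) = (\<Sum>i\<in>{j}. c i * cinner (e i) (e j))"
    using e by (intro suminf_finite) (auto simp: orthonormal_def)
  then show "cinner (\<Sum>i. c i *\<^sub>C e i) (e j) = c j"
    using e by (simp add: * orthonormal_def)
qed

text \<open>The isometry sends \<open>e\<^sub>i\<close> to \<open>e\<^sub>i\<^sub>+\<^sub>k\<close> and is the identity on the orthogonal complement of the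
  sequence. It frees \<open>k\<close> dimensions while fixing every vector orthogonal to the sequence.\<close>

lemma shift_along_orthonormal_exists:
  fixes e :: "nat \<Rightarrow> 'a::chilbert_space"
  assumes e: "orthonormal e"
  shows "\<exists>W :: 'a \<Rightarrow> 'a. bclinear W \<and> (\<forall>x. norm (W x) = norm x) \<and>
    (\<forall>x. (\<forall>i. cinner x (e i) = 0) \<longrightarrow> W x = x) \<and> (\<forall>x. \<forall>j<k. cinner (W x) (e j) = 0)"
proof -
  have e': "orthonormal (\<lambda>i. e (i + k))"
    using e by (simp add: orthonormal_def)
  note sq = summable_bessel [OF e]
  define U where "U x = (\<Sum>i. cinner x (e i) *\<^sub>C e i)" for x
  define T where "T x = (\<Sum>i. cinner x (e i) *\<^sub>C e (i + k))" for x
  define W where "W x = x - U x + T x" for x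
  note sU = summable_orthonormal [OF e sq] and sT = summable_orthonormal [OF e' sq]
  have p: "cinner (x - U x) (e j) = 0" for x j
    by (simp add: U_def cinner_diff_left suminf_orthonormal(3) [OF e sq])
  have p': "cinner (e j) (x - U x) = 0" for x j
    using p cinner_commute [of "e j"] by simp
  have "cinner (U x) (x - U x) = 0" "cinner (T x) (x - U x) = 0" for x
    using suminf_orthonormal(2) [OF e sq, of x "x - U x"] suminf_orthonormal(2) [OF e' sq, of x "x - U x"]
    by (simp_all add: p' flip: U_def T_def)
  then have orth: "cinner (x - U x) (U x) = 0" "cinner (x - U x) (T x) = 0" for x
    using cinner_commute [of "x - U x"] by simp_all
  have "(norm (W x))\<^sup>2 = (norm x)\<^sup>2" for x
  proof -
    have "(norm (W x))\<^sup>2 = (norm (x - U x))\<^sup>2 + (norm (T x))\<^sup>2"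
      unfolding W_def by (rule norm_add_square_orthogonal [OF orth(2)])
    moreover have "(norm x)\<^sup>2 = (norm (x - U x))\<^sup>2 + (norm (U x))\<^sup>2"
      using norm_add_square_orthogonal [OF orth(1), of x] by simp
    moreover have "(norm (T x))\<^sup>2 = (norm (U x))\<^sup>2"
      using suminf_orthonormal(1) [OF e sq, of x] suminf_orthonormal(1) [OF e' sq, of x]
      by (simp add: U_def T_def)
    ultimately show ?thesis by simp
  qed
  then have norm_W: "norm (W x) = norm x" for x
    by (simp add: power2_eq_iff_nonneg)
  have add: "U (x + y) = U x + U y" "T (x + y) = T x + T y" for x y
    unfolding U_def T_def
    by (simp_all add: suminf_add [OF sU sU] suminf_add [OF sT sT] cinner_add_left scaleC_add_left)
  have scale: "U (a *\<^sub>C x) = a *\<^sub>C U x" "T (a *\<^sub>C x) = a *\<^sub>C T x" for a x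
    unfolding U_def T_def
    by (simp_all add: bounded_linear.suminf [OF bounded_linear_scaleC sU] bounded_linear.suminf [OF bounded_linear_scaleC sT]
        cinner_scaleC_left scaleC_scaleC)
  have "bclinear W"
    by (rule bclinearI [where K = 1])
      (simp_all add: norm_W, simp_all add: W_def add scale scaleC_add_right scaleC_diff_right)
  moreover have "W x = x" if "\<forall>i. cinner x (e i) = 0" for x
    using that by (simp add: W_def U_def T_def)
  moreover have "cinner (W x) (e j) = 0" if "j < k" for x j
  proof -
    have "cinner (T x) (e j) = 0"
      using e that unfolding T_def suminf_orthonormal(2) [OF e' sq] by (simp add: orthonormal_def)
    then show ?thesis
      by (simp add: W_def cinner_add_left p)
  qed
  ultimately show ?thesis
    using norm_W by blast
qed

section \<open>An inequality for tuples with commuting dilations\<close>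

text \<open>The gap is the distance of \<open>V (r x)\<close> and \<open>r y\<close> for any unitary dilation \<open>V\<close> of \<open>T\<close>. It vanishes
  when \<open>T x = y\<close> and \<open>T\<close> preserves the norm of \<open>x\<close>.\<close>

definition dilation_gap :: "('h::complex_inner \<Rightarrow> 'h) \<Rightarrow> 'h \<Rightarrow> 'h \<Rightarrow> real" where
  "dilation_gap T x y = sqrt ((norm x)\<^sup>2 + (norm y)\<^sup>2 - 2 * Re (cinner (T x) y))"

text \<open>The total length of two chains of points of the dilating space. The first chain is
  \<open>V\<^sub>2 V\<^sub>3 r x\<^sub>0\<close>, \<open>V\<^sub>2 r y\<^sub>1\<close>, \<open>V\<^sub>2 V\<^sub>1 r x\<^sub>1 = V\<^sub>1 V\<^sub>2 r x\<^sub>1\<close>, \<open>V\<^sub>1 r (- y\<^sub>1)\<close>, \<open>V\<^sub>1 V\<^sub>1 r (- x\<^sub>1)\<close>.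
  The second chain is \<open>V\<^sub>3 V\<^sub>2 r x\<^sub>0\<close>, \<open>V\<^sub>3 r y\<^sub>0\<close>, \<open>V\<^sub>3 V\<^sub>1 r x\<^sub>0 = V\<^sub>1 V\<^sub>3 r x\<^sub>0\<close>, \<open>V\<^sub>1 r y\<^sub>1\<close>,
  \<open>V\<^sub>1 V\<^sub>1 r x\<^sub>1\<close>. Each step has the length of one gap because unitaries preserve
  distances.\<close>

definition total_gap :: "(nat \<Rightarrow> 'h::complex_inner \<Rightarrow> 'h) \<Rightarrow> 'h \<Rightarrow> 'h \<Rightarrow> 'h \<Rightarrow> 'h \<Rightarrow> real" where
  "total_gap S x\<^sub>0 x\<^sub>1 y\<^sub>0 y\<^sub>1 =
    dilation_gap (S 3) x\<^sub>0 y\<^sub>1 + dilation_gap (S 1) x\<^sub>1 y\<^sub>1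
      + dilation_gap (S 2) x\<^sub>1 (- y\<^sub>1) + dilation_gap (S 1) (- x\<^sub>1) (- y\<^sub>1)
    + dilation_gap (S 2) x\<^sub>0 y\<^sub>0 + dilation_gap (S 1) x\<^sub>0 y\<^sub>0
      + dilation_gap (S 3) x\<^sub>0 y\<^sub>1 + dilation_gap (S 1) x\<^sub>1 y\<^sub>1"

context unitaries_with_isometry
begin

lemma hnorm_r: "Re \<langle>r x, r x\<rangle> = (norm x)\<^sup>2"
proof -
  have "hnorm K (r x) = norm x"
    using isometry by (simp add: isometry_into_def)
  then show ?thesis
    using real_sqrt_pow2 [OF inner_self_nonneg [OF r(1) [of x]]] by (simp add: hnorm_def)
qed

end

text \<open>The adjoint is defined by a definite description, so this needs the existence of a
  representing vector for \<open>x \<mapsto> \<langle>r x, y\<rangle>\<close>, which the Riesz theorem supplies.\<close>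

lemma cinner_hadjoint:
  fixes r :: "'h::chilbert_space \<Rightarrow> 'k"
  assumes "hilbert K" and r: "isometry_into K r" and y: "y \<in> hcarrier K"
  shows "cinner x (hadjoint K r y) = hinner K (r x) y"
proof -
  interpret hilbert K by fact
  have rD: "r x \<in> C" "r (x + z) = r x \<oplus> r z" "r (a *\<^sub>C x) = a \<odot> r x" "hnorm K (r x) = norm x" for x z a
    using r by (auto simp: isometry_into_def)
  have "cmod \<langle>r x, y\<rangle> \<le> hnorm K y * norm x" for x
  proof (cases "\<langle>r x, y\<rangle> = 0")
    case True
    have "0 \<le> hnorm K y"
      using inner_self_nonneg [OF y] by (simp add: hnorm_def)
    then show ?thesis using True by simp
  next
    case False
    \<comment> \<open>Rotating \<open>x\<close> makes the inner product real and nonnegative, which reduces the bound on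
          its modulus to one on its real part.\<close>
    define a where "a = cnj \<langle>r x, y\<rangle> / cmod \<langle>r x, y\<rangle>"
    have a: "cmod a = 1"
      using False by (simp add: a_def norm_divide)
    have "a * \<langle>r x, y\<rangle> = cmod \<langle>r x, y\<rangle>"
      using False by (simp add: a_def mult.commute [of "cnj _"] complex_norm_square [symmetric]
          power2_eq_square)
    then have "cmod \<langle>r x, y\<rangle> = Re \<langle>r (a *\<^sub>C x), y\<rangle>"
      using y by (simp add: rD inner_scale_left)
    also have "\<dots> \<le> hnorm K (r (a *\<^sub>C x)) * hnorm K y"
      by (intro Re_inner_le rD y)
    also have "\<dots> = hnorm K y * norm x"
      by (simp add: rD(4) norm_scaleC a)
    finally show ?thesis .
  qed
  then have "\<exists>z. \<forall>x. \<langle>r x, y\<rangle> = cinner x z"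
    using y by (intro riesz [where B = "hnorm K y"]) (simp_all add: rD inner_add_left inner_scale_left)
  then obtain z where z: "\<And>x. \<langle>r x, y\<rangle> = cinner x z" by blast
  have "hadjoint K r y = z"
    unfolding hadjoint_def z by (rule the_equality) (auto intro: cinner_eqI)
  then show ?thesis by (simp add: z)
qed

lemma hdist_dilation:
  fixes S :: "nat \<Rightarrow> 'h::chilbert_space \<Rightarrow> 'h"
  assumes D: "free_unitary_dilation d S K r V" and i: "i \<in> {1..d}"
  shows "hdist K (V i (r x)) (r y) = dilation_gap (S i) x y"
proof -
  interpret unitaries_with_isometry K d r V
    using D by (simp add: free_unitary_dilation_def unitaries_with_isometry_def
        unitaries_with_isometry_axioms_def)
  note V = unitary_onD [OF unitary [OF i]]
  have "word_prod S [(i, 1)] = hadjoint K r \<circ> word_prod V [(i, 1)] \<circ> r"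
    using D i by (simp add: free_unitary_dilation_def)
  then have "S i x = hadjoint K r (V i (r x))"
    by (simp add: word_prod_def fun_eq_iff)
  then have "cinner y (S i x) = \<langle>r y, V i (r x)\<rangle>"
    using cinner_hadjoint [OF hilbert_axioms isometry V(1) [OF r(1)]] by simp
  then have "Re \<langle>V i (r x), r y\<rangle> = Re (cinner (S i x) y)"
    using Re_commute [OF V(1) [OF r(1)] r(1), of x y] Re_cinner_commute [of "S i x" y] by simp
  then have "(hdist K (V i (r x)) (r y))\<^sup>2 = (norm x)\<^sup>2 + (norm y)\<^sup>2 - 2 * Re (cinner (S i x) y)"
    using V(1,4) r(1) by (simp add: hdist_sq hnorm_r)
  then show ?thesis
    using hdist_nonneg [OF V(1) [OF r(1)] r(1)] unfolding dilation_gap_def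
    by (metis real_sqrt_unique)
qed

text \<open>When the unitaries commute, both chains start at the same point, and their ends are
  at distance \<open>2 \<parallel>x\<^sub>1\<parallel>\<close>.\<close>

lemma commuting_dilation_inequality:
  fixes S :: "nat \<Rightarrow> 'h::chilbert_space \<Rightarrow> 'h"
  assumes D: "free_unitary_dilation d S K r V" and comm: "commuting_on d K V" and d: "3 \<le> d"
  shows "2 * norm x\<^sub>1 \<le> total_gap S x\<^sub>0 x\<^sub>1 y\<^sub>0 y\<^sub>1"
proof -
  interpret unitaries_with_isometry K d r V
    using D by (simp add: free_unitary_dilation_def unitaries_with_isometry_def
        unitaries_with_isometry_axioms_def)
  have i: "1 \<in> {1..d}" "2 \<in> {1..d}" "3 \<in> {1..d}" using d by auto
  have closed: "V i z \<in> C" if "i \<in> {1..d}" "z \<in> C" for i z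
    using unitary_onD(1) [OF unitary] that by blast
  have V: "hdist K (V j (V i (r x))) (V j (r y)) = dilation_gap (S i) x y"
    "hdist K (V j (r y)) (V j (V i (r x))) = dilation_gap (S i) x y"
    if "i \<in> {1..d}" "j \<in> {1..d}" for i j x y
    using hdist_unitary [OF unitary [OF that(2)] closed [OF that(1) r(1)] r(1), of x y]
      hdist_commute [OF closed [OF that(2) closed [OF that(1) r(1)]] closed [OF that(2) r(1)], of x y]
    by (simp_all add: hdist_dilation [OF D that(1)])
  have c: "V i (V j z) = V j (V i z)" if "i \<in> {1..d}" "j \<in> {1..d}" "z \<in> C" for i j z
    using comm that by (simp add: commuting_on_def)
  have tri: "hdist K u w \<le> hdist K u v + hdist K v w" if "u \<in> C" "v \<in> C" "w \<in> C" for u v w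
    using hdist_triangle that by blast
  note cl = closed [OF i(1)] closed [OF i(2)] closed [OF i(3)] r(1)
  let ?p = "V 2 (V 3 (r x\<^sub>0))"
  have "hdist K ?p (V 1 (V 1 (r (- x\<^sub>1)))) \<le> dilation_gap (S 3) x\<^sub>0 y\<^sub>1 + dilation_gap (S 1) x\<^sub>1 y\<^sub>1
      + dilation_gap (S 2) x\<^sub>1 (- y\<^sub>1) + dilation_gap (S 1) (- x\<^sub>1) (- y\<^sub>1)"
  proof -
    have "hdist K ?p (V 2 (r y\<^sub>1)) = dilation_gap (S 3) x\<^sub>0 y\<^sub>1"
      by (rule V i)+
    moreover have "hdist K (V 2 (r y\<^sub>1)) (V 2 (V 1 (r x\<^sub>1))) = dilation_gap (S 1) x\<^sub>1 y\<^sub>1"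
      by (rule V i)+
    moreover have "hdist K (V 2 (V 1 (r x\<^sub>1))) (V 1 (r (- y\<^sub>1))) = dilation_gap (S 2) x\<^sub>1 (- y\<^sub>1)"
      unfolding c [OF i(2,1) r(1)] by (rule V i)+
    moreover have "hdist K (V 1 (r (- y\<^sub>1))) (V 1 (V 1 (r (- x\<^sub>1)))) = dilation_gap (S 1) (- x\<^sub>1) (- y\<^sub>1)"
      by (rule V i)+
    moreover have "hdist K ?p (V 2 (V 1 (r x\<^sub>1))) \<le> hdist K ?p (V 2 (r y\<^sub>1)) + hdist K (V 2 (r y\<^sub>1)) (V 2 (V 1 (r x\<^sub>1)))"
      "hdist K ?p (V 1 (r (- y\<^sub>1))) \<le> hdist K ?p (V 2 (V 1 (r x\<^sub>1))) + hdist K (V 2 (V 1 (r x\<^sub>1))) (V 1 (r (- y\<^sub>1)))"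
      "hdist K ?p (V 1 (V 1 (r (- x\<^sub>1)))) \<le> hdist K ?p (V 1 (r (- y\<^sub>1))) + hdist K (V 1 (r (- y\<^sub>1))) (V 1 (V 1 (r (- x\<^sub>1))))"
      by (intro tri cl)+
    ultimately show ?thesis by linarith
  qed
  moreover have "hdist K ?p (V 1 (V 1 (r x\<^sub>1))) \<le> dilation_gap (S 2) x\<^sub>0 y\<^sub>0 + dilation_gap (S 1) x\<^sub>0 y\<^sub>0
      + dilation_gap (S 3) x\<^sub>0 y\<^sub>1 + dilation_gap (S 1) x\<^sub>1 y\<^sub>1"
  proof -
    have "hdist K ?p (V 3 (r y\<^sub>0)) = dilation_gap (S 2) x\<^sub>0 y\<^sub>0"
      unfolding c [OF i(2,3) r(1)] by (rule V i)+
    moreover have "hdist K (V 3 (r y\<^sub>0)) (V 3 (V 1 (r x\<^sub>0))) = dilation_gap (S 1) x\<^sub>0 y\<^sub>0"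
      by (rule V i)+
    moreover have "hdist K (V 3 (V 1 (r x\<^sub>0))) (V 1 (r y\<^sub>1)) = dilation_gap (S 3) x\<^sub>0 y\<^sub>1"
      unfolding c [OF i(3,1) r(1)] by (rule V i)+
    moreover have "hdist K (V 1 (r y\<^sub>1)) (V 1 (V 1 (r x\<^sub>1))) = dilation_gap (S 1) x\<^sub>1 y\<^sub>1"
      by (rule V i)+
    moreover have "hdist K ?p (V 3 (V 1 (r x\<^sub>0))) \<le> hdist K ?p (V 3 (r y\<^sub>0)) + hdist K (V 3 (r y\<^sub>0)) (V 3 (V 1 (r x\<^sub>0)))"
      "hdist K ?p (V 1 (r y\<^sub>1)) \<le> hdist K ?p (V 3 (V 1 (r x\<^sub>0))) + hdist K (V 3 (V 1 (r x\<^sub>0))) (V 1 (r y\<^sub>1))"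
      "hdist K ?p (V 1 (V 1 (r x\<^sub>1))) \<le> hdist K ?p (V 1 (r y\<^sub>1)) + hdist K (V 1 (r y\<^sub>1)) (V 1 (V 1 (r x\<^sub>1)))"
      by (intro tri cl)+
    ultimately show ?thesis by linarith
  qed
  moreover have "hdist K (V 1 (V 1 (r x\<^sub>1))) (V 1 (V 1 (r (- x\<^sub>1)))) \<le>
      hdist K ?p (V 1 (V 1 (r x\<^sub>1))) + hdist K ?p (V 1 (V 1 (r (- x\<^sub>1))))"
    unfolding hdist_commute [of ?p "V 1 (V 1 (r x\<^sub>1))", OF cl(2) [OF cl(3) [OF cl(4)]] cl(1) [OF cl(1) [OF cl(4)]]]
    by (intro tri cl)
  moreover have "hdist K (V 1 (V 1 (r x\<^sub>1))) (V 1 (V 1 (r (- x\<^sub>1)))) = 2 * norm x\<^sub>1"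
  proof -
    have "hdist K (V 1 (V 1 (r x\<^sub>1))) (V 1 (V 1 (r (- x\<^sub>1)))) = hdist K (r x\<^sub>1) (r (- x\<^sub>1))"
      by (simp only: hdist_unitary [OF unitary [OF i(1)]] cl)
    moreover have "r (- x\<^sub>1) = (-1) \<odot> r x\<^sub>1"
      using r(3) [of "-1" x\<^sub>1] by simp
    ultimately have "(hdist K (V 1 (V 1 (r x\<^sub>1))) (V 1 (V 1 (r (- x\<^sub>1)))))\<^sup>2 = (2 * norm x\<^sub>1)\<^sup>2"
      using r(1) [of x\<^sub>1] hnorm_r [of x\<^sub>1] by (simp add: hdist_sq inner_scale_left inner_scale_right scale_closed)
    then show ?thesis
      by (rule power2_eq_imp_eq) (intro hdist_nonneg cl mult_nonneg_nonneg norm_ge_zero zero_le_numeral)+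
  qed
  ultimately show ?thesis unfolding total_gap_def by linarith
qed

section \<open>Density of the tuples that violate the inequality\<close>

text \<open>Parrott's triple. With respect to \<open>(e\<^sub>0, e\<^sub>1)\<close> and \<open>(e\<^sub>2, e\<^sub>3)\<close> the first two operators are the identity and
  \<open>diag (1, -1)\<close>; of the flip, the third operator keeps only \<open>e\<^sub>0 \<mapsto> e\<^sub>3\<close>, which is the part that enters
  the two chains. All products vanish, so the triple commutes. For \<open>x\<^sub>i = e\<^sub>i\<close> and \<open>y\<^sub>i = e\<^sub>2\<^sub>+\<^sub>i\<close> every gap
  in the total gap is zero.\<close>

definition parrott :: "(nat \<Rightarrow> 'h::complex_inner) \<Rightarrow> nat \<Rightarrow> 'h \<Rightarrow> 'h" where
  "parrott e i x =
    (if i = 1 then cinner x (e 0) *\<^sub>C e 2 + cinner x (e 1) *\<^sub>C e 3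
     else if i = 2 then cinner x (e 0) *\<^sub>C e 2 - cinner x (e 1) *\<^sub>C e 3
     else if i = 3 then cinner x (e 0) *\<^sub>C e 3
     else 0)"

lemma parrott_add: "parrott e i (x + y) = parrott e i x + parrott e i y"
  by (simp add: parrott_def cinner_add_left scaleC_add_left algebra_simps)

lemma parrott_scale: "parrott e i (a *\<^sub>C x) = a *\<^sub>C parrott e i x"
  by (simp add: parrott_def cinner_scaleC_left scaleC_add_right scaleC_diff_right scaleC_scaleC)

lemma parrott_eq_0: "cinner x (e 0) = 0 \<Longrightarrow> cinner x (e 1) = 0 \<Longrightarrow> parrott e i x = 0"
  by (simp add: parrott_def)

lemma cinner_parrott_eq_0:
  assumes "cinner z (e 2) = 0" "cinner z (e 3) = 0"
  shows "cinner z (parrott e i x) = 0"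
  using assms by (simp add: parrott_def cinner_algebra)

lemma parrott_parrott:
  assumes "orthonormal e"
  shows "parrott e i (parrott e j x) = 0"
proof (rule parrott_eq_0)
  show "cinner (parrott e j x) (e 0) = 0" "cinner (parrott e j x) (e 1) = 0"
    using assms by (simp_all add: parrott_def cinner_algebra orthonormal_def)
qed

lemma norm_parrott_le:
  assumes e: "orthonormal e"
  shows "(norm (parrott e i x))\<^sup>2 \<le> (cmod (cinner x (e 0)))\<^sup>2 + (cmod (cinner x (e 1)))\<^sup>2"
proof -
  have n: "norm (e j) = 1" for j
    using e by (simp add: norm_eq_sqrt_cinner orthonormal_def)
  have "cinner (a *\<^sub>C e 2) (b *\<^sub>C e 3) = 0" for a b
    using e by (simp add: cinner_scaleC_left cinner_scaleC_right orthonormal_def)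
  then show ?thesis
    by (simp add: parrott_def norm_add_square norm_diff_square norm_scaleC n)
qed

lemma strictly_noncommuting_if_total_gap_less:
  fixes S :: "nat \<Rightarrow> 'h::chilbert_space \<Rightarrow> 'h"
  assumes "3 \<le> d" "total_gap S x\<^sub>0 x\<^sub>1 y\<^sub>0 y\<^sub>1 < 2 * norm x\<^sub>1"
  shows "strictly_noncommuting d S"
  unfolding strictly_noncommuting_def
proof (intro notI, elim exE conjE)
  fix K :: "(nat \<Rightarrow> 'h) hilbert" and r V
  assume "free_unitary_dilation d S K r V" "commuting_on d K V"
  from commuting_dilation_inequality [OF this assms(1), of x\<^sub>1 x\<^sub>0 y\<^sub>0 y\<^sub>1] show False
    using assms(2) by simp
qed

lemma set_monomial_word: "fst ` set (map (\<lambda>i. (i, n i)) [1..<Suc d]) = {1..d}"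
  by force

text \<open>The perturbed tuple is \<open>R\<^sub>i = W S\<^sub>i W\<^sup>* + A\<^sub>i\<close>, where the isometry \<open>W\<close> fixes \<open>F\<close> and has range orthogonal
  to \<open>e\<^sub>0, \<dots>, e\<^sub>3\<close>, and \<open>A\<close> is Parrott's triple on these four vectors. The two summands live on orthogonal
  reducing subspaces, so contractivity and commutativity are inherited, and \<open>R\<^sub>i W = W S\<^sub>i\<close> carries every
  monomial in \<open>S\<close> to the same monomial in \<open>R\<close>.\<close>

lemma noncommuting_perturbation_exists:
  fixes S :: "nat \<Rightarrow> 'h::chilbert_space \<Rightarrow> 'h"
  assumes inf: "infinite_dimensional TYPE('h)" and d: "3 \<le> d"
    and S: "S \<in> commuting_contractions d" and F: "finite F"
  shows "\<exists>S'\<in>commuting_contractions d.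
    (\<forall>n. \<forall>x\<in>F. \<forall>y\<in>F. cinner (monomial d S' n x) y = cinner (monomial d S n x) y) \<and>
    (\<exists>x\<^sub>0 x\<^sub>1 y\<^sub>0 y\<^sub>1. total_gap S' x\<^sub>0 x\<^sub>1 y\<^sub>0 y\<^sub>1 < 2 * norm x\<^sub>1)"
proof -
  have SD: "bclinear (S i)" "norm (S i x) \<le> norm x" "S i (S j x) = S j (S i x)"
    if "i \<in> {1..d}" "j \<in> {1..d}" for i j x
    using S that by (auto simp: commuting_contractions_def PiE_iff contraction_iff fun_eq_iff)
  obtain e :: "nat \<Rightarrow> 'h" where e: "orthonormal e" "\<And>x i. x \<in> F \<Longrightarrow> cinner x (e i) = 0"
    using orthonormal_sequence_exists [OF inf F] by blast
  have on: "cinner (e i) (e j) = (if i = j then 1 else 0)" for i j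
    using e(1) by (simp add: orthonormal_def)
  have norm_e: "norm (e i) = 1" for i
    by (simp add: norm_eq_sqrt_cinner on)
  obtain W where W: "bclinear W" "\<And>x. norm (W x) = norm x"
    "\<And>x. \<forall>i. cinner x (e i) = 0 \<Longrightarrow> W x = x" "\<And>x j. j < 4 \<Longrightarrow> cinner (W x) (e j) = 0"
    using shift_along_orthonormal_exists [OF e(1), of 4] by blast
  define W' where "W' = adjoint_op W"
  have W': "bclinear W'"
    unfolding W'_def by (rule bclinear_adjoint [OF W(1)])
  have W'W: "W' (W x) = x" for x
    unfolding W'_def by (rule adjoint_isometry [OF W(1) cinner_isometry [OF W(1,2)]])
  have eW: "cinner (e j) (W x) = 0" if "j < 4" for j x
    using W(4) [OF that] cinner_commute [of "e j"] by simp
  have W'_eq_0: "W' y = 0" if "\<And>x. cinner (W x) y = 0" for y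
    by (rule cinner_eqI) (simp add: W'_def cinner_adjoint_right [OF W(1)] that)
  have W'e: "W' (e j) = 0" if "j < 4" for j
    by (rule W'_eq_0) (rule W(4) [OF that])
  have W_parrott: "cinner (W x) (parrott e i y) = 0" for i x y
    by (rule cinner_parrott_eq_0) (simp_all add: W(4))
  have W'_parrott: "W' (parrott e i y) = 0" for i y
    by (rule W'_eq_0) (rule W_parrott)
  have parrott_W: "parrott e i (W x) = 0" for i x
    by (rule parrott_eq_0) (simp_all add: W(4))
  define R where "R i x = W (S i (W' x)) + parrott e i x" for i x
  have norm_R: "norm (R i x) \<le> norm x" if i: "i \<in> {1..d}" for i x
  proof (rule power2_le_imp_le)
    let ?q = "x - W (W' x)"
    have "cinner x (W (W' x)) = cinner (W' x) (W' x)"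
      by (simp add: W'_def cinner_adjoint_left [OF W(1)])
    then have "cinner x (W (W' x)) = cinner (W (W' x)) (W (W' x))"
      by (simp add: cinner_isometry [OF W(1,2)])
    then have "cinner ?q (W (W' x)) = 0"
      by (simp add: cinner_diff_left)
    from norm_add_square_orthogonal [OF this]
    have x: "(norm x)\<^sup>2 = (norm ?q)\<^sup>2 + (norm (W' x))\<^sup>2"
      by (simp add: W(2))
    have "cinner ?q (e j) = cinner x (e j)" if "j < 4" for j
      using W(4) [OF that] by (simp add: cinner_diff_left)
    then have "(cmod (cinner x (e 0)))\<^sup>2 + (cmod (cinner x (e 1)))\<^sup>2 \<le> (norm ?q)\<^sup>2"
      using bessel [OF e(1), of ?q 2] by (simp add: numeral_2_eq_2)
    then have "(norm (parrott e i x))\<^sup>2 \<le> (norm ?q)\<^sup>2"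
      using norm_parrott_le [OF e(1), of i x] by linarith
    moreover have "(norm (S i (W' x)))\<^sup>2 \<le> (norm (W' x))\<^sup>2"
      using SD(2) [OF i i] by (intro power_mono) auto
    moreover have "(norm (R i x))\<^sup>2 = (norm (S i (W' x)))\<^sup>2 + (norm (parrott e i x))\<^sup>2"
      unfolding R_def by (simp add: norm_add_square_orthogonal [OF W_parrott] W(2))
    ultimately show "(norm (R i x))\<^sup>2 \<le> (norm x)\<^sup>2"
      using x by linarith
  qed simp
  have bR: "bclinear (R i)" if i: "i \<in> {1..d}" for i
    using norm_R [OF i]
    by (intro bclinearI [where K = 1])
      (simp_all add: R_def bclinearD [OF W(1)] bclinearD [OF W'] bclinearD [OF SD(1) [OF i i]]
        parrott_add parrott_scale scaleC_add_right)
  have RR: "R i (R j x) = W (S i (S j (W' x)))" if "i \<in> {1..d}" "j \<in> {1..d}" for i j x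
    by (simp add: R_def bclinearD [OF W'] W'W W'_parrott parrott_add parrott_W parrott_parrott [OF e(1)])
  define S' where "S' = restrict R {1..d}"
  have S': "S' i = R i" if "i \<in> {1..d}" for i
    using that by (simp add: S'_def)
  have mem: "S' \<in> commuting_contractions d"
    using bR norm_R SD(3)
    by (auto simp: commuting_contractions_def S'_def contraction_iff fun_eq_iff RR)
  have WS: "W (S i x) = S' i (W x)" if "i \<in> {1..d}" for i x
    using that by (simp add: S' R_def W'W parrott_W)
  have "cinner (monomial d S' n x) y = cinner (monomial d S n x) y" if "x \<in> F" "y \<in> F" for n x y
  proof -
    have "W x = x" "W y = y" using W(3) e(2) that by auto
    moreover have "W (monomial d S n x) = monomial d S' n (W x)"
      unfolding monomial_def by (rule word_prod_intertwine) (simp only: set_monomial_word WS)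
    ultimately have "cinner (monomial d S' n x) y = cinner (W (monomial d S n x)) (W y)"
      by simp
    then show ?thesis by (simp add: cinner_isometry [OF W(1,2)])
  qed
  moreover have "total_gap S' (e 0) (e 1) (e 2) (e 3) = 0"
  proof -
    have "S' i (e j) = parrott e i (e j)" if "i \<in> {1..d}" "j < 4" for i j
      using that by (simp add: S' R_def W'e bclinearD(4) [OF W(1)] bclinearD(4) [OF SD(1)])
    moreover have "S' i (- e j) = - S' i (e j)" if "i \<in> {1..d}" for i j
      using that by (simp add: S' bclinearD(3) [OF bR])
    moreover have "(1::nat) \<in> {1..d}" "2 \<in> {1..d}" "3 \<in> {1..d}"
      using d by auto
    ultimately show ?thesis
      by (simp add: total_gap_def dilation_gap_def norm_e parrott_def on cinner_algebra)
  qed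
  then have "total_gap S' (e 0) (e 1) (e 2) (e 3) < 2 * norm (e 1)"
    by (simp add: norm_e)
  ultimately show ?thesis
    using mem by blast
qed

section \<open>Openness in the weak polynomial topology\<close>

lemma word_prod_single:
  assumes "distinct xs"
  shows "word_prod S (map (\<lambda>j. (j, if j = i then 1 else 0)) xs) = (if i \<in> set xs then S i else id)"
  using assms by (induction xs) (auto simp: word_prod_def)

lemma monomial_single: "i \<in> {1..d} \<Longrightarrow> monomial d S (\<lambda>j. if j = i then 1 else 0) = S i"
  unfolding monomial_def by (subst word_prod_single) auto

lemma continuous_map_cinner_component:
  fixes x y :: "'h::complex_inner"
  assumes i: "i \<in> {1..d}"
  shows "continuous_map (weak_polynomial_topology d) euclidean (\<lambda>S. cinner (S i x) y)"
proof -
  have "continuous_map euclidean euclidean (\<lambda>f :: 'h \<Rightarrow> 'h \<Rightarrow> complex. f x y)"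
    unfolding continuous_map_iff_continuous2
    by (rule continuous_on_product_then_coordinatewise [OF continuous_on_product_coordinates])
  then have "continuous_map weak_operator_topology euclidean ((\<lambda>f. f x y) \<circ> (\<lambda>T (x::'h) (y::'h). cinner (T x) y))"
    unfolding weak_operator_topology_def by (rule continuous_map_pullback)
  then have 1: "continuous_map weak_operator_topology euclidean (\<lambda>T. cinner (T x) y)"
    by (simp add: o_def)
  have "continuous_map (product_topology (\<lambda>_. weak_operator_topology) UNIV) weak_operator_topology
      (\<lambda>f :: (nat \<Rightarrow> nat) \<Rightarrow> 'h \<Rightarrow> 'h. f (\<lambda>j. if j = i then 1 else 0))"
    by (rule continuous_map_product_projection) simp
  from continuous_map_compose [OF this 1]
  have "continuous_map (weak_polynomial_topology d) euclidean
      (((\<lambda>T. cinner (T x) y) \<circ> (\<lambda>f :: (nat \<Rightarrow> nat) \<Rightarrow> 'h \<Rightarrow> 'h. f (\<lambda>j. if j = i then 1 else 0))) \<circ> monomial d)"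
    unfolding weak_polynomial_topology_def by (rule continuous_map_pullback)
  then show ?thesis
    using i by (simp add: o_def monomial_single)
qed

lemma continuous_map_dilation_gap:
  assumes "i \<in> {1..d}"
  shows "continuous_map (weak_polynomial_topology d) euclideanreal (\<lambda>S. dilation_gap (S i) x y)"
proof -
  have "continuous_map (euclidean :: complex topology) euclideanreal
      (\<lambda>c. sqrt ((norm x)\<^sup>2 + (norm y)\<^sup>2 - 2 * Re c))"
    unfolding continuous_map_iff_continuous2 by (intro continuous_intros)
  from continuous_map_compose [OF continuous_map_cinner_component [OF assms, of x y] this]
  show ?thesis by (simp add: o_def dilation_gap_def)
qed

lemma openin_total_gap_less:
  assumes "3 \<le> d"
  shows "openin (weak_polynomial_topology d)
    {S \<in> commuting_contractions d. total_gap S x\<^sub>0 x\<^sub>1 y\<^sub>0 y\<^sub>1 < c}"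
proof -
  have "continuous_map (weak_polynomial_topology d) euclideanreal (\<lambda>S. total_gap S x\<^sub>0 x\<^sub>1 y\<^sub>0 y\<^sub>1)"
    unfolding total_gap_def
    using assms by (intro continuous_map_add continuous_map_dilation_gap) auto
  then have "openin (weak_polynomial_topology d)
      {S \<in> topspace (weak_polynomial_topology d). total_gap S x\<^sub>0 x\<^sub>1 y\<^sub>0 y\<^sub>1 \<in> {..<c}}"
    by (rule openin_continuous_map_preimage) simp
  then show ?thesis
    by (simp add: topspace_weak_polynomial_topology)
qed

text \<open>Choosing one perturbation for each finite set of vectors gives a net indexed by finite sets. Each
  matrix coefficient of each monomial is eventually constant along it, so the net converges to \<open>S\<close>
  in the weak polynomial topology and enters \<open>U\<close>.\<close>

lemma noncommuting_perturbation_in_open: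
  fixes U :: "(nat \<Rightarrow> 'h::chilbert_space \<Rightarrow> 'h) set"
  assumes inf: "infinite_dimensional TYPE('h)" and d: "3 \<le> d"
    and U: "openin (weak_polynomial_topology d) U" "S \<in> U"
  shows "\<exists>S'\<in>U. \<exists>x\<^sub>0 x\<^sub>1 y\<^sub>0 y\<^sub>1. total_gap S' x\<^sub>0 x\<^sub>1 y\<^sub>0 y\<^sub>1 < 2 * norm x\<^sub>1"
proof -
  have S: "S \<in> commuting_contractions d"
    using openin_subset [OF U(1)] U(2) by (auto simp: topspace_weak_polynomial_topology)
  define good where "good F S' \<longleftrightarrow> S' \<in> commuting_contractions d \<and>
    (\<forall>n. \<forall>x\<in>F. \<forall>y\<in>F. cinner (monomial d S' n x) y = cinner (monomial d S n x) y) \<and>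
    (\<exists>x\<^sub>0 x\<^sub>1 y\<^sub>0 y\<^sub>1. total_gap S' x\<^sub>0 x\<^sub>1 y\<^sub>0 y\<^sub>1 < 2 * norm x\<^sub>1)" for F S'
  have "\<exists>S'. good F S'" if "finite F" for F
    using noncommuting_perturbation_exists [OF inf d S that] unfolding good_def by blast
  then obtain s where s: "\<And>F. finite F \<Longrightarrow> good F (s F)"
    by metis
  have ev: "\<forall>\<^sub>F F in finite_subsets_at_top UNIV. finite F \<and> F0 \<subseteq> F" if "finite F0" for F0 :: "'h set"
    using that unfolding eventually_finite_subsets_at_top by blast
  have mem: "\<forall>\<^sub>F F in finite_subsets_at_top UNIV. s F \<in> commuting_contractions d"
    using ev [of "{}"] by (rule eventually_mono) (use s in \<open>auto simp: good_def\<close>)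
  have "limitin (weak_polynomial_topology d) s S (finite_subsets_at_top UNIV)"
    unfolding limitin_weak_polynomial_topology limitin_weak_operator_topology
  proof (intro conjI allI)
    show "\<forall>\<^sub>F F in finite_subsets_at_top UNIV. bounded_clinear (monomial d (s F) n)" for n
      using mem by (rule eventually_mono) (rule bounded_clinear_monomial)
    show "((\<lambda>F. cinner (monomial d (s F) n x) y) \<longlongrightarrow> cinner (monomial d S n x) y)
        (finite_subsets_at_top UNIV)" for n x y
    proof (rule tendsto_eventually)
      show "\<forall>\<^sub>F F in finite_subsets_at_top UNIV.
          cinner (monomial d (s F) n x) y = cinner (monomial d S n x) y"
        using ev [of "{x, y}"] by (rule eventually_mono) (use s in \<open>auto simp: good_def\<close>)
    qed
  qed (use S mem bounded_clinear_monomial in auto)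
  then have "\<forall>\<^sub>F F in finite_subsets_at_top UNIV. s F \<in> U"
    using U by (simp add: limitin_def)
  then have "\<forall>\<^sub>F F in finite_subsets_at_top UNIV. s F \<in> U \<and> finite F"
    using ev [of "{}"] by (auto elim: eventually_elim2)
  then obtain F where "s F \<in> U" "finite F"
    using eventually_happens' finite_subsets_at_top_neq_bot by blast
  then show ?thesis
    using s [of F] unfolding good_def by blast
qed

section \<open>Strictly non-commuting dilations are generic\<close>

text \<open>For \<open>d \<ge> 3\<close> the complement is not only meagre but nowhere dense: the sets on which the
  inequality fails are open, disjoint from the complement, and together dense.\<close>

theorem proposition6p4:
  fixes d :: nat
  assumes "d \<ge> 1"
  shows "(d \<le> 2 \<longrightarrow>
            strictly_noncommuting_tuples d = ({} :: (nat \<Rightarrow> 'h::chilbert_space \<Rightarrow> 'h) set)) \<and>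
         (d \<ge> 3 \<and> infinite_dimensional TYPE('h) \<longrightarrow>
            strictly_noncommuting_tuples d \<noteq> ({} :: (nat \<Rightarrow> 'h \<Rightarrow> 'h) set)) \<and>
         (d \<ge> 3 \<and> infinite_dimensional TYPE('h) \<and> separable_space (euclidean :: 'h topology) \<longrightarrow>
            residual_in (weak_polynomial_topology d)
              (strictly_noncommuting_tuples d :: (nat \<Rightarrow> 'h \<Rightarrow> 'h) set))"
proof (intro conjI impI)
  show "strictly_noncommuting_tuples d = ({} :: (nat \<Rightarrow> 'h \<Rightarrow> 'h) set)" if "d \<le> 2"
  proof -
    have False if "S \<in> commuting_contractions d" "strictly_noncommuting d S" for S :: "nat \<Rightarrow> 'h \<Rightarrow> 'h"
      using commuting_unitary_dilation_of_pair [OF assms \<open>d \<le> 2\<close> that(1)]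
        strictly_noncommutingD [OF that(2)] by blast
    then show ?thesis
      by (auto simp: strictly_noncommuting_tuples_def)
  qed
next
  assume "d \<ge> 3 \<and> infinite_dimensional TYPE('h)"
  then have d: "3 \<le> d" and inf: "infinite_dimensional TYPE('h)" by auto
  let ?X = "weak_polynomial_topology d :: (nat \<Rightarrow> 'h \<Rightarrow> 'h) topology"
  have "contraction (id :: 'h \<Rightarrow> 'h)"
    by (auto simp: contraction_iff intro!: bclinearI [where K = 1])
  then have "(\<lambda>i\<in>{1..d}. id) \<in> topspace ?X"
    by (simp add: topspace_weak_polynomial_topology commuting_contractions_def)
  then obtain S where "S \<in> topspace ?X" "\<exists>x\<^sub>0 x\<^sub>1 y\<^sub>0 y\<^sub>1. total_gap S x\<^sub>0 x\<^sub>1 y\<^sub>0 y\<^sub>1 < 2 * norm x\<^sub>1"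
    using noncommuting_perturbation_in_open [OF inf d openin_topspace] by blast
  then have "S \<in> strictly_noncommuting_tuples d"
    using strictly_noncommuting_if_total_gap_less [OF d]
    by (auto simp: strictly_noncommuting_tuples_def topspace_weak_polynomial_topology)
  then show "strictly_noncommuting_tuples d \<noteq> ({} :: (nat \<Rightarrow> 'h \<Rightarrow> 'h) set)"
    by blast
next
  assume "d \<ge> 3 \<and> infinite_dimensional TYPE('h) \<and> separable_space (euclidean :: 'h topology)"
  then have d: "3 \<le> d" and inf: "infinite_dimensional TYPE('h)" by auto
  let ?X = "weak_polynomial_topology d :: (nat \<Rightarrow> 'h \<Rightarrow> 'h) topology"
  let ?D = "topspace ?X - strictly_noncommuting_tuples d"
  have "?X interior_of (?X closure_of ?D) = {}"
  proof (rule ccontr)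
    assume "?X interior_of (?X closure_of ?D) \<noteq> {}"
    then obtain S where "S \<in> ?X interior_of (?X closure_of ?D)" by blast
    then obtain S' x\<^sub>0 x\<^sub>1 y\<^sub>0 y\<^sub>1 where S': "S' \<in> ?X interior_of (?X closure_of ?D)"
      and gap: "total_gap S' x\<^sub>0 x\<^sub>1 y\<^sub>0 y\<^sub>1 < 2 * norm x\<^sub>1"
      using noncommuting_perturbation_in_open [OF inf d openin_interior_of] by blast
    define U where "U = {T \<in> commuting_contractions d. total_gap T x\<^sub>0 x\<^sub>1 y\<^sub>0 y\<^sub>1 < 2 * norm x\<^sub>1}"
    have "openin ?X U"
      unfolding U_def by (rule openin_total_gap_less [OF d])
    have cl: "S' \<in> ?X closure_of ?D"
      using subsetD [OF interior_of_subset S'] .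
    then have "S' \<in> topspace ?X"
      by (rule subsetD [OF closure_of_subset_topspace])
    then have "S' \<in> U"
      using gap by (simp add: U_def topspace_weak_polynomial_topology)
    then obtain T where T: "T \<in> ?D" "T \<in> U"
      using cl \<open>openin ?X U\<close> unfolding in_closure_of by blast
    then have "T \<in> strictly_noncommuting_tuples d"
      using strictly_noncommuting_if_total_gap_less [OF d, of T x\<^sub>0 x\<^sub>1 y\<^sub>0 y\<^sub>1]
      by (simp add: strictly_noncommuting_tuples_def U_def)
    then show False using T(1) by blast
  qed
  then have "nowhere_dense_in ?X ?D"
    by (simp add: nowhere_dense_in_def)
  then show "residual_in ?X (strictly_noncommuting_tuples d)"
    unfolding residual_in_def meagre_in_def
    by (intro conjI exI [of _ "{?D}"])
      (auto simp: strictly_noncommuting_tuples_def topspace_weak_polynomial_topology)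
qed

end
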